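(* Let $\hat S$ and $\check S$ be the positively and negatively step-reinforced random walks with reinforcement parameter $p$ built from i.i.d. variables $X_1,X_2,\dots$ with $\mathbb{E}(X_1^2)<\infty$. Let $m_i=\mathbb{E}(X_1^i)$ for $i=1,2$, $\sigma^2=\mathrm{Var}(X_1)$, $\check\mu=\frac{(1-p)m_1}{1+p}$ and $\check\sigma^2=m_2-\left(\frac{(1-p)m_1}{1+p}\right)^2$ (with $\sigma,\check\sigma\ge0$). 1. For $p\in(0,1/2)$, $$\limsup_{n\to\infty}\frac{\hat S(n)-m_1n}{\sqrt{2n\log\log n}}=\frac{\sigma}{\sqrt{1-2p}}\quad\text{a.s.}$$ 2. For $p=1/2$, $$\limsup_{n\to\infty}\frac{\hat S(n)-m_1n}{\sqrt{2n\log n\,\log\log\log n}}=\sigma\quad\text{a.s.}$$ 3. For $p\in(0,1)$, $$\limsup_{n\to\infty}\frac{\check S(n)-\check\mu n}{\sqrt{2n\log\log n}}=\frac{\check\sigma}{\sqrt{2p+1}}\quad\text{a.s.}$$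
   Context: Let $\{X_n,n\ge1\}$ be i.i.d. real random variables, $\{\varepsilon_n,n\ge2\}$ i.i.d. Bernoulli variables with parameter $p$ (so $\mathbb{P}(\varepsilon_n=1)=p$), and for $n\ge2$ let $U_n$ be uniformly distributed on $\{1,\dots,n-1\}$; all the variables $X_1,X_2,\varepsilon_2,U_2,X_3,\varepsilon_3,U_3,\dots$ are independent. Positively step-reinforced walk: $\hat X_1=X_1$ and for $n\ge2$, $\hat X_n=X_n$ if $\varepsilon_n=0$, $\hat X_n=\hat X_{U_n}$ if $\varepsilon_n=1$; $\hat S(n)=\hat X_1+\dots+\hat X_n$. Negatively step-reinforced walk: $\check X_1=X_1$ and for $n\ge2$, $\check X_n=X_n$ if $\varepsilon_n=0$, $\check X_n=-\check X_{U_n}$ if $\varepsilon_n=1$; $\check S(n)=\check X_1+\dots+\check X_n$. *)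

theory Defs
  imports "HOL-Probability.Probability"
begin

text \<open>
  The steps of the two walks, pathwise, for a sequence \<open>x\<close> of innovations, a sequence \<open>e\<close> of
  reinforcement decisions (\<open>True\<close> for the value \<open>1\<close>) and a sequence \<open>u\<close> of chosen times.
  The test \<open>u n \<in> {1..<n}\<close> makes the recursion terminate; for uniform \<open>u n\<close> on
  \<open>{1..<n}\<close> it can fail only on a null set. Time starts at 1, the value at 0 is never used.
\<close>

fun pos_step :: "(nat \<Rightarrow> real) \<Rightarrow> (nat \<Rightarrow> bool) \<Rightarrow> (nat \<Rightarrow> nat) \<Rightarrow> nat \<Rightarrow> real" where
  "pos_step x e u n =
     (if n \<ge> 2 \<and> e n \<and> u n \<in> {1..<n} then pos_step x e u (u n) else x n)"

fun neg_step :: "(nat \<Rightarrow> real) \<Rightarrow> (nat \<Rightarrow> bool) \<Rightarrow> (nat \<Rightarrow> nat) \<Rightarrow> nat \<Rightarrow> real" where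
  "neg_step x e u n =
     (if n \<ge> 2 \<and> e n \<and> u n \<in> {1..<n} then - neg_step x e u (u n) else x n)"

declare pos_step.simps [simp del] neg_step.simps [simp del]

definition pos_walk ::
  "(nat \<Rightarrow> 'a \<Rightarrow> real) \<Rightarrow> (nat \<Rightarrow> 'a \<Rightarrow> bool) \<Rightarrow> (nat \<Rightarrow> 'a \<Rightarrow> nat) \<Rightarrow> nat \<Rightarrow> 'a \<Rightarrow> real" where
  "pos_walk X \<epsilon> U n \<omega> =
     (\<Sum>k=1..n. pos_step (\<lambda>i. X i \<omega>) (\<lambda>i. \<epsilon> i \<omega>) (\<lambda>i. U i \<omega>) k)"

definition neg_walk ::
  "(nat \<Rightarrow> 'a \<Rightarrow> real) \<Rightarrow> (nat \<Rightarrow> 'a \<Rightarrow> bool) \<Rightarrow> (nat \<Rightarrow> 'a \<Rightarrow> nat) \<Rightarrow> nat \<Rightarrow> 'a \<Rightarrow> real" where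
  "neg_walk X \<epsilon> U n \<omega> =
     (\<Sum>k=1..n. neg_step (\<lambda>i. X i \<omega>) (\<lambda>i. \<epsilon> i \<omega>) (\<lambda>i. U i \<omega>) k)"

datatype var_index = Innovation nat | Decision nat | Choice nat

text \<open>
  Since \<open>indep_vars\<close> needs a common value type, the decisions and chosen times are embedded into
  the reals for the joint independence assumption; these embeddings are injective and do not
  change the generated \<open>\<sigma>\<close>-algebras.
\<close>

locale step_reinforcement = prob_space M
  for M :: "'a measure" and p :: real
    and X :: "nat \<Rightarrow> 'a \<Rightarrow> real" and \<epsilon> :: "nat \<Rightarrow> 'a \<Rightarrow> bool" and U :: "nat \<Rightarrow> 'a \<Rightarrow> nat" +
  assumes p_bounds: "0 \<le> p" "p \<le> 1"
    and X_rv: "\<And>n. n \<ge> 1 \<Longrightarrow> random_variable borel (X n)"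
    and X_ident: "\<And>n. n \<ge> 1 \<Longrightarrow> distr M borel (X n) = distr M borel (X 1)"
    and eps_rv: "\<And>n. n \<ge> 2 \<Longrightarrow> random_variable (count_space UNIV) (\<epsilon> n)"
    and eps_bernoulli:
      "\<And>n. n \<ge> 2 \<Longrightarrow> distr M (count_space UNIV) (\<epsilon> n) = measure_pmf (bernoulli_pmf p)"
    and U_rv: "\<And>n. n \<ge> 2 \<Longrightarrow> random_variable (count_space UNIV) (U n)"
    and U_uniform:
      "\<And>n. n \<ge> 2 \<Longrightarrow> distr M (count_space UNIV) (U n) = measure_pmf (pmf_of_set {1..<n})"
    and indep:
      "indep_vars (\<lambda>_. borel :: real measure)
         (\<lambda>i. case i of
            Innovation n \<Rightarrow> X n
          | Decision n \<Rightarrow> (\<lambda>\<omega>. of_bool (\<epsilon> n \<omega>))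
          | Choice n \<Rightarrow> (\<lambda>\<omega>. real (U n \<omega>)))
         (Innovation ` {1..} \<union> Decision ` {2..} \<union> Choice ` {2..})"

end

theory Submission
  imports Defs "HOL-Real_Asymp.Real_Asymp"
begin

text \<open>
  Both walks are cases of one walk with a sign \<open>s = \<plusminus>1\<close> in the copying rule. With \<open>r = p s\<close>, the
  weights \<open>a\<^sub>n = \<Prod>\<^sub>i\<^sub>=\<^sub>1\<^sup>n\<^sup>-\<^sup>1 i / (i + r)\<close>, which behave like a constant times \<open>n\<^sup>-\<^sup>r\<close>, turn the centred walk into a
  martingale, and its conditional variances are asymptotic to deterministic ones by a strong law for
  the steps and their squares. Because a copied step has, up to sign, the law of \<open>X 1\<close>, the steps can be
  truncated at a level depending on the current time; with a second moment, the part cut off is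
  negligible on the scale of the law of the iterated logarithm. The remaining martingale has small
  bounded increments and an almost deterministic bracket: the upper bound follows from the exponential
  maximal inequality, the lower bound from exponential tilting on geometric blocks.
\<close>

section \<open>Exponential bounds for martingales with bounded increments\<close>

text \<open>The scales are dictated by the weights. The centred walk grows in conditional mean by
  the factor \<open>1 + r / n\<close>, so the bracket of the weighted martingale grows like the sum
  of \<open>n\<^sup>-\<^sup>2\<^sup>r\<close>: like
  \<open>n\<^sup>1\<^sup>-\<^sup>2\<^sup>r / (1 - 2 r)\<close> for \<open>r < 1 / 2\<close>, which
  produces the constants \<open>1 - 2 p\<close> and \<open>1 + 2 p\<close>, and like
  \<open>ln n\<close> for \<open>r = 1 / 2\<close>, which produces the additional logarithm. The
  constant in the asymptotics of \<open>a\<^sub>n\<close> is a Gamma value and cancels. Two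
  obstacles shape the proof. The bracket is close to a deterministic sequence only almost surely and
  eventually, while the exponential inequalities want bounds at every sample point; the increments
  are therefore altered on the exceptional events. And the blocks of the lower bound are dependent,
  so the block estimate is proved relative to an arbitrary event of the past. Throughout,
  conditional statements are identities of integrals against bounded test functions.\<close>

lemma exp_le_quadratic:
  fixes y :: real
  assumes "\<bar>y\<bar> \<le> \<beta>"
  shows "exp y \<le> 1 + y + y\<^sup>2 / 2 * exp \<beta>"
proof -
  obtain t where t: "\<bar>t\<bar> \<le> \<bar>y\<bar>" "exp y = (\<Sum>m<2. (y ^ m) / fact m) + (exp t / fact 2) * y ^ 2"
    using Maclaurin_exp_le[of y 2] by blast
  have "exp t \<le> exp \<beta>" using t(1) assms by simp
  then have "(exp t / 2) * y ^ 2 \<le> (exp \<beta> / 2) * y ^ 2" by (intro mult_right_mono) auto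
  then show ?thesis using t(2) by (simp add: numeral_2_eq_2 field_simps)
qed

text \<open>Keeping the Lagrange remainder as a factor \<open>exp \<beta>\<close> or
  \<open>exp (- \<beta>)\<close> on the square, instead of as a cubic error, makes both compensators
  exact multiples of the conditional variance.\<close>

lemma exp_ge_quadratic:
  fixes y :: real
  assumes "\<bar>y\<bar> \<le> \<beta>"
  shows "exp y \<ge> 1 + y + y\<^sup>2 / 2 * exp (- \<beta>)"
proof -
  obtain t where t: "\<bar>t\<bar> \<le> \<bar>y\<bar>" "exp y = (\<Sum>m<2. (y ^ m) / fact m) + (exp t / fact 2) * y ^ 2"
    using Maclaurin_exp_le[of y 2] by blast
  have "exp t \<ge> exp (- \<beta>)" using t(1) assms by simp
  then have "(exp t / 2) * y ^ 2 \<ge> (exp (- \<beta>) / 2) * y ^ 2" by (intro mult_right_mono) auto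
  then show ?thesis using t(2) by (simp add: numeral_2_eq_2 field_simps)
qed

text \<open>A logarithm bound with quadratic loss; it turns the factor \<open>1 + z\<close> left by
  the lower Taylor bound back into an exponential.\<close>

lemma one_plus_ge_exp:
  fixes y :: real
  assumes "0 \<le> y" "y \<le> 1"
  shows "exp (y * (1 - y)) \<le> 1 + y"
proof -
  have "y * (1 - y) \<le> ln (1 + y)"
    using ln_one_plus_pos_lower_bound[OF assms] by (simp add: power2_eq_square algebra_simps)
  then show ?thesis using assms by (metis add_pos_nonneg exp_le_cancel_iff exp_ln zero_less_one)
qed

lemma mult_exp_diff: "(h::real) * exp (a - b) = h * exp (- b) * exp a"
  by (simp add: exp_diff exp_minus field_simps)

section \<open>Filtrations and a maximal inequality with drift\<close>

locale filtered_prob_space = prob_space M for M :: "'a measure" +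
  fixes F :: "nat \<Rightarrow> 'a measure"
  assumes subalg: "subalgebra M (F n)"
    and sets_F_Suc: "sets (F n) \<subseteq> sets (F (Suc n))"
begin

lemma space_F [simp]: "space (F n) = space M"
  using subalg[of n] by (simp add: subalgebra_def)

lemma sets_F: "A \<in> sets (F n) \<Longrightarrow> A \<in> sets M"
  using subalg[of n] by (auto simp: subalgebra_def)

lemma sets_F_mono: "m \<le> n \<Longrightarrow> sets (F m) \<subseteq> sets (F n)"
  using lift_Suc_mono_le[of "\<lambda>n. sets (F n)"] sets_F_Suc by blast

lemma subalg_F: "m \<le> n \<Longrightarrow> subalgebra (F n) (F m)"
  using sets_F_mono by (simp add: subalgebra_def)

lemma meas_F_mono: "f \<in> measurable (F m) N \<Longrightarrow> m \<le> n \<Longrightarrow> f \<in> measurable (F n) N"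
  using measurable_from_subalg[OF subalg_F] by blast

lemma meas_F: "f \<in> measurable (F m) N \<Longrightarrow> f \<in> measurable M N"
  using measurable_from_subalg[OF subalg] by blast

text \<open>Decompose the event by the first time in \<open>{m..n}\<close> at which the level is
  reached. The drift \<open>d\<close> lets one inequality serve both the exponential
  supermartingales, with \<open>d = 0\<close>, and the squared averages in the strong law, with a
  summable drift.\<close>

lemma maximal_inequality:
  fixes Z :: "nat \<Rightarrow> 'a \<Rightarrow> real" and d :: "nat \<Rightarrow> real"
  assumes Z_meas: "\<And>n. Z n \<in> borel_measurable (F n)"
    and Z_nonneg: "\<And>n \<omega>. \<omega> \<in> space M \<Longrightarrow> 0 \<le> Z n \<omega>"
    and Z_int: "\<And>n. integrable M (Z n)"
    and step: "\<And>k A. m \<le> k \<Longrightarrow> k < n \<Longrightarrow> A \<in> sets (F k) \<Longrightarrow>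
      expectation (\<lambda>\<omega>. indicator A \<omega> * Z (Suc k) \<omega>) \<le> expectation (\<lambda>\<omega>. indicator A \<omega> * Z k \<omega>) + d k"
    and "m \<le> n"
  shows "\<epsilon> * prob {\<omega>\<in>space M. \<exists>i\<in>{m..n}. Z i \<omega> \<ge> \<epsilon>} \<le> expectation (Z m) + (\<Sum>i=m..<n. d i)"
proof -
  define A where "A n = {\<omega>\<in>space M. \<forall>i\<in>{m..n}. Z i \<omega> < \<epsilon>}" for n
  define B where "B n = {\<omega>\<in>space M. \<exists>i\<in>{m..n}. Z i \<omega> \<ge> \<epsilon>}" for n
  have [measurable]: "Z n \<in> borel_measurable M" for n using Z_meas meas_F by blast
  have A_F: "A n \<in> sets (F n)" for n
  proof -
    have [measurable]: "Z i \<in> borel_measurable (F n)" if "i \<in> {m..n}" for i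
      using that by (intro meas_F_mono[OF Z_meas, of i n]) auto
    have "{\<omega>\<in>space (F n). \<forall>i\<in>{m..n}. Z i \<omega> < \<epsilon>} \<in> sets (F n)" by measurable
    then show ?thesis by (simp add: A_def)
  qed
  then have [measurable]: "A n \<in> sets M" for n using sets_F by blast
  have [measurable]: "B n \<in> sets M" for n unfolding B_def by measurable
  have int: "integrable M (\<lambda>\<omega>. indicator S \<omega> * Z n \<omega>)" if "S \<in> sets M" for S n
    using integrable_real_mult_indicator[OF that Z_int[of n]] by (simp add: mult.commute)
  have intB: "integrable M (\<lambda>\<omega>. \<epsilon> * indicator S \<omega>)" if "S \<in> sets M" for S
    using that by (auto intro!: integrable_mult_right integrable_real_indicator simp: emeasure_eq_measure)
  \<comment> \<open>The induction carries the mass of \<open>Z n\<close> on the event that the level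
    has not been reached yet; this is the mass to which the one-step hypothesis is applied
    next.\<close>
  have "\<epsilon> * prob (B n) + expectation (\<lambda>\<omega>. indicator (A n) \<omega> * Z n \<omega>) \<le> expectation (Z m) + (\<Sum>i=m..<n. d i)"
    using \<open>m \<le> n\<close>
  proof (induction n rule: dec_induct)
    case base
    have "\<epsilon> * prob (B m) + expectation (\<lambda>\<omega>. indicator (A m) \<omega> * Z m \<omega>)
        = expectation (\<lambda>\<omega>. \<epsilon> * indicator (B m) \<omega> + indicator (A m) \<omega> * Z m \<omega>)"
      using int intB by (subst Bochner_Integration.integral_add) auto
    also have "\<dots> \<le> expectation (Z m)"
      using int intB Z_int by (intro integral_mono Bochner_Integration.integrable_add)
         (auto simp: A_def B_def Z_nonneg split: split_indicator)
    finally show ?case by simp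
  next
    case (step n)
    let ?C = "A n \<inter> {\<omega>\<in>space M. Z (Suc n) \<omega> \<ge> \<epsilon>}"
    have [measurable]: "?C \<in> sets M" by measurable
    have iv: "{m..Suc n} = insert (Suc n) {m..n}" using step by auto
    have BS: "B (Suc n) = B n \<union> ?C" "B n \<inter> ?C = {}" unfolding B_def A_def iv by (auto simp: not_le not_less)
    have P: "prob (B (Suc n)) = prob (B n) + prob ?C"
      unfolding BS(1) by (intro finite_measure_Union) (use BS in auto)
    have "\<epsilon> * prob ?C + expectation (\<lambda>\<omega>. indicator (A (Suc n)) \<omega> * Z (Suc n) \<omega>)
        = expectation (\<lambda>\<omega>. \<epsilon> * indicator ?C \<omega> + indicator (A (Suc n)) \<omega> * Z (Suc n) \<omega>)"
      using int intB by (subst Bochner_Integration.integral_add) auto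
    also have "\<dots> \<le> expectation (\<lambda>\<omega>. indicator (A n) \<omega> * Z (Suc n) \<omega>)"
      using int intB by (intro integral_mono Bochner_Integration.integrable_add)
         (auto simp: A_def iv Z_nonneg split: split_indicator)
    also have "\<dots> \<le> expectation (\<lambda>\<omega>. indicator (A n) \<omega> * Z n \<omega>) + d n"
      using step assms(4) A_F by auto
    finally show ?case using step P by (simp add: algebra_simps)
  qed
  moreover have "0 \<le> expectation (\<lambda>\<omega>. indicator (A n) \<omega> * Z n \<omega>)"
    by (intro Bochner_Integration.integral_nonneg_AE AE_I2) (simp add: Z_nonneg)
  ultimately show ?thesis unfolding B_def by linarith
qed

end

text \<open>Martingale differences with predictable conditional variances \<open>V\<close>, indexed
  so that \<open>D k\<close> is revealed at time \<open>Suc k\<close> while \<open>V k\<close> is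
  known at time \<open>k\<close>. Both conditional moments are expressed through bounded
  \<open>F k\<close>-measurable test functions; the bounds hold at every sample point because the
  exponential estimates use them pointwise.\<close>

locale bounded_mds = filtered_prob_space M F for M :: "'a measure" and F +
  fixes D V :: "nat \<Rightarrow> 'a \<Rightarrow> real" and c :: "nat \<Rightarrow> real"
  assumes D_meas: "D k \<in> borel_measurable (F (Suc k))"
    and V_meas: "V k \<in> borel_measurable (F k)"
    and D_bound: "\<omega> \<in> space M \<Longrightarrow> \<bar>D k \<omega>\<bar> \<le> c k"
    and V_nonneg: "\<omega> \<in> space M \<Longrightarrow> 0 \<le> V k \<omega>"
    and V_bound: "\<omega> \<in> space M \<Longrightarrow> V k \<omega> \<le> (c k)\<^sup>2"
    and D_centered: "H \<in> borel_measurable (F k) \<Longrightarrow> (\<And>\<omega>. \<omega> \<in> space M \<Longrightarrow> \<bar>H \<omega>\<bar> \<le> B) \<Longrightarrow>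
       expectation (\<lambda>\<omega>. H \<omega> * D k \<omega>) = 0"
    and D_variance: "H \<in> borel_measurable (F k) \<Longrightarrow> (\<And>\<omega>. \<omega> \<in> space M \<Longrightarrow> \<bar>H \<omega>\<bar> \<le> B) \<Longrightarrow>
       expectation (\<lambda>\<omega>. H \<omega> * (D k \<omega>)\<^sup>2) = expectation (\<lambda>\<omega>. H \<omega> * V k \<omega>)"
begin

lemma c_nonneg: "0 \<le> c k"
proof -
  obtain \<omega> where "\<omega> \<in> space M" using not_empty by blast
  then show ?thesis using D_bound[of \<omega> k] by linarith
qed

lemma D_sq: "\<omega> \<in> space M \<Longrightarrow> (D k \<omega>)\<^sup>2 \<le> (c k)\<^sup>2"
  using D_bound[of \<omega> k] c_nonneg[of k] abs_le_square_iff[of "D k \<omega>" "c k"] by simp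

lemma D_meas_M [measurable]: "D k \<in> borel_measurable M"
  using D_meas meas_F by blast

lemma V_meas_M [measurable]: "V k \<in> borel_measurable M"
  using V_meas meas_F by blast

lemma integrable_bounded:
  assumes "f \<in> borel_measurable M" "\<And>\<omega>. \<omega> \<in> space M \<Longrightarrow> \<bar>f \<omega>\<bar> \<le> (B::real)"
  shows "integrable M f"
  by (rule integrable_const_bound[of _ B]) (use assms in auto)

text \<open>Testing the two moment conditions against \<open>G\<close> kills the linear term and
  replaces the squared increment by \<open>V k\<close>; this is the only way in which the martingale
  property enters the exponential bounds.\<close>

lemma quadratic_expansion:
  assumes G: "G \<in> borel_measurable (F k)" "\<And>\<omega>. \<omega> \<in> space M \<Longrightarrow> \<bar>G \<omega>\<bar> \<le> B"
  shows "integrable M (\<lambda>\<omega>. G \<omega> * exp (l * D k \<omega>))"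
    and "integrable M (\<lambda>\<omega>. G \<omega> * (1 + l * D k \<omega> + y * (D k \<omega>)\<^sup>2))"
    and "integrable M (\<lambda>\<omega>. G \<omega> * (1 + y * V k \<omega>))"
    and "expectation (\<lambda>\<omega>. G \<omega> * (1 + l * D k \<omega> + y * (D k \<omega>)\<^sup>2)) = expectation (\<lambda>\<omega>. G \<omega> * (1 + y * V k \<omega>))"
proof -
  have [measurable]: "G \<in> borel_measurable M" using G(1) meas_F by blast
  have B0: "0 \<le> B" using G(2) not_empty by fastforce
  show "integrable M (\<lambda>\<omega>. G \<omega> * exp (l * D k \<omega>))"
  proof (rule integrable_bounded[of _ "B * exp (\<bar>l\<bar> * c k)"])
    fix \<omega> assume w: "\<omega> \<in> space M"
    have "l * D k \<omega> \<le> \<bar>l\<bar> * \<bar>D k \<omega>\<bar>" using abs_ge_self[of "l * D k \<omega>"] by (simp only: abs_mult)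
    also have "\<dots> \<le> \<bar>l\<bar> * c k" by (intro mult_left_mono D_bound w) auto
    finally show "\<bar>G \<omega> * exp (l * D k \<omega>)\<bar> \<le> B * exp (\<bar>l\<bar> * c k)"
      using G(2)[OF w] B0 by (auto simp: abs_mult intro!: mult_mono)
  qed measurable
  have i2: "integrable M G" using G by (intro integrable_bounded[of _ B]) auto
  have i3: "integrable M (\<lambda>\<omega>. G \<omega> * D k \<omega>)"
    by (rule integrable_bounded[of _ "B * c k"]) (use G D_bound B0 in \<open>auto simp: abs_mult intro!: mult_mono\<close>)
  have i4: "integrable M (\<lambda>\<omega>. G \<omega> * (D k \<omega>)\<^sup>2)"
    by (rule integrable_bounded[of _ "B * (c k)\<^sup>2"]) (use G B0 D_sq in \<open>auto simp: abs_mult intro!: mult_mono\<close>)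
  have i5: "integrable M (\<lambda>\<omega>. G \<omega> * V k \<omega>)"
    by (rule integrable_bounded[of _ "B * (c k)\<^sup>2"])
      (use G V_bound V_nonneg B0 c_nonneg[of k] in \<open>auto simp: abs_mult intro!: mult_mono\<close>)
  have e: "(\<lambda>\<omega>. G \<omega> * (1 + l * D k \<omega> + y * (D k \<omega>)\<^sup>2)) = (\<lambda>\<omega>. G \<omega> + l * (G \<omega> * D k \<omega>) + y * (G \<omega> * (D k \<omega>)\<^sup>2))"
    "(\<lambda>\<omega>. G \<omega> * (1 + y * V k \<omega>)) = (\<lambda>\<omega>. G \<omega> + y * (G \<omega> * V k \<omega>))"
    by (simp_all add: algebra_simps)
  show "integrable M (\<lambda>\<omega>. G \<omega> * (1 + l * D k \<omega> + y * (D k \<omega>)\<^sup>2))" "integrable M (\<lambda>\<omega>. G \<omega> * (1 + y * V k \<omega>))"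
    unfolding e using i2 i3 i4 i5 by auto
  show "expectation (\<lambda>\<omega>. G \<omega> * (1 + l * D k \<omega> + y * (D k \<omega>)\<^sup>2)) = expectation (\<lambda>\<omega>. G \<omega> * (1 + y * V k \<omega>))"
    unfolding e using i2 i3 i4 i5 D_centered[OF G] D_variance[OF G] by simp
qed

context
  fixes H :: "'a \<Rightarrow> real" and k :: nat and B l \<beta> :: real
  assumes H: "H \<in> borel_measurable (F k)" "\<And>\<omega>. \<omega> \<in> space M \<Longrightarrow> 0 \<le> H \<omega>" "\<And>\<omega>. \<omega> \<in> space M \<Longrightarrow> H \<omega> \<le> B"
    and b: "\<bar>l\<bar> * c k \<le> \<beta>"
begin

text \<open>The compensator is known at time \<open>k\<close> and its exponential is at most 1, so
  it can be absorbed into the test function.\<close>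

lemma discounted:
  assumes "0 \<le> y"
  defines "G \<equiv> \<lambda>\<omega>. H \<omega> * exp (- (y * V k \<omega>))"
  shows "G \<in> borel_measurable (F k)" "\<omega> \<in> space M \<Longrightarrow> 0 \<le> G \<omega>" "\<omega> \<in> space M \<Longrightarrow> \<bar>G \<omega>\<bar> \<le> B"
proof -
  show "G \<in> borel_measurable (F k)" unfolding G_def using H(1) V_meas[of k] by measurable
  show G0: "0 \<le> G \<omega>" if "\<omega> \<in> space M" using H(2)[OF that] by (simp add: G_def)
  have "G \<omega> \<le> H \<omega>" if "\<omega> \<in> space M"
    using H(2)[OF that] V_nonneg[OF that, of k] assms(1) by (simp add: G_def mult_left_le)
  then show "\<bar>G \<omega>\<bar> \<le> B" if "\<omega> \<in> space M" using that G0 H(3)[OF that] by fastforce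
qed

lemma integrable_H: "integrable M H"
  by (rule integrable_bounded[of _ B]) (use H meas_F in auto)

lemma small_step: "\<omega> \<in> space M \<Longrightarrow> \<bar>l * D k \<omega>\<bar> \<le> \<beta>"
  using D_bound[of \<omega> k] b mult_left_mono[of "\<bar>D k \<omega>\<bar>" "c k" "\<bar>l\<bar>"] by (simp add: abs_mult)

text \<open>With the compensator absorbed, the conditional mean of the quadratic upper bound is
  \<open>1 + z\<close>, where \<open>z\<close> is the compensator itself, and
  \<open>1 + z \<le> exp z\<close> cancels it.\<close>

lemma exp_step_upper:
  "expectation (\<lambda>\<omega>. H \<omega> * exp (l * D k \<omega> - l\<^sup>2 / 2 * exp \<beta> * V k \<omega>)) \<le> expectation H"
proof -
  let ?y = "l\<^sup>2 / 2 * exp \<beta>"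
  define G where "G \<omega> = H \<omega> * exp (- (?y * V k \<omega>))" for \<omega>
  have G: "G \<in> borel_measurable (F k)" "\<And>\<omega>. \<omega> \<in> space M \<Longrightarrow> 0 \<le> G \<omega>" "\<And>\<omega>. \<omega> \<in> space M \<Longrightarrow> \<bar>G \<omega>\<bar> \<le> B"
    unfolding G_def[abs_def] using discounted[of ?y] by auto
  note expand = quadratic_expansion(1)[OF G(1,3), of l] quadratic_expansion(2)[OF G(1,3), of l ?y]
    quadratic_expansion(3)[OF G(1,3), of ?y] quadratic_expansion(4)[OF G(1,3), of l ?y]
  have "expectation (\<lambda>\<omega>. H \<omega> * exp (l * D k \<omega> - ?y * V k \<omega>)) = expectation (\<lambda>\<omega>. G \<omega> * exp (l * D k \<omega>))"
    unfolding G_def mult_exp_diff ..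
  also have "\<dots> \<le> expectation (\<lambda>\<omega>. G \<omega> * (1 + l * D k \<omega> + ?y * (D k \<omega>)\<^sup>2))"
  proof (rule integral_mono[OF expand(1,2)])
    fix \<omega> assume w: "\<omega> \<in> space M"
    have "exp (l * D k \<omega>) \<le> 1 + l * D k \<omega> + ?y * (D k \<omega>)\<^sup>2"
      using exp_le_quadratic[OF small_step[OF w]] by (simp add: power_mult_distrib mult_ac)
    then show "G \<omega> * exp (l * D k \<omega>) \<le> G \<omega> * (1 + l * D k \<omega> + ?y * (D k \<omega>)\<^sup>2)" by (intro mult_left_mono G(2) w)
  qed
  also have "\<dots> = expectation (\<lambda>\<omega>. G \<omega> * (1 + ?y * V k \<omega>))" by (rule expand(4))
  also have "\<dots> \<le> expectation H"
  proof (rule integral_mono[OF expand(3) integrable_H])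
    fix \<omega> assume w: "\<omega> \<in> space M"
    have "G \<omega> * (1 + ?y * V k \<omega>) \<le> G \<omega> * exp (?y * V k \<omega>)" by (intro mult_left_mono exp_ge_add_one_self G(2) w)
    also have "\<dots> = H \<omega>" by (simp add: G_def exp_minus)
    finally show "G \<omega> * (1 + ?y * V k \<omega>) \<le> H \<omega>" .
  qed
  finally show ?thesis .
qed

text \<open>For the reverse bound \<open>1 + z\<close> must dominate an exponential, so the
  compensator has to shrink: the factor \<open>exp (- \<beta>)\<close> is lost in the Taylor bound
  and \<open>1 - \<beta>\<^sup>2 / 2\<close> in \<open>one_plus_ge_exp\<close>, since
  \<open>V_bound\<close> gives \<open>z \<le> \<beta>\<^sup>2 / 2\<close>.\<close>

lemma exp_step_lower:
  assumes \<beta>: "0 \<le> \<beta>" "\<beta> \<le> 1" and \<rho>: "0 \<le> \<rho>" "\<rho> \<le> exp (- \<beta>) * (1 - \<beta>\<^sup>2 / 2)"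
  shows "expectation (\<lambda>\<omega>. H \<omega> * exp (l * D k \<omega> - l\<^sup>2 / 2 * \<rho> * V k \<omega>)) \<ge> expectation H"
proof -
  let ?y = "l\<^sup>2 / 2 * exp (- \<beta>)"
  define G where "G \<omega> = H \<omega> * exp (- (l\<^sup>2 / 2 * \<rho> * V k \<omega>))" for \<omega>
  have G: "G \<in> borel_measurable (F k)" "\<And>\<omega>. \<omega> \<in> space M \<Longrightarrow> 0 \<le> G \<omega>" "\<And>\<omega>. \<omega> \<in> space M \<Longrightarrow> \<bar>G \<omega>\<bar> \<le> B"
    unfolding G_def[abs_def] using discounted[of "l\<^sup>2 / 2 * \<rho>"] \<rho> by auto
  note expand = quadratic_expansion(1)[OF G(1,3), of l] quadratic_expansion(2)[OF G(1,3), of l ?y]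
    quadratic_expansion(3)[OF G(1,3), of ?y] quadratic_expansion(4)[OF G(1,3), of l ?y]
  have "expectation H \<le> expectation (\<lambda>\<omega>. G \<omega> * (1 + ?y * V k \<omega>))"
  proof (rule integral_mono[OF integrable_H expand(3)])
    fix \<omega> assume w: "\<omega> \<in> space M"
    let ?z = "?y * V k \<omega>"
    have z0: "0 \<le> ?z" using V_nonneg[OF w, of k] by simp
    have "l\<^sup>2 * V k \<omega> \<le> l\<^sup>2 * (c k)\<^sup>2" using V_bound[OF w, of k] by (intro mult_left_mono) auto
    also have "\<dots> = (\<bar>l\<bar> * c k)\<^sup>2" by (simp add: power_mult_distrib)
    also have "\<dots> \<le> \<beta>\<^sup>2" using b c_nonneg[of k] by (intro power_mono) auto
    finally have lV: "l\<^sup>2 * V k \<omega> \<le> \<beta>\<^sup>2" .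
    have "?z = (l\<^sup>2 * V k \<omega>) / 2 * exp (- \<beta>)" by simp
    also have "\<dots> \<le> \<beta>\<^sup>2 / 2 * 1" using lV \<beta> by (intro mult_mono) auto
    finally have z1: "?z \<le> \<beta>\<^sup>2 / 2" by simp
    have z2: "?z \<le> 1" using z1 \<beta> power_le_one[of \<beta> 2] by linarith
    have "l\<^sup>2 / 2 * \<rho> * V k \<omega> \<le> l\<^sup>2 / 2 * (exp (- \<beta>) * (1 - \<beta>\<^sup>2 / 2)) * V k \<omega>"
      using \<rho> V_nonneg[OF w, of k] by (intro mult_right_mono mult_left_mono) auto
    also have "\<dots> = ?z * (1 - \<beta>\<^sup>2 / 2)" by simp
    also have "\<dots> \<le> ?z * (1 - ?z)" using z1 z0 by (intro mult_left_mono) auto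
    finally have "exp (l\<^sup>2 / 2 * \<rho> * V k \<omega>) \<le> 1 + ?z"
      using one_plus_ge_exp[OF z0 z2] by (meson exp_le_cancel_iff order_trans)
    then have "G \<omega> * exp (l\<^sup>2 / 2 * \<rho> * V k \<omega>) \<le> G \<omega> * (1 + ?z)" by (intro mult_left_mono G(2) w)
    moreover have "G \<omega> * exp (l\<^sup>2 / 2 * \<rho> * V k \<omega>) = H \<omega>" by (simp add: G_def exp_minus)
    ultimately show "H \<omega> \<le> G \<omega> * (1 + ?z)" by simp
  qed
  also have "\<dots> = expectation (\<lambda>\<omega>. G \<omega> * (1 + l * D k \<omega> + ?y * (D k \<omega>)\<^sup>2))" by (rule expand(4)[symmetric])
  also have "\<dots> \<le> expectation (\<lambda>\<omega>. G \<omega> * exp (l * D k \<omega>))"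
  proof (rule integral_mono[OF expand(2,1)])
    fix \<omega> assume w: "\<omega> \<in> space M"
    have "1 + l * D k \<omega> + ?y * (D k \<omega>)\<^sup>2 \<le> exp (l * D k \<omega>)"
      using exp_ge_quadratic[OF small_step[OF w]] by (simp add: power_mult_distrib mult_ac)
    then show "G \<omega> * (1 + l * D k \<omega> + ?y * (D k \<omega>)\<^sup>2) \<le> G \<omega> * exp (l * D k \<omega>)" by (intro mult_left_mono G(2) w)
  qed
  also have "\<dots> = expectation (\<lambda>\<omega>. H \<omega> * exp (l * D k \<omega> - l\<^sup>2 / 2 * \<rho> * V k \<omega>))"
    unfolding G_def mult_exp_diff ..
  finally show ?thesis .
qed

end

definition mart :: "nat \<Rightarrow> nat \<Rightarrow> 'a \<Rightarrow> real" where "mart m n \<omega> = (\<Sum>k=m..<n. D k \<omega>)"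
definition brak :: "nat \<Rightarrow> nat \<Rightarrow> 'a \<Rightarrow> real" where "brak m n \<omega> = (\<Sum>k=m..<n. V k \<omega>)"

lemma mart_meas: "n \<le> n' \<Longrightarrow> mart m n \<in> borel_measurable (F n')"
  unfolding mart_def by (intro borel_measurable_sum meas_F_mono[OF D_meas]) auto

text \<open>The bracket is predictable: \<open>V k\<close> is already known at time
  \<open>k\<close>, hence the gain of one time step over \<open>mart_meas\<close>.\<close>

lemma brak_meas: "n \<le> Suc n' \<Longrightarrow> brak m n \<in> borel_measurable (F n')"
  unfolding brak_def by (intro borel_measurable_sum meas_F_mono[OF V_meas]) auto

lemma mart_meas_M [measurable]: "mart m n \<in> borel_measurable M"
  by (rule meas_F[OF mart_meas[OF order_refl]])

lemma brak_meas_M [measurable]: "brak m n \<in> borel_measurable M"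
  by (rule meas_F[OF brak_meas[of n n]]) simp

lemma mart_bound: "\<omega> \<in> space M \<Longrightarrow> \<bar>mart m n \<omega>\<bar> \<le> (\<Sum>k=m..<n. c k)"
  unfolding mart_def by (rule order_trans[OF sum_abs]) (intro sum_mono D_bound)

lemma brak_nonneg: "\<omega> \<in> space M \<Longrightarrow> 0 \<le> brak m n \<omega>"
  unfolding brak_def by (intro sum_nonneg V_nonneg)

lemma exp_mart_bound:
  assumes "\<omega> \<in> space M" "0 \<le> \<rho>"
  shows "exp (l * mart m n \<omega> - l\<^sup>2 / 2 * \<rho> * brak m n \<omega>) \<le> exp (\<bar>l\<bar> * (\<Sum>k=m..<n. c k))"
proof -
  have "l * mart m n \<omega> \<le> \<bar>l\<bar> * \<bar>mart m n \<omega>\<bar>" using abs_ge_self[of "l * mart m n \<omega>"] by (simp only: abs_mult)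
  also have "\<dots> \<le> \<bar>l\<bar> * (\<Sum>k=m..<n. c k)" by (intro mult_left_mono mart_bound assms) auto
  moreover have "0 \<le> l\<^sup>2 / 2 * \<rho> * brak m n \<omega>"
    using brak_nonneg[OF assms(1), of m n] assms(2) by simp
  ultimately show ?thesis unfolding exp_le_cancel_iff by linarith
qed

lemma exp_mart_Suc:
  assumes "m \<le> n"
  shows "exp (l * mart m (Suc n) \<omega> - l\<^sup>2 / 2 * \<rho> * brak m (Suc n) \<omega>)
     = exp (l * mart m n \<omega> - l\<^sup>2 / 2 * \<rho> * brak m n \<omega>) * exp (l * D n \<omega> - l\<^sup>2 / 2 * \<rho> * V n \<omega>)"
proof -
  have "mart m (Suc n) \<omega> = mart m n \<omega> + D n \<omega>" "brak m (Suc n) \<omega> = brak m n \<omega> + V n \<omega>"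
    using assms by (simp_all add: mart_def brak_def)
  then show ?thesis unfolding exp_add[symmetric] by (simp only: algebra_simps)
qed

text \<open>One time step with a test function from the current time \<open>n\<close>, the form that
  the maximal inequality asks for; \<open>exp_mart_upper\<close> and \<open>exp_mart_lower\<close>
  chain one-step bounds for a test function from the start \<open>m\<close> of a block.\<close>

lemma exp_mart_step_upper:
  assumes H: "H \<in> borel_measurable (F n)" "\<And>\<omega>. \<omega> \<in> space M \<Longrightarrow> 0 \<le> H \<omega>" "\<And>\<omega>. \<omega> \<in> space M \<Longrightarrow> H \<omega> \<le> B"
    and mn: "m \<le> n" and b: "\<bar>l\<bar> * c n \<le> \<beta>"
  shows "expectation (\<lambda>\<omega>. H \<omega> * exp (l * mart m (Suc n) \<omega> - l\<^sup>2 / 2 * exp \<beta> * brak m (Suc n) \<omega>))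
     \<le> expectation (\<lambda>\<omega>. H \<omega> * exp (l * mart m n \<omega> - l\<^sup>2 / 2 * exp \<beta> * brak m n \<omega>))"
proof -
  let ?H = "\<lambda>\<omega>. H \<omega> * exp (l * mart m n \<omega> - l\<^sup>2 / 2 * exp \<beta> * brak m n \<omega>)"
  have "expectation (\<lambda>\<omega>. ?H \<omega> * exp (l * D n \<omega> - l\<^sup>2 / 2 * exp \<beta> * V n \<omega>)) \<le> expectation ?H"
  proof (rule exp_step_upper[of _ _ "B * exp (\<bar>l\<bar> * (\<Sum>k=m..<n. c k))"])
    show "?H \<in> borel_measurable (F n)"
      using H(1) mart_meas[of n n m] brak_meas[of n n m] by simp
    fix \<omega> assume w: "\<omega> \<in> space M"
    show "0 \<le> ?H \<omega>" using H(2)[OF w] by simp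
    show "?H \<omega> \<le> B * exp (\<bar>l\<bar> * (\<Sum>k=m..<n. c k))"
      using H(2)[OF w] H(3)[OF w] exp_mart_bound[OF w, of "exp \<beta>" l m n] by (intro mult_mono) auto
  qed (use b in auto)
  then show ?thesis unfolding exp_mart_Suc[OF mn] by (simp add: mult.assoc)
qed

lemma exp_mart_upper:
  assumes H: "H \<in> borel_measurable (F m)" "\<And>\<omega>. \<omega> \<in> space M \<Longrightarrow> 0 \<le> H \<omega>" "\<And>\<omega>. \<omega> \<in> space M \<Longrightarrow> H \<omega> \<le> B"
    and mn: "m \<le> n" and b: "\<And>k. k \<in> {m..<n} \<Longrightarrow> \<bar>l\<bar> * c k \<le> \<beta>"
  shows "expectation (\<lambda>\<omega>. H \<omega> * exp (l * mart m n \<omega> - l\<^sup>2 / 2 * exp \<beta> * brak m n \<omega>)) \<le> expectation H"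
  using mn b
proof (induction n rule: dec_induct)
  case base
  then show ?case by (simp add: mart_def brak_def)
next
  case (step n)
  have "expectation (\<lambda>\<omega>. H \<omega> * exp (l * mart m (Suc n) \<omega> - l\<^sup>2 / 2 * exp \<beta> * brak m (Suc n) \<omega>))
     \<le> expectation (\<lambda>\<omega>. H \<omega> * exp (l * mart m n \<omega> - l\<^sup>2 / 2 * exp \<beta> * brak m n \<omega>))"
    using step by (intro exp_mart_step_upper[of _ _ B] meas_F_mono[OF H(1)] H) auto
  also have "\<dots> \<le> expectation H" using step by auto
  finally show ?case .
qed

lemma exp_mart_lower:
  assumes H: "H \<in> borel_measurable (F m)" "\<And>\<omega>. \<omega> \<in> space M \<Longrightarrow> 0 \<le> H \<omega>" "\<And>\<omega>. \<omega> \<in> space M \<Longrightarrow> H \<omega> \<le> B"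
    and mn: "m \<le> n" and b: "\<And>k. k \<in> {m..<n} \<Longrightarrow> \<bar>l\<bar> * c k \<le> \<beta>"
    and \<beta>: "0 \<le> \<beta>" "\<beta> \<le> 1" and \<rho>: "0 \<le> \<rho>" "\<rho> \<le> exp (- \<beta>) * (1 - \<beta>\<^sup>2 / 2)"
  shows "expectation (\<lambda>\<omega>. H \<omega> * exp (l * mart m n \<omega> - l\<^sup>2 / 2 * \<rho> * brak m n \<omega>)) \<ge> expectation H"
  using mn b
proof (induction n rule: dec_induct)
  case base
  then show ?case by (simp add: mart_def brak_def)
next
  case (step n)
  let ?H = "\<lambda>\<omega>. H \<omega> * exp (l * mart m n \<omega> - l\<^sup>2 / 2 * \<rho> * brak m n \<omega>)"
  have "expectation H \<le> expectation ?H" using step by auto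
  also have "\<dots> \<le> expectation (\<lambda>\<omega>. ?H \<omega> * exp (l * D n \<omega> - l\<^sup>2 / 2 * \<rho> * V n \<omega>))"
  proof (rule exp_step_lower[of _ _ "B * exp (\<bar>l\<bar> * (\<Sum>k=m..<n. c k))" _ \<beta>])
    show "?H \<in> borel_measurable (F n)"
      using meas_F_mono[OF H(1), of n] step mart_meas[of n n m] brak_meas[of n n m] by simp
    fix \<omega> assume w: "\<omega> \<in> space M"
    show "0 \<le> ?H \<omega>" using H(2)[OF w] by simp
    show "?H \<omega> \<le> B * exp (\<bar>l\<bar> * (\<Sum>k=m..<n. c k))"
      using H(2)[OF w] H(3)[OF w] exp_mart_bound[OF w, of "\<rho>" l m n] \<rho> by (intro mult_mono) auto
  qed (use step \<beta> \<rho> in auto)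
  finally show ?case using step unfolding exp_mart_Suc[OF step(1)] by (simp add: mult.assoc)
qed

end

section \<open>The iterated logarithm and geometric times\<close>

definition LL :: "real \<Rightarrow> real" where "LL x = ln (ln x)"

lemma LL_mono: "1 < x \<Longrightarrow> x \<le> y \<Longrightarrow> LL x \<le> LL y"
  unfolding LL_def by simp

lemma exp_LL: "1 < x \<Longrightarrow> exp (LL x) = ln x"
  unfolding LL_def by simp

lemma LL_at_top: "filterlim LL at_top at_top"
  unfolding LL_def by real_asymp

text \<open>\<open>N j\<close> is the first time at which \<open>T\<close> reaches
  \<open>\<theta> ^ j\<close>. One step earlier the value is still below
  \<open>\<theta> ^ j\<close>, so the ratio condition bounds the overshoot eventually by any factor
  above 1.\<close>

lemma geometric_hitting_times:
  fixes T :: "nat \<Rightarrow> real"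
  assumes mono: "\<And>n. T n \<le> T (Suc n)" and lim: "filterlim T at_top sequentially"
    and ratio: "(\<lambda>n. T (Suc n) / T n) \<longlonglongrightarrow> 1" and \<theta>: "\<theta> > 1" and \<rho>: "\<rho> > 1"
  obtains N :: "nat \<Rightarrow> nat" where "\<And>j. T (N j) \<ge> \<theta> ^ j" "\<And>j n. n < N j \<Longrightarrow> T n < \<theta> ^ j"
    "\<And>i j. i \<le> j \<Longrightarrow> N i \<le> N j" "eventually (\<lambda>j. T (N j) \<le> \<rho> * \<theta> ^ j) sequentially"
    "filterlim N at_top sequentially"
proof -
  define N where "N j = (LEAST n. T n \<ge> \<theta> ^ j)" for j
  have ex: "\<exists>n. T n \<ge> \<theta> ^ j" for j
  proof -
    have "eventually (\<lambda>n. T n \<ge> \<theta> ^ j) sequentially" using lim unfolding filterlim_at_top by blast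
    then show ?thesis unfolding eventually_sequentially by blast
  qed
  have N1: "T (N j) \<ge> \<theta> ^ j" for j unfolding N_def using ex by (rule LeastI_ex)
  have N2: "T n < \<theta> ^ j" if "n < N j" for j n
    using not_less_Least[of n "\<lambda>n. T n \<ge> \<theta> ^ j"] that unfolding N_def by simp
  have N3: "N i \<le> N j" if "i \<le> j" for i j
  proof (rule ccontr)
    assume "\<not> N i \<le> N j"
    then have "T (N j) < \<theta> ^ i" using N2 by simp
    also have "\<dots> \<le> \<theta> ^ j" using that \<theta> by (intro power_increasing) auto
    finally show False using N1[of j] by simp
  qed
  have N4: "filterlim N at_top sequentially"
    unfolding filterlim_at_top
  proof
    fix Z
    obtain j0 where "T Z < \<theta> ^ j0" using real_arch_pow[OF \<theta>] by blast
    show "eventually (\<lambda>j. Z \<le> N j) sequentially"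
      unfolding eventually_sequentially
    proof (intro exI allI impI)
      fix j assume "j0 \<le> j"
      then have "T Z < \<theta> ^ j" using \<open>T Z < \<theta> ^ j0\<close> power_increasing[of j0 j \<theta>] \<theta> by linarith
      moreover have "T (N j) \<le> T Z" if "N j \<le> Z" using lift_Suc_mono_le[of T, OF mono that] .
      ultimately show "Z \<le> N j" using N1[of j] by linarith
    qed
  qed
  have "eventually (\<lambda>n. T (Suc n) / T n < \<rho>) sequentially" using order_tendstoD(2)[OF ratio \<rho>] .
  moreover have "eventually (\<lambda>n. T n > 0) sequentially" using lim by (auto simp: filterlim_at_top_dense)
  ultimately have "eventually (\<lambda>n. T (Suc n) \<le> \<rho> * T n) sequentially"
    by eventually_elim (simp add: field_simps)
  then obtain n0 where n0: "\<And>n. n \<ge> n0 \<Longrightarrow> T (Suc n) \<le> \<rho> * T n" by (auto simp: eventually_sequentially)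
  have "eventually (\<lambda>j. Suc n0 \<le> N j) sequentially" using N4 by (auto simp: filterlim_at_top)
  then have "eventually (\<lambda>j. T (N j) \<le> \<rho> * \<theta> ^ j) sequentially"
  proof eventually_elim
    case (elim j)
    then obtain k where k: "N j = Suc k" "k \<ge> n0" by (cases "N j") auto
    have "T (N j) \<le> \<rho> * T k" using n0[OF k(2)] k by simp
    also have "\<dots> \<le> \<rho> * \<theta> ^ j" using N2[of k j] k \<rho> by (intro mult_left_mono) auto
    finally show ?case .
  qed
  then show ?thesis using that N1 N2 N3 N4 by blast
qed

lemma geometric_bracket:
  fixes x \<theta> :: real
  assumes "\<theta> > 1" "\<theta> ^ J \<le> x"
  obtains j where "J \<le> j" "\<theta> ^ j \<le> x" "x < \<theta> ^ Suc j"
proof -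
  have ex: "\<exists>j. x < \<theta> ^ j" using real_arch_pow[OF assms(1)] .
  define i where "i = (LEAST j. x < \<theta> ^ j)"
  have i1: "x < \<theta> ^ i" unfolding i_def using ex by (rule LeastI_ex)
  have i2: "\<theta> ^ j \<le> x" if "j < i" for j
    using not_less_Least[of j "\<lambda>j. x < \<theta> ^ j"] that unfolding i_def by simp
  have "J < i"
  proof (rule ccontr)
    assume "\<not> J < i"
    then have "\<theta> ^ i \<le> \<theta> ^ J" using assms by (intro power_increasing) auto
    then show False using i1 assms by linarith
  qed
  then obtain j where "i = Suc j" "J \<le> j" by (cases i) auto
  then show ?thesis using that i1 i2 by auto
qed

section \<open>The upper half for bounded martingale differences\<close>

context bounded_mds
begin

lemma brak_upper:
  assumes "\<And>k. V k \<omega> \<le> (1 + \<kappa>) * (T (Suc k) - T k)" "m \<le> n"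
  shows "brak m n \<omega> \<le> (1 + \<kappa>) * (T n - T m)"
proof -
  have "brak m n \<omega> \<le> (\<Sum>k=m..<n. (1 + \<kappa>) * (T (Suc k) - T k))"
    unfolding brak_def by (intro sum_mono assms)
  also have "\<dots> = (1 + \<kappa>) * (T n - T m)"
    using assms by (simp add: sum_distrib_left[symmetric] sum_Suc_diff')
  finally show ?thesis .
qed

lemma brak_lower:
  assumes "\<And>k. V k \<omega> \<ge> (1 - \<kappa>) * (T (Suc k) - T k)" "m \<le> n"
  shows "brak m n \<omega> \<ge> (1 - \<kappa>) * (T n - T m)"
proof -
  have "brak m n \<omega> \<ge> (\<Sum>k=m..<n. (1 - \<kappa>) * (T (Suc k) - T k))"
    unfolding brak_def by (intro sum_mono assms)
  moreover have "(\<Sum>k=m..<n. (1 - \<kappa>) * (T (Suc k) - T k)) = (1 - \<kappa>) * (T n - T m)"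
    using assms by (simp add: sum_distrib_left[symmetric] sum_Suc_diff')
  ultimately show ?thesis by simp
qed

text \<open>As the bracket does not exceed \<open>y\<close> up to time \<open>n\<close>, a passage
  of the martingale above \<open>x\<close> lifts the exponential supermartingale, which starts at 1,
  above the inverse of the right-hand side. The parameter \<open>l\<close> is left free for
  optimisation.\<close>

lemma maximal_exp:
  assumes l: "0 \<le> l" and b: "\<And>k. k < n \<Longrightarrow> l * c k \<le> \<beta>"
    and R: "\<And>\<omega> i. \<omega> \<in> space M \<Longrightarrow> i \<le> n \<Longrightarrow> brak 0 i \<omega> \<le> y"
  shows "prob {\<omega>\<in>space M. \<exists>i\<le>n. mart 0 i \<omega> \<ge> x} \<le> exp (l\<^sup>2 / 2 * exp \<beta> * y - l * x)"
proof -
  define Z where "Z i \<omega> = exp (l * mart 0 i \<omega> - l\<^sup>2 / 2 * exp \<beta> * brak 0 i \<omega>)" for i \<omega>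
  let ?e = "exp (l * x - l\<^sup>2 / 2 * exp \<beta> * y)"
  have Zm: "Z i \<in> borel_measurable (F i)" for i
    unfolding Z_def using mart_meas[of i i 0] brak_meas[of i i 0] by simp
  have Zi: "integrable M (Z i)" for i
  proof (rule integrable_bounded)
    show "Z i \<in> borel_measurable M" using Zm meas_F by blast
    fix \<omega> assume w: "\<omega> \<in> space M"
    show "\<bar>Z i \<omega>\<bar> \<le> exp (\<bar>l\<bar> * (\<Sum>k=0..<i. c k))" using exp_mart_bound[OF w, of "exp \<beta>" l 0 i] by (simp add: Z_def)
  qed
  have "?e * prob {\<omega>\<in>space M. \<exists>i\<in>{0..n}. Z i \<omega> \<ge> ?e} \<le> expectation (Z 0) + (\<Sum>i=0..<n. (\<lambda>_. 0) i)"
  proof (rule maximal_inequality[OF Zm _ Zi])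
    fix k A assume k: "k < n" and A: "A \<in> sets (F k)"
    have "expectation (\<lambda>\<omega>. indicator A \<omega> * exp (l * mart 0 (Suc k) \<omega> - l\<^sup>2 / 2 * exp \<beta> * brak 0 (Suc k) \<omega>))
     \<le> expectation (\<lambda>\<omega>. indicator A \<omega> * exp (l * mart 0 k \<omega> - l\<^sup>2 / 2 * exp \<beta> * brak 0 k \<omega>))"
      by (rule exp_mart_step_upper[of _ _ 1]) (use A b[OF k] l in \<open>auto simp: indicator_def\<close>)
    then show "expectation (\<lambda>\<omega>. indicator A \<omega> * Z (Suc k) \<omega>) \<le> expectation (\<lambda>\<omega>. indicator A \<omega> * Z k \<omega>) + 0"
      by (simp add: Z_def)
  qed (auto simp: Z_def)
  then have "?e * prob {\<omega>\<in>space M. \<exists>i\<in>{0..n}. Z i \<omega> \<ge> ?e} \<le> 1"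
    by (simp add: Z_def[abs_def] mart_def brak_def prob_space)
  moreover have "prob {\<omega>\<in>space M. \<exists>i\<le>n. mart 0 i \<omega> \<ge> x} \<le> prob {\<omega>\<in>space M. \<exists>i\<in>{0..n}. Z i \<omega> \<ge> ?e}"
  proof (rule finite_measure_mono)
    have [measurable]: "Z i \<in> borel_measurable M" for i using Zm meas_F by blast
    show "{\<omega>\<in>space M. \<exists>i\<in>{0..n}. Z i \<omega> \<ge> ?e} \<in> sets M" by measurable
    show "{\<omega>\<in>space M. \<exists>i\<le>n. mart 0 i \<omega> \<ge> x} \<subseteq> {\<omega>\<in>space M. \<exists>i\<in>{0..n}. Z i \<omega> \<ge> ?e}"
    proof safe
      fix \<omega> i assume w: "\<omega> \<in> space M" and i: "i \<le> n" and x: "x \<le> mart 0 i \<omega>"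
      have "l * x \<le> l * mart 0 i \<omega>" using l x by (rule mult_left_mono[rotated])
      moreover have "l\<^sup>2 / 2 * exp \<beta> * brak 0 i \<omega> \<le> l\<^sup>2 / 2 * exp \<beta> * y"
        using R[OF w i] by (intro mult_left_mono) auto
      ultimately have "?e \<le> Z i \<omega>" unfolding Z_def exp_le_cancel_iff by linarith
      then show "\<exists>i\<in>{0..n}. ?e \<le> Z i \<omega>" using i by auto
    qed
  qed
  ultimately have "?e * prob {\<omega>\<in>space M. \<exists>i\<le>n. mart 0 i \<omega> \<ge> x} \<le> 1"
    by (meson exp_ge_zero mult_left_mono order_trans)
  then have "prob {\<omega>\<in>space M. \<exists>i\<le>n. mart 0 i \<omega> \<ge> x} \<le> 1 / ?e" by (simp add: pos_le_divide_eq mult.commute)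
  also have "\<dots> = exp (l\<^sup>2 / 2 * exp \<beta> * y - l * x)" by (simp add: exp_diff)
  finally show ?thesis .
qed

text \<open>The maximal inequality is applied up to each geometric time and the probabilities are
  summed. Three losses have to fit into \<open>1 + \<eta>\<close>: \<open>exp (2 * \<delta>)\<close>
  from the size of the increments, \<open>1 + \<kappa>\<close> from the bracket, and
  \<open>\<theta>\<^sup>2\<close> from the spacing and the overshoot of the geometric times.\<close>

lemma lil_upper:
  fixes T :: "nat \<Rightarrow> real"
  assumes mono: "\<And>n. T n \<le> T (Suc n)" and lim: "filterlim T at_top sequentially"
    and ratio: "(\<lambda>n. T (Suc n) / T n) \<longlonglongrightarrow> 1" and T0: "T 0 \<ge> 0"
    and Vup: "\<And>\<omega> k. \<omega> \<in> space M \<Longrightarrow> V k \<omega> \<le> (1 + \<kappa>) * (T (Suc k) - T k)" and \<kappa>: "0 \<le> \<kappa>"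
    and csmall: "eventually (\<lambda>n. \<forall>k<n. c k * sqrt (LL (T n)) \<le> \<delta> * sqrt (T n)) sequentially"
    and \<delta>: "\<delta> \<ge> 0" and \<eta>: "exp (2 * \<delta>) * (1 + \<kappa>) < 1 + \<eta>"
  shows "AE \<omega> in M. eventually (\<lambda>n. mart 0 n \<omega> \<le> (1 + \<eta>) * sqrt (2 * T n * LL (T n))) sequentially"
proof -
  define r where "r = (1 + \<eta>) / (exp (2 * \<delta>) * (1 + \<kappa>))"
  have e1: "exp (2 * \<delta>) * (1 + \<kappa>) \<ge> 1" using \<delta> \<kappa> mult_mono[of 1 "exp (2*\<delta>)" 1 "1+\<kappa>"] by simp
  then have r1: "r > 1" unfolding r_def using \<eta> by simp
  have \<eta>0: "\<eta> > 0" using \<eta> e1 by simp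
  \<comment> \<open>\<open>sqrt r\<close> leaves room for the squared spacing; \<open>6/5\<close>
    keeps \<open>sqrt 2 * \<theta>\<close> below 2, which gives
    \<open>l * c k \<le> 2 * \<delta>\<close> below.\<close>
  define \<theta> where "\<theta> = min (6/5) (sqrt r)"
  have \<theta>1: "\<theta> > 1" using r1 by (simp add: \<theta>_def)
  have \<theta>2: "\<theta> \<le> 6/5" by (simp add: \<theta>_def)
  have "\<theta>\<^sup>2 \<le> (sqrt r)\<^sup>2" using \<theta>1 by (intro power_mono) (auto simp: \<theta>_def)
  then have \<theta>r: "\<theta>\<^sup>2 \<le> r" using r1 by simp
  have \<theta>3: "exp (2 * \<delta>) * (1 + \<kappa>) * \<theta>\<^sup>2 \<le> 1 + \<eta>"
    using \<theta>r e1 unfolding r_def by (simp add: field_simps)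
  obtain N where N: "\<And>j. T (N j) \<ge> \<theta> ^ j" "\<And>j n. n < N j \<Longrightarrow> T n < \<theta> ^ j"
    "\<And>i j. i \<le> j \<Longrightarrow> N i \<le> N j" "eventually (\<lambda>j. T (N j) \<le> \<theta> * \<theta> ^ j) sequentially"
    "filterlim N at_top sequentially"
    using geometric_hitting_times[OF mono lim ratio \<theta>1 \<theta>1] by blast
  \<comment> \<open>The level belongs to the lower end of the block, so it lies below the
    normalisation at every \<open>n\<close> with \<open>\<theta> ^ j \<le> T n\<close>.\<close>
  define x where "x j = (1 + \<eta>) * sqrt (2 * \<theta> ^ j * LL (\<theta> ^ j))" for j
  define E where "E j = {\<omega>\<in>space M. \<exists>i\<le>N (Suc j). mart 0 i \<omega> \<ge> x j}" for j
  have [measurable]: "E j \<in> sets M" for j unfolding E_def by measurable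
  have powtop: "filterlim (\<lambda>j. \<theta> ^ j) at_top sequentially"
    using \<theta>1 by real_asymp
  have LLtop: "filterlim (\<lambda>j. LL (\<theta> ^ j)) at_top sequentially"
    by (rule filterlim_compose[OF LL_at_top powtop])
  have ev1: "eventually (\<lambda>j. T (N (Suc j)) \<le> \<theta> * \<theta> ^ Suc j) sequentially"
    by (rule eventually_sequentially_Suc[THEN iffD2, OF N(4)])
  have ev2: "eventually (\<lambda>j. LL (\<theta> ^ j) > 0) sequentially" using LLtop by (simp add: filterlim_at_top_dense)
  have ev3: "eventually (\<lambda>j. \<theta> ^ j > 1) sequentially" using powtop by (simp add: filterlim_at_top_dense)
  have "filterlim (\<lambda>j. N (Suc j)) at_top sequentially"
    by (rule filterlim_compose[OF N(5) filterlim_Suc])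
  then have ev4: "eventually (\<lambda>j. \<forall>k<N (Suc j). c k * sqrt (LL (T (N (Suc j)))) \<le> \<delta> * sqrt (T (N (Suc j)))) sequentially"
    by (rule eventually_compose_filterlim[OF csmall])
  have bound: "eventually (\<lambda>j. prob (E j) \<le> exp (- (1 + \<eta>) * LL (\<theta> ^ j))) sequentially"
    using ev1 ev2 ev3 ev4
  proof eventually_elim
    case (elim j)
    \<comment> \<open>Up to the factor \<open>1 + \<eta>\<close> this is the level divided by
      \<open>\<theta> ^ j\<close>, the optimal parameter. The exponent becomes at most
      \<open>(1 + \<eta>) - 2 * (1 + \<eta>)\<close> times \<open>LL (\<theta> ^ j)\<close>.\<close>
    define l where "l = sqrt (2 * LL (\<theta> ^ j) / \<theta> ^ j)"
    let ?y = "(1 + \<kappa>) * (\<theta>\<^sup>2 * \<theta> ^ j)"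
    have pj: "\<theta> ^ j > 0" using \<theta>1 by simp
    have TN: "T (N (Suc j)) \<le> \<theta>\<^sup>2 * \<theta> ^ j" using elim(1) by (simp add: power2_eq_square mult_ac)
    have TN': "\<theta> ^ j \<le> T (N (Suc j))"
      using N(1)[of "Suc j", unfolded power_Suc] mult_right_mono[of 1 \<theta> "\<theta> ^ j"] \<theta>1 pj by linarith
    have l0: "0 \<le> l" using elim pj by (simp add: l_def)
    have l2: "l\<^sup>2 = 2 * LL (\<theta> ^ j) / \<theta> ^ j" using elim pj by (simp add: l_def)
    have lc: "l * c k \<le> 2 * \<delta>" if "k < N (Suc j)" for k
    proof -
      have "c k * sqrt (LL (\<theta> ^ j)) \<le> c k * sqrt (LL (T (N (Suc j))))"
        using LL_mono[OF elim(3) TN'] c_nonneg[of k] by (intro mult_left_mono) auto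
      also have "\<dots> \<le> \<delta> * sqrt (T (N (Suc j)))" using elim(4) that by blast
      also have "\<dots> \<le> \<delta> * sqrt (\<theta>\<^sup>2 * \<theta> ^ j)" using TN \<delta> by (intro mult_left_mono) auto
      also have "\<dots> = \<delta> * \<theta> * sqrt (\<theta> ^ j)" using \<theta>1 by (simp add: real_sqrt_mult)
      finally have "c k * sqrt (LL (\<theta> ^ j)) / sqrt (\<theta> ^ j) \<le> \<delta> * \<theta>"
        using pj by (simp add: pos_divide_le_eq)
      then have "sqrt 2 * (c k * sqrt (LL (\<theta> ^ j)) / sqrt (\<theta> ^ j)) \<le> sqrt 2 * (\<delta> * \<theta>)"
        by (intro mult_left_mono) auto
      also have "\<dots> \<le> 1.5 * (\<delta> * (6/5))" using \<delta> \<theta>2 \<theta>1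
        by (intro mult_mono mult_left_mono real_le_lsqrt mult_nonneg_nonneg) (simp_all add: power2_eq_square)
      also have "\<dots> \<le> 2 * \<delta>" using \<delta> by simp
      finally show ?thesis unfolding l_def by (simp add: real_sqrt_mult real_sqrt_divide mult_ac)
    qed
    have R: "brak 0 i \<omega> \<le> ?y" if w: "\<omega> \<in> space M" and i: "i \<le> N (Suc j)" for \<omega> i
    proof -
      have "brak 0 i \<omega> \<le> (1 + \<kappa>) * (T i - T 0)" by (rule brak_upper) (use Vup[OF w] in auto)
      also have "\<dots> \<le> (1 + \<kappa>) * (\<theta>\<^sup>2 * \<theta> ^ j)"
        using \<kappa> T0 TN lift_Suc_mono_le[of T, OF mono i] by (intro mult_left_mono) auto
      finally show ?thesis .
    qed
    have "prob (E j) \<le> exp (l\<^sup>2 / 2 * exp (2 * \<delta>) * ?y - l * x j)"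
      unfolding E_def by (rule maximal_exp[OF l0 lc R])
    also have "\<dots> \<le> exp (- (1 + \<eta>) * LL (\<theta> ^ j))"
    proof -
      have "l * x j = (1 + \<eta>) * (2 * LL (\<theta> ^ j))"
      proof -
        have "l * sqrt (2 * \<theta> ^ j * LL (\<theta> ^ j)) = sqrt ((2 * LL (\<theta> ^ j))\<^sup>2)"
          unfolding l_def real_sqrt_mult[symmetric] using \<theta>1 by (simp add: power2_eq_square)
        also have "\<dots> = 2 * LL (\<theta> ^ j)" unfolding real_sqrt_abs using elim by simp
        finally show ?thesis by (simp add: x_def)
      qed
      moreover have "l\<^sup>2 / 2 * exp (2 * \<delta>) * ?y = (exp (2 * \<delta>) * (1 + \<kappa>) * \<theta>\<^sup>2) * LL (\<theta> ^ j)"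
        unfolding l2 using \<theta>1 by (simp add: field_simps)
      moreover have "(exp (2 * \<delta>) * (1 + \<kappa>) * \<theta>\<^sup>2) * LL (\<theta> ^ j) \<le> (1 + \<eta>) * LL (\<theta> ^ j)"
        using \<theta>3 elim by (intro mult_right_mono) auto
      ultimately show ?thesis by (simp add: algebra_simps)
    qed
    finally show ?case .
  qed
  \<comment> \<open>\<open>LL (\<theta> ^ j)\<close> is the logarithm of
    \<open>j * ln \<theta>\<close>, so the probabilities decay like \<open>j\<close> to the power
    \<open>- (1 + \<eta>)\<close>.\<close>
  have "summable (\<lambda>j. (ln \<theta> * real j) powr (- (1 + \<eta>)))"
    using \<eta>0 \<theta>1 by (simp add: powr_mult summable_real_powr_iff summable_mult)
  moreover have "eventually (\<lambda>j. norm (prob (E j)) \<le> (ln \<theta> * real j) powr (- (1 + \<eta>))) sequentially"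
    using bound ev3
  proof eventually_elim
    case (elim j)
    have "j \<noteq> 0" using elim(2) by (cases j) auto
    then have "exp (- (1 + \<eta>) * LL (\<theta> ^ j)) = (ln \<theta> * real j) powr (- (1 + \<eta>))"
      using \<theta>1 by (simp add: powr_def LL_def ln_realpow mult_ac)
    then show ?case using elim by simp
  qed
  ultimately have "summable (\<lambda>j. prob (E j))" by (rule summable_comparison_test_ev[rotated])
  then have "AE \<omega> in M. eventually (\<lambda>j. \<omega> \<in> space M - E j) sequentially"
    by (intro borel_cantelli_AE1) (auto simp: emeasure_eq_measure)
  then show ?thesis
  proof eventually_elim
    case (elim \<omega>)
    then have "eventually (\<lambda>j. \<omega> \<in> space M - E j \<and> LL (\<theta> ^ j) > 0 \<and> \<theta> ^ j > 1) sequentially"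
      using ev2 ev3 by eventually_elim auto
    then obtain J where J: "\<And>j. j \<ge> J \<Longrightarrow> \<omega> \<in> space M - E j \<and> LL (\<theta> ^ j) > 0 \<and> \<theta> ^ j > 1"
      unfolding eventually_sequentially by blast
    have "eventually (\<lambda>n. T n \<ge> \<theta> ^ J) sequentially" using lim by (simp add: filterlim_at_top)
    then show ?case
    proof eventually_elim
      case (elim n)
      obtain j where j: "J \<le> j" "\<theta> ^ j \<le> T n" "T n < \<theta> ^ Suc j"
        using geometric_bracket[OF \<theta>1 elim] by blast
      have "n \<le> N (Suc j)"
      proof (rule ccontr)
        assume "\<not> n \<le> N (Suc j)"
        then have "T (N (Suc j)) \<le> T n" by (intro lift_Suc_mono_le[of T, OF mono]) auto
        then show False using N(1)[of "Suc j"] j by simp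
      qed
      then have "mart 0 n \<omega> \<le> x j" using J[OF j(1)] unfolding E_def by force
      also have "\<dots> \<le> (1 + \<eta>) * sqrt (2 * T n * LL (T n))"
        unfolding x_def using \<eta>0 J[OF j(1)] j(2) LL_mono[of "\<theta> ^ j" "T n"]
        by (intro mult_left_mono real_sqrt_le_mono mult_mono) auto
      finally show ?case .
    qed
  qed
qed

end

section \<open>Exponential tilting on a block\<close>

lemma tilting_margin_below:
  fixes \<eta> \<nu> :: real
  assumes "0 < \<eta>" "\<eta> \<le> 1" "0 \<le> \<nu>" "\<nu> \<le> \<eta>\<^sup>2 / 20" "\<rho> \<le> 1 + \<nu>" and r: "1 - \<nu> \<le> r"
  shows "\<eta> * (1 - \<eta>) + ((1 - \<eta>)\<^sup>2 * \<rho> - (1 - \<nu>)) / 2 * r \<le> - (\<eta>\<^sup>2 / 4)"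
proof -
  have e2: "\<eta>\<^sup>2 \<le> \<eta>" using assms by (simp add: power2_eq_square mult_left_le)
  define A where "A = (1 - \<nu>) - (1 - \<eta>)\<^sup>2 * (1 + \<nu>)"
  have A: "A = 2 * \<eta> - \<eta>\<^sup>2 - \<nu> * (2 - 2 * \<eta> + \<eta>\<^sup>2)"
    by (simp add: A_def power2_eq_square algebra_simps)
  have n1: "\<nu> * (2 - 2 * \<eta> + \<eta>\<^sup>2) \<le> \<nu> * 2" using assms e2 by (intro mult_left_mono) auto
  have A1: "A \<ge> 2 * \<eta> - \<eta>\<^sup>2 - 2 * \<nu>" unfolding A using n1 by simp
  have A0: "A \<ge> 0" using A1 e2 assms by linarith
  have n2: "0 \<le> \<nu> * (2 - 2 * \<eta> + \<eta>\<^sup>2)"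
    using assms by (intro mult_nonneg_nonneg) auto
  have A2: "A \<le> 2" unfolding A using assms n2 zero_le_power2[of \<eta>] by linarith
  have "((1 - \<eta>)\<^sup>2 * \<rho> - (1 - \<nu>)) \<le> - A"
    unfolding A_def using assms mult_left_mono[of \<rho> "1 + \<nu>" "(1 - \<eta>)\<^sup>2"] by simp
  moreover have r0: "0 \<le> r" using r assms e2 by linarith
  ultimately have "((1 - \<eta>)\<^sup>2 * \<rho> - (1 - \<nu>)) / 2 * r \<le> - A / 2 * r"
    by (intro mult_right_mono) auto
  also have "\<dots> \<le> - A / 2 * (1 - \<nu>)" using A0 r by (intro mult_left_mono_neg) auto
  also have "\<dots> = - A / 2 + A * \<nu> / 2" by (simp add: field_simps)
  also have "\<dots> \<le> - A / 2 + 2 * \<nu> / 2" using A2 assms mult_right_mono[of A 2 \<nu>] by simp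
  finally have "((1 - \<eta>)\<^sup>2 * \<rho> - (1 - \<nu>)) / 2 * r \<le> - \<eta> + \<eta>\<^sup>2 / 2 + 2 * \<nu>" using A1 by simp
  moreover have "\<eta> * (1 - \<eta>) = \<eta> - \<eta>\<^sup>2" by (simp add: power2_eq_square algebra_simps)
  ultimately show ?thesis using assms by linarith
qed

text \<open>In units of \<open>l\<^sup>2 * q\<close>, the two margins bound the exponent of the
  weight with parameter \<open>l\<close> relative to the weight with parameter
  \<open>(1 - \<eta>) * l\<close> or \<open>(1 + \<eta>) * l\<close> at the matching edge of the
  window. For \<open>\<nu> = 0\<close> and \<open>\<rho> = r = 1\<close> both equal
  \<open>- \<eta>\<^sup>2 / 2\<close>; half of this is given up for the inexact bracket and
  compensators.\<close>

lemma tilting_margin_above: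
  fixes \<eta> \<nu> :: real
  assumes "0 < \<eta>" "\<eta> \<le> 1" "0 \<le> \<nu>" "\<nu> \<le> \<eta>\<^sup>2 / 20" "1 \<le> \<rho>" "\<rho> \<le> 1 + \<nu>" and r: "0 \<le> r" "r \<le> 1 + \<nu>"
  shows "- \<eta> * (1 + \<eta>) + ((1 + \<eta>)\<^sup>2 * \<rho> - (1 - \<nu>)) / 2 * r \<le> - (\<eta>\<^sup>2 / 4)"
proof -
  have e2: "\<eta>\<^sup>2 \<le> \<eta>" using assms by (simp add: power2_eq_square mult_left_le)
  define A where "A = (1 + \<eta>)\<^sup>2 * (1 + \<nu>) - (1 - \<nu>)"
  have A: "A = 2 * \<eta> + \<eta>\<^sup>2 + \<nu> * (2 + 2 * \<eta> + \<eta>\<^sup>2)"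
    by (simp add: A_def power2_eq_square algebra_simps)
  have n1: "\<nu> * (2 + 2 * \<eta> + \<eta>\<^sup>2) \<le> \<nu> * 5" using assms e2 by (intro mult_left_mono) auto
  have A0: "0 \<le> A" unfolding A using assms by simp
  have A2: "A \<le> 4" unfolding A using n1 assms e2 by linarith
  have "((1 + \<eta>)\<^sup>2 * \<rho> - (1 - \<nu>)) \<le> A"
    unfolding A_def using assms mult_left_mono[of \<rho> "1 + \<nu>" "(1 + \<eta>)\<^sup>2"] by simp
  then have "((1 + \<eta>)\<^sup>2 * \<rho> - (1 - \<nu>)) / 2 * r \<le> A / 2 * r"
    using r by (intro mult_right_mono) auto
  also have "\<dots> \<le> A / 2 * (1 + \<nu>)" using A0 r by (intro mult_left_mono) auto
  also have "\<dots> = A / 2 + A * \<nu> / 2" by (simp add: field_simps)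
  also have "\<dots> \<le> A / 2 + 4 * \<nu> / 2" using A2 assms mult_right_mono[of A 4 \<nu>] by simp
  \<comment> \<open>This error term is the larger one of the two margins and explains the
    \<open>20\<close>: it needs \<open>9 / 2 * \<nu> \<le> \<eta>\<^sup>2 / 4\<close>.\<close>
  finally have "((1 + \<eta>)\<^sup>2 * \<rho> - (1 - \<nu>)) / 2 * r \<le> \<eta> + \<eta>\<^sup>2 / 2 + 9 / 2 * \<nu>"
    using A n1 by linarith
  moreover have "- \<eta> * (1 + \<eta>) = - \<eta> - \<eta>\<^sup>2" by (simp add: power2_eq_square algebra_simps)
  ultimately show ?thesis using assms by linarith
qed

context bounded_mds
begin

text \<open>
  Exponential tilting: under the weight \<open>exp (l * mart m n)\<close> the increment concentrates
  near \<open>l * q\<close>. The parts of the weight off the window \<open>(1 - \<eta>, 1 + \<eta>) * l * q\<close> are dominated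
  by the weights with parameters \<open>(1 - \<eta>) * l\<close> and \<open>(1 + \<eta>) * l\<close>.
\<close>

lemma prob_block_lower:
  assumes G: "G \<in> sets (F m)" and mn: "m \<le> n" and \<eta>: "0 < \<eta>" "\<eta> \<le> 1" and \<nu>: "0 \<le> \<nu>" "\<nu> \<le> \<eta>\<^sup>2 / 20"
    and l: "0 \<le> l" and q: "0 < q"
    and R: "\<And>\<omega>. \<omega> \<in> space M \<Longrightarrow> (1 - \<nu>) * q \<le> brak m n \<omega>" "\<And>\<omega>. \<omega> \<in> space M \<Longrightarrow> brak m n \<omega> \<le> (1 + \<nu>) * q"
    and b: "\<And>k. k \<in> {m..<n} \<Longrightarrow> (1 + \<eta>) * l * c k \<le> \<nu> / 3"
    and large: "exp (- (\<eta>\<^sup>2 / 4 * (l\<^sup>2 * q))) \<le> 1 / 8"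
  shows "prob (G \<inter> {\<omega>\<in>space M. mart m n \<omega> \<ge> (1 - \<eta>) * (l * q)}) \<ge> prob G / 2 * exp (- (1 / 2 + 2 * \<eta>) * (l\<^sup>2 * q))"
proof -
  let ?G = "\<lambda>\<omega>. indicator G \<omega> :: real"
  \<comment> \<open>A third of \<open>\<nu>\<close> suffices for both compensators:
    \<open>exp (\<nu> / 3) \<le> 1 + \<nu>\<close> for the upper bound, and the factor lost in
    \<open>exp_mart_lower\<close> is at least \<open>1 - \<nu>\<close>.\<close>
  let ?\<beta> = "\<nu> / 3"
  define \<rho> where "\<rho> = exp ?\<beta>"
  define Z where "Z l \<rho> \<omega> = exp (l * mart m n \<omega> - l\<^sup>2 / 2 * \<rho> * brak m n \<omega>)" for l \<rho> \<omega>
  define e1 where "e1 = exp (- (\<eta>\<^sup>2 / 4 * (l\<^sup>2 * q)))"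
  define e2 where "e2 = exp ((1 / 2 + 2 * \<eta>) * (l\<^sup>2 * q))"
  define A where "A = {\<omega>\<in>space M. mart m n \<omega> \<ge> (1 - \<eta>) * (l * q)}"
  have [measurable]: "G \<in> sets M" using G sets_F by blast
  have [measurable]: "A \<in> sets M" unfolding A_def by measurable
  have expectation_indicator: "expectation (\<lambda>\<omega>. indicator (G \<inter> A) \<omega>) = prob (G \<inter> A)"
    by simp
  have eta2: "\<eta>\<^sup>2 \<le> 1" using \<eta> by (simp add: power_le_one)
  have \<nu>1: "\<nu> \<le> 1 / 20" using \<nu> eta2 by linarith
  have \<rho>1: "1 \<le> \<rho>" using \<nu> by (simp add: \<rho>_def)
  have \<rho>2: "\<rho> \<le> 1 + \<nu>"
  proof -
    have "exp ?\<beta> \<le> 1 + ?\<beta> + ?\<beta>\<^sup>2" using \<nu> \<nu>1 by (intro exp_bound) auto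
    moreover have "?\<beta>\<^sup>2 \<le> ?\<beta> * 1" unfolding power2_eq_square using \<nu> \<nu>1 by (intro mult_left_mono) auto
    ultimately show ?thesis unfolding \<rho>_def using \<nu> by simp
  qed
  have low: "1 - \<nu> \<le> exp (- ?\<beta>) * (1 - ?\<beta>\<^sup>2 / 2)"
  proof -
    have b2: "?\<beta>\<^sup>2 \<le> ?\<beta> * 1" unfolding power2_eq_square using \<nu> \<nu>1 by (intro mult_left_mono) auto
    have "(1 - ?\<beta>) * (1 - ?\<beta>) \<le> exp (- ?\<beta>) * (1 - ?\<beta>\<^sup>2 / 2)"
      using exp_ge_add_one_self[of "- ?\<beta>"] b2 \<nu> \<nu>1 by (intro mult_mono) auto
    moreover have "(1 - ?\<beta>) * (1 - ?\<beta>) = 1 - 2 * ?\<beta> + ?\<beta>\<^sup>2" by (simp add: power2_eq_square algebra_simps)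
    moreover have "0 \<le> ?\<beta>\<^sup>2" by simp
    ultimately show ?thesis using \<nu> by linarith
  qed
  have cb: "x * l * c k \<le> \<nu> / 3" if "k \<in> {m..<n}" "x \<le> 1 + \<eta>" for k x
    using b[OF that(1)] mult_right_mono[of x "1 + \<eta>" "l * c k"] that l c_nonneg[of k] by (simp add: mult.assoc)
  have up: "expectation (\<lambda>\<omega>. ?G \<omega> * Z (x * l) \<rho> \<omega>) \<le> prob G" if x: "0 \<le> x" "x \<le> 1 + \<eta>" for x
  proof -
    have "expectation (\<lambda>\<omega>. ?G \<omega> * Z (x * l) \<rho> \<omega>) \<le> expectation ?G"
      unfolding Z_def \<rho>_def using G mn cb x l
      by (intro exp_mart_upper[of _ _ 1]) (auto simp: indicator_def abs_mult)
    then show ?thesis by simp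
  qed
  have lo: "prob G \<le> expectation (\<lambda>\<omega>. ?G \<omega> * Z l (1 - \<nu>) \<omega>)"
  proof -
    have "expectation ?G \<le> expectation (\<lambda>\<omega>. ?G \<omega> * Z l (1 - \<nu>) \<omega>)"
      unfolding Z_def using G mn cb[of _ 1] \<eta> l \<nu> \<nu>1 low
      by (intro exp_mart_lower[of _ _ 1 _ _ ?\<beta>]) (auto simp: indicator_def)
    then show ?thesis by simp
  qed
  have Zi: "integrable M (\<lambda>\<omega>. ?G \<omega> * Z x y \<omega>)" if "0 \<le> y" for x y
  proof (rule integrable_bounded)
    show "(\<lambda>\<omega>. ?G \<omega> * Z x y \<omega>) \<in> borel_measurable M" unfolding Z_def by measurable
    fix \<omega> assume w: "\<omega> \<in> space M"
    show "\<bar>?G \<omega> * Z x y \<omega>\<bar> \<le> exp (\<bar>x\<bar> * (\<Sum>k=m..<n. c k))"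
      unfolding Z_def using exp_mart_bound[OF w that, of x m n] by (auto simp: indicator_def)
  qed
  have Ai: "integrable M (\<lambda>\<omega>. indicator (G \<inter> A) \<omega> :: real)"
    by (intro integrable_real_indicator) (auto simp: emeasure_eq_measure)
  have pointwise: "Z l (1 - \<nu>) \<omega> \<le> e1 * Z ((1 - \<eta>) * l) \<rho> \<omega> + e1 * Z ((1 + \<eta>) * l) \<rho> \<omega> + e2 * indicator A \<omega>"
    if w: "\<omega> \<in> space M" for \<omega>
  proof -
    define r where "r = brak m n \<omega> / q"
    have r: "brak m n \<omega> = r * q" using q by (simp add: r_def)
    have r1: "1 - \<nu> \<le> r" "r \<le> 1 + \<nu>" using R[OF w] q by (simp_all add: r_def field_simps)
    have r0: "0 \<le> r" using r1 \<nu>1 by simp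
    define L where "L = l\<^sup>2 * q"
    have L0: "0 \<le> L" using q by (simp add: L_def)
    define y where "y = mart m n \<omega>"
    have Zr: "Z x z \<omega> = exp (x * y - x\<^sup>2 / 2 * z * (r * q))" for x z
      by (simp add: Z_def r y_def)
    have lq: "l * (l * q) = L" by (simp add: L_def power2_eq_square)
    consider "y < (1 - \<eta>) * (l * q)" | "y > (1 + \<eta>) * (l * q)" | "(1 - \<eta>) * (l * q) \<le> y" "y \<le> (1 + \<eta>) * (l * q)"
      by linarith
    then show ?thesis
    proof cases
      case 1
      have "\<eta> * (l * y) \<le> \<eta> * (l * ((1 - \<eta>) * (l * q)))"
        using 1 l \<eta> by (intro mult_left_mono) auto
      also have "\<dots> = \<eta> * (1 - \<eta>) * L" using lq by (simp add: mult_ac)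
      finally have a: "\<eta> * (l * y) \<le> \<eta> * (1 - \<eta>) * L" .
      have m: "(\<eta> * (1 - \<eta>) + ((1 - \<eta>)\<^sup>2 * \<rho> - (1 - \<nu>)) / 2 * r) * L \<le> - (\<eta>\<^sup>2 / 4) * L"
        using \<eta> \<nu> \<rho>2 r1 L0 by (intro mult_right_mono tilting_margin_below) auto
      have b: "l * y - l\<^sup>2 / 2 * (1 - \<nu>) * (r * q) \<le>
          - (\<eta>\<^sup>2 / 4 * (l\<^sup>2 * q)) + ((1 - \<eta>) * l * y - ((1 - \<eta>) * l)\<^sup>2 / 2 * \<rho> * (r * q))"
      proof -
        have "((1 - \<eta>) * l)\<^sup>2 / 2 * \<rho> * (r * q) - l\<^sup>2 / 2 * (1 - \<nu>) * (r * q) = ((1 - \<eta>)\<^sup>2 * \<rho> - (1 - \<nu>)) / 2 * r * L"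
          unfolding L_def power_mult_distrib by (simp add: field_simps)
        moreover have "(1 - \<eta>) * l * y = l * y - \<eta> * (l * y)" by (simp add: algebra_simps)
        ultimately show ?thesis using a m[unfolded distrib_right] unfolding L_def[symmetric] by linarith
      qed
      then have "Z l (1 - \<nu>) \<omega> \<le> e1 * Z ((1 - \<eta>) * l) \<rho> \<omega>"
        unfolding Zr e1_def exp_add[symmetric] exp_le_cancel_iff .
      moreover have "0 \<le> e1 * Z ((1 + \<eta>) * l) \<rho> \<omega>" "0 \<le> e2 * indicator A \<omega>"
        by (simp_all add: Z_def e1_def e2_def)
      ultimately show ?thesis by linarith
    next
      case 2
      have "\<eta> * (l * y) \<ge> \<eta> * (l * ((1 + \<eta>) * (l * q)))"
        using 2 l \<eta> by (intro mult_left_mono) auto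
      moreover have "\<eta> * (l * ((1 + \<eta>) * (l * q))) = \<eta> * (1 + \<eta>) * L" using lq by (simp add: mult_ac)
      ultimately have a: "- \<eta> * (l * y) \<le> - \<eta> * (1 + \<eta>) * L" by simp
      have m: "(- \<eta> * (1 + \<eta>) + ((1 + \<eta>)\<^sup>2 * \<rho> - (1 - \<nu>)) / 2 * r) * L \<le> - (\<eta>\<^sup>2 / 4) * L"
        using \<eta> \<nu> \<rho>1 \<rho>2 r1 r0 L0 by (intro mult_right_mono tilting_margin_above) auto
      have b: "l * y - l\<^sup>2 / 2 * (1 - \<nu>) * (r * q) \<le>
          - (\<eta>\<^sup>2 / 4 * (l\<^sup>2 * q)) + ((1 + \<eta>) * l * y - ((1 + \<eta>) * l)\<^sup>2 / 2 * \<rho> * (r * q))"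
      proof -
        have "((1 + \<eta>) * l)\<^sup>2 / 2 * \<rho> * (r * q) - l\<^sup>2 / 2 * (1 - \<nu>) * (r * q) = ((1 + \<eta>)\<^sup>2 * \<rho> - (1 - \<nu>)) / 2 * r * L"
          unfolding L_def power_mult_distrib by (simp add: field_simps)
        moreover have "(1 + \<eta>) * l * y = l * y + \<eta> * (l * y)" by (simp add: algebra_simps)
        ultimately show ?thesis using a m[unfolded distrib_right] unfolding L_def[symmetric] by linarith
      qed
      then have "Z l (1 - \<nu>) \<omega> \<le> e1 * Z ((1 + \<eta>) * l) \<rho> \<omega>"
        unfolding Zr e1_def exp_add[symmetric] exp_le_cancel_iff .
      moreover have "0 \<le> e1 * Z ((1 - \<eta>) * l) \<rho> \<omega>" "0 \<le> e2 * indicator A \<omega>"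
        by (simp_all add: Z_def e1_def e2_def)
      ultimately show ?thesis by linarith
    next
      case 3
      \<comment> \<open>Inside the window the exponent is largest at the upper edge, where it is
        \<open>(1 + \<eta>) - (1 - \<nu>) * r / 2\<close> in units of \<open>L\<close>, with
        \<open>r \<ge> 1 - \<nu>\<close>. This is the source of \<open>1 / 2 + 2 * \<eta>\<close> in
        the probability bound.\<close>
      have "l * y \<le> l * ((1 + \<eta>) * (l * q))" by (rule mult_left_mono[OF 3(2) l])
      also have "\<dots> = (1 + \<eta>) * L" unfolding lq[symmetric] by simp
      finally have a: "l * y \<le> (1 + \<eta>) * L" .
      have "(1 - \<nu>) * (1 - \<nu>) \<ge> 1 - 2 * \<nu>" by (simp add: algebra_simps)
      moreover have "(1 - \<nu>) * (1 - \<nu>) \<le> (1 - \<nu>) * r" using r1 \<nu>1 by (intro mult_left_mono) auto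
      ultimately have "(1 - 2 * \<nu>) / 2 \<le> (1 - \<nu>) * r / 2" by simp
      moreover have "\<nu> \<le> \<eta>"
      proof -
        have "\<eta>\<^sup>2 \<le> \<eta>" using \<eta> by (simp add: power2_eq_square mult_left_le)
        then show ?thesis using \<nu> \<eta> by linarith
      qed
      ultimately have "(1 + \<eta>) - (1 - \<nu>) * r / 2 \<le> 1 / 2 + 2 * \<eta>" by (simp add: field_simps)
      then have "((1 + \<eta>) - (1 - \<nu>) * r / 2) * L \<le> (1 / 2 + 2 * \<eta>) * L" using L0 by (rule mult_right_mono)
      then have "l * y - l\<^sup>2 / 2 * (1 - \<nu>) * (r * q) \<le> (1 / 2 + 2 * \<eta>) * L"
      proof -
        have "((1 + \<eta>) - (1 - \<nu>) * r / 2) * L = (1 + \<eta>) * L - l\<^sup>2 / 2 * (1 - \<nu>) * (r * q)"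
          unfolding L_def by (simp add: field_simps)
        with \<open>((1 + \<eta>) - (1 - \<nu>) * r / 2) * L \<le> (1 / 2 + 2 * \<eta>) * L\<close> show ?thesis using a by linarith
      qed
      then have "Z l (1 - \<nu>) \<omega> \<le> e2"
        unfolding Zr e2_def L_def exp_le_cancel_iff .
      moreover have "indicator A \<omega> = (1::real)" using 3 w by (simp add: y_def A_def)
      moreover have "0 \<le> e1 * Z ((1 - \<eta>) * l) \<rho> \<omega>" "0 \<le> e1 * Z ((1 + \<eta>) * l) \<rho> \<omega>"
        by (simp_all add: Z_def e1_def)
      ultimately show ?thesis by simp
    qed
  qed
  have "prob G \<le> expectation (\<lambda>\<omega>. ?G \<omega> * Z l (1 - \<nu>) \<omega>)" by (rule lo)
  also have "\<dots> \<le> expectation (\<lambda>\<omega>. e1 * (?G \<omega> * Z ((1 - \<eta>) * l) \<rho> \<omega>) + e1 * (?G \<omega> * Z ((1 + \<eta>) * l) \<rho> \<omega>)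
      + e2 * indicator (G \<inter> A) \<omega>)"
  proof (rule integral_mono)
    show "integrable M (\<lambda>\<omega>. ?G \<omega> * Z l (1 - \<nu>) \<omega>)" using \<nu>1 by (intro Zi) auto
    show "integrable M (\<lambda>\<omega>. e1 * (?G \<omega> * Z ((1 - \<eta>) * l) \<rho> \<omega>) + e1 * (?G \<omega> * Z ((1 + \<eta>) * l) \<rho> \<omega>)
      + e2 * indicator (G \<inter> A) \<omega>)"
      using \<rho>1 Ai by (intro Bochner_Integration.integrable_add integrable_mult_right Zi) auto
    fix \<omega> assume w: "\<omega> \<in> space M"
    show "?G \<omega> * Z l (1 - \<nu>) \<omega> \<le> e1 * (?G \<omega> * Z ((1 - \<eta>) * l) \<rho> \<omega>) + e1 * (?G \<omega> * Z ((1 + \<eta>) * l) \<rho> \<omega>)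
      + e2 * indicator (G \<inter> A) \<omega>"
    proof (cases "\<omega> \<in> G")
      case True
      then have "?G \<omega> = 1" "indicator (G \<inter> A) \<omega> = (indicator A \<omega> :: real)"
        by (simp_all add: indicator_def)
      then show ?thesis using pointwise[OF w] by (simp only: mult_1)
    next
      case False
      then show ?thesis by (simp add: indicator_def)
    qed
  qed
  also have "\<dots> = e1 * expectation (\<lambda>\<omega>. ?G \<omega> * Z ((1 - \<eta>) * l) \<rho> \<omega>) + e1 * expectation (\<lambda>\<omega>. ?G \<omega> * Z ((1 + \<eta>) * l) \<rho> \<omega>)
      + e2 * expectation (\<lambda>\<omega>. indicator (G \<inter> A) \<omega>)"
    using \<rho>1 Ai Zi[of \<rho>] by simp
  \<comment> \<open>By \<open>large\<close> each side of the window accounts for at most an eighth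
    of \<open>prob G\<close>; the window has to carry the rest.\<close>
  also have "\<dots> \<le> (1 / 8) * prob G + (1 / 8) * prob G + e2 * prob (G \<inter> A)"
  proof -
    have "e1 * expectation (\<lambda>\<omega>. ?G \<omega> * Z (x * l) \<rho> \<omega>) \<le> (1 / 8) * prob G" if "0 \<le> x" "x \<le> 1 + \<eta>" for x
    proof -
      have "e1 * expectation (\<lambda>\<omega>. ?G \<omega> * Z (x * l) \<rho> \<omega>) \<le> e1 * prob G"
        using up[OF that] by (intro mult_left_mono) (simp_all add: e1_def)
      also have "\<dots> \<le> (1 / 8) * prob G" using large unfolding e1_def by (intro mult_right_mono) auto
      finally show ?thesis .
    qed
    from this[of "1 - \<eta>"] this[of "1 + \<eta>"] \<eta>
    have "e1 * expectation (\<lambda>\<omega>. ?G \<omega> * Z ((1 - \<eta>) * l) \<rho> \<omega>) \<le> (1 / 8) * prob G"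
      "e1 * expectation (\<lambda>\<omega>. ?G \<omega> * Z ((1 + \<eta>) * l) \<rho> \<omega>) \<le> (1 / 8) * prob G" by linarith+
    moreover have "expectation (\<lambda>\<omega>. indicator (G \<inter> A) \<omega>) = prob (G \<inter> A)"
      using expectation_indicator .
    ultimately show ?thesis by simp
  qed
  finally have "prob G / 2 \<le> e2 * prob (G \<inter> A)" using measure_nonneg[of M G] by linarith
  moreover have "0 < e2" by (simp add: e2_def)
  ultimately have "prob G / 2 * (1 / e2) \<le> prob (G \<inter> A)"
    by (simp add: field_simps)
  moreover have "1 / e2 = exp (- (1 / 2 + 2 * \<eta>) * (l\<^sup>2 * q))"
    unfolding e2_def minus_mult_left[symmetric] exp_minus inverse_eq_divide ..
  ultimately show ?thesis unfolding A_def by simp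
qed

end

text \<open>The block probabilities of the lower half have this shape: \<open>ln (T (N j))\<close>
  grows linearly in \<open>j\<close> along geometric times, so their sum diverges like the harmonic
  series.\<close>

lemma not_summable_inverse_linear:
  fixes a b :: real
  assumes "0 < a" "0 \<le> b"
  shows "\<not> summable (\<lambda>j. 1 / (b + a * real (Suc j)))"
proof
  assume s: "summable (\<lambda>j. 1 / (b + a * real (Suc j)))"
  have "summable (\<lambda>j. (a + b) * (1 / (b + a * real (Suc j))))" using s by (rule summable_mult)
  moreover have "norm (1 / real (Suc j)) \<le> (a + b) * (1 / (b + a * real (Suc j)))" for j
  proof -
    have "b + a * real (Suc j) \<le> (a + b) * real (Suc j)" using assms by (simp add: algebra_simps)
    moreover have "0 < b + a * real (Suc j)" using assms by (simp add: add_nonneg_pos)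
    ultimately show ?thesis by (simp add: field_simps del: of_nat_Suc)
  qed
  ultimately have "summable (\<lambda>j. 1 / real (Suc j))" by (rule summable_comparison_test'[where N=0]) 
  then have "summable (\<lambda>n. inverse (real n))"
    unfolding inverse_eq_divide by (subst summable_Suc_iff[symmetric])
  then show False using not_summable_harmonic[where 'a=real] by simp
qed

context prob_space
begin

text \<open>A second Borel-Cantelli lemma without independence: \<open>A j\<close> need only have
  relative probability at least \<open>p j\<close> on the event that nothing has occurred since
  \<open>J\<close>. The probability of no success is then at most the product of the factors
  \<open>1 - p i\<close>, hence at most the exponential of minus a divergent sum.\<close>

lemma AE_frequently_of_lower_bounds:
  fixes A :: "nat \<Rightarrow> 'a set" and p :: "nat \<Rightarrow> real"
  assumes [measurable]: "\<And>j. A j \<in> events"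
    and lower: "\<And>J j. j0 \<le> J \<Longrightarrow> J \<le> j \<Longrightarrow> prob ((\<Inter>i\<in>{J..<j}. space M - A i) \<inter> space M \<inter> A j) \<ge> p j * prob ((\<Inter>i\<in>{J..<j}. space M - A i) \<inter> space M)"
    and p: "\<And>j. 0 \<le> p j" "\<not> summable p"
  shows "AE \<omega> in M. frequently (\<lambda>j. \<omega> \<in> A j) sequentially"
proof -
  define G where "G J j = (\<Inter>i\<in>{J..<j}. space M - A i) \<inter> space M" for J j
  have [measurable]: "G J j \<in> events" for J j unfolding G_def by measurable
  have G_le: "prob (G J j) \<le> exp (- (\<Sum>i=J..<j. p i))" if "j0 \<le> J" "J \<le> j" for J j
    using that(2)
  proof (induction j rule: dec_induct)
    case base
    then show ?case by simp
  next
    case (step j)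
    have eq: "G J (Suc j) = G J j - (G J j \<inter> A j)"
      using step by (auto simp: G_def less_Suc_eq)
    have "prob (G J (Suc j)) = prob (G J j) - prob (G J j \<inter> A j)"
      unfolding eq by (intro finite_measure_Diff) auto
    also have "\<dots> \<le> prob (G J j) - p j * prob (G J j)"
      using lower[of J j] that(1) step by (simp add: G_def)
    also have "\<dots> = (1 + - p j) * prob (G J j)" by (simp add: algebra_simps)
    also have "\<dots> \<le> exp (- p j) * prob (G J j)" by (intro mult_right_mono exp_ge_add_one_self) auto
    also have "\<dots> \<le> exp (- p j) * exp (- (\<Sum>i=J..<j. p i))" using step by (intro mult_left_mono) auto
    also have "\<dots> = exp (- (\<Sum>i=J..<Suc j. p i))" using step by (simp add: exp_add[symmetric])
    finally show ?case .
  qed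
  have null: "prob (\<Inter>j. G J j) = 0" if "j0 \<le> J" for J
  proof -
    have "\<not> summable (\<lambda>i. p (i + J))" using p(2) by (simp add: summable_iff_shift)
    then have "filterlim (\<lambda>n. \<Sum>i<n. p (i + J)) at_top sequentially"
    proof (rule contrapos_np)
      assume nt: "\<not> filterlim (\<lambda>n. \<Sum>i<n. p (i + J)) at_top sequentially"
      have inc: "incseq (\<lambda>n. \<Sum>i<n. p (i + J))" using p(1) by (auto intro!: incseq_SucI)
      obtain Z where Z: "\<not> eventually (\<lambda>n. Z \<le> (\<Sum>i<n. p (i + J))) sequentially"
        using nt by (auto simp: filterlim_at_top)
      have "(\<Sum>i<n. p (i + J)) \<le> Z" for n
      proof (rule ccontr)
        assume "\<not> (\<Sum>i<n. p (i + J)) \<le> Z"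
        then have "Z \<le> (\<Sum>i<m. p (i + J))" if "m \<ge> n" for m
          using incseqD[OF inc that] by linarith
        then show False using Z unfolding eventually_sequentially by blast
      qed
      then show "summable (\<lambda>i. p (i + J))" using p(1) by (intro summableI_nonneg_bounded)
    qed
    then have "((\<lambda>n. exp (- (\<Sum>i<n. p (i + J)))) \<longlongrightarrow> 0) sequentially"
      by (intro filterlim_compose[OF exp_at_bot] filterlim_compose[OF filterlim_uminus_at_bot_at_top])
    moreover have "prob (\<Inter>j. G J j) \<le> exp (- (\<Sum>i<n. p (i + J)))" for n
    proof -
      have "prob (\<Inter>j. G J j) \<le> prob (G J (J + n))" by (intro finite_measure_mono) auto
      also have "\<dots> \<le> exp (- (\<Sum>i=J..<J + n. p i))" using that by (intro G_le) auto
      also have "(\<Sum>i=J..<J + n. p i) = (\<Sum>i<n. p (i + J))"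
        using sum.shift_bounds_nat_ivl[of p 0 J n] by (simp add: atLeast0LessThan add.commute)
      finally show ?thesis .
    qed
    ultimately have "prob (\<Inter>j. G J j) \<le> 0" by (intro tendsto_lowerbound[where F=sequentially]) auto
    then show ?thesis using measure_nonneg[of M "\<Inter>j. G J j"] by linarith
  qed
  have "AE \<omega> in M. \<omega> \<notin> (\<Inter>j. G (max j0 J) j)" for J
  proof (rule AE_not_in)
    show "(\<Inter>j. G (max j0 J) j) \<in> null_sets M"
      using null[of "max j0 J"] by (intro null_setsI) (auto simp: emeasure_eq_measure)
  qed
  then have "AE \<omega> in M. \<forall>J. \<omega> \<notin> (\<Inter>j. G (max j0 J) j)" by (simp add: AE_all_countable)
  then show ?thesis using AE_space
  proof eventually_elim
    case (elim \<omega>)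
    show ?case unfolding frequently_sequentially
    proof
      fix J
      obtain j where "\<omega> \<notin> G (max j0 J) j" using elim(1) by blast
      then obtain i where "i \<in> {max j0 J..<j}" "\<omega> \<in> A i" using elim(2) unfolding G_def by blast
      then have "i \<ge> J" by simp
      with \<open>\<omega> \<in> A i\<close> show "\<exists>i\<ge>J. \<omega> \<in> A i" by blast
    qed
  qed
qed

end

section \<open>The lower half for bounded martingale differences\<close>

context bounded_mds
begin

text \<open>Applied to the reflected martingale, the upper half bounds how far below zero the
  martingale can be when a block starts.\<close>

lemma uminus_bounded_mds: "bounded_mds M F (\<lambda>k \<omega>. - D k \<omega>) V c"
proof (unfold_locales)
  show "(\<lambda>\<omega>. - D k \<omega>) \<in> borel_measurable (F (Suc k))" for k using D_meas[of k] by simp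
  show "expectation (\<lambda>\<omega>. H \<omega> * - D k \<omega>) = 0"
    if "H \<in> borel_measurable (F k)" "\<And>\<omega>. \<omega> \<in> space M \<Longrightarrow> \<bar>H \<omega>\<bar> \<le> B" for H k B
    using D_centered[OF that] by simp
  show "expectation (\<lambda>\<omega>. H \<omega> * (- D k \<omega>)\<^sup>2) = expectation (\<lambda>\<omega>. H \<omega> * V k \<omega>)"
    if "H \<in> borel_measurable (F k)" "\<And>\<omega>. \<omega> \<in> space M \<Longrightarrow> \<bar>H \<omega>\<bar> \<le> B" for H k B
    using D_variance[OF that] by simp
qed (use V_meas D_bound V_nonneg V_bound in auto)

lemma mart_split: "l \<le> m \<Longrightarrow> m \<le> n \<Longrightarrow> mart l n \<omega> = mart l m \<omega> + mart m n \<omega>"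
  unfolding mart_def by (simp add: sum.atLeastLessThan_concat)

text \<open>On widely spaced geometric times a single block carries almost all of the variance, and
  \<open>prob_block_lower\<close> makes its increment large infinitely often. The loss
  \<open>5 * \<eta>\<close> is spent as follows: \<open>\<eta>\<close> for the tilting window,
  \<open>2 * \<eta>\<close> for \<open>sqrt \<gamma>\<close>, \<open>\<eta>\<close> for the variance
  missing from the block, and \<open>\<eta>\<close> for the value at the start of the block.\<close>

lemma lil_lower:
  fixes T :: "nat \<Rightarrow> real"
  assumes mono: "\<And>n. T n \<le> T (Suc n)" and lim: "filterlim T at_top sequentially"
    and ratio: "(\<lambda>n. T (Suc n) / T n) \<longlonglongrightarrow> 1" and T0: "T 0 \<ge> 0"
    and Vup: "\<And>\<omega> k. \<omega> \<in> space M \<Longrightarrow> V k \<omega> \<le> (1 + \<kappa>) * (T (Suc k) - T k)"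
    and Vlo: "\<And>\<omega> k. \<omega> \<in> space M \<Longrightarrow> V k \<omega> \<ge> (1 - \<kappa>) * (T (Suc k) - T k)"
    and csmall: "eventually (\<lambda>n. \<forall>k<n. c k * sqrt (LL (T n)) \<le> \<delta> * sqrt (T n)) sequentially"
    and \<eta>: "0 < \<eta>" "\<eta> \<le> 1 / 4" and \<kappa>: "0 \<le> \<kappa>" "\<kappa> \<le> \<eta>\<^sup>2 / 20" and \<delta>: "\<delta> \<ge> 0" "\<delta> \<le> \<eta>\<^sup>2 / 200"
  shows "AE \<omega> in M. frequently (\<lambda>n. mart 0 n \<omega> \<ge> (1 - 5 * \<eta>) * sqrt (2 * T n * LL (T n))) sequentially"
proof -
  define \<nu> where "\<nu> = \<eta>\<^sup>2 / 20"
  have \<eta>2: "\<eta>\<^sup>2 \<le> 1 / 16" using power_mono[of \<eta> "1/4" 2] \<eta> by (simp add: power2_eq_square)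
  have \<eta>2': "0 < \<eta>\<^sup>2" using \<eta> by simp
  \<comment> \<open>Large enough that the variance before a block is at most the fraction
    \<open>2 / \<theta> = \<eta>\<^sup>2 / 50\<close> of the total; twice the normalisation at the
    start of a block is then below \<open>\<eta>\<close> times the one at its end.\<close>
  define \<theta> where "\<theta> = 100 / \<eta>\<^sup>2"
  have \<theta>: "\<theta> \<ge> 1600" "\<theta> > 1" using \<eta>2 \<eta>2' by (simp_all add: \<theta>_def field_simps)
  \<comment> \<open>Solves \<open>(1 / 2 + 2 * \<eta>) * (2 * \<gamma>) = 1\<close>, so that a block
    succeeds with relative probability at least \<open>1 / (2 * ln (T (N (Suc j))))\<close>, which
    is just not summable.\<close>
  define \<gamma> where "\<gamma> = 1 / (1 + 4 * \<eta>)"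
  have \<gamma>: "0 < \<gamma>" "\<gamma> \<le> 1" using \<eta> by (simp_all add: \<gamma>_def)
  have two: "(1::real) < 2" by simp
  obtain N where N: "\<And>j. T (N j) \<ge> \<theta> ^ j" "\<And>j n. n < N j \<Longrightarrow> T n < \<theta> ^ j"
    "\<And>i j. i \<le> j \<Longrightarrow> N i \<le> N j" "eventually (\<lambda>j. T (N j) \<le> 2 * \<theta> ^ j) sequentially"
    "filterlim N at_top sequentially"
    using geometric_hitting_times[OF mono lim ratio \<theta>(2), of 2] two by blast
  define q where "q j = T (N (Suc j)) - T (N j)" for j
  define l where "l j = sqrt (2 * \<gamma> * LL (T (N (Suc j))) / q j)" for j
  define A where "A j = {\<omega>\<in>space M. mart (N j) (N (Suc j)) \<omega> \<ge> (1 - \<eta>) * (l j * q j)}" for j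
  define p where "p j = 1 / (2 * ln 2 + 2 * ln \<theta> * real (Suc j))" for j
  have NSuc: "filterlim (\<lambda>j. N (Suc j)) at_top sequentially"
    by (rule filterlim_compose[OF N(5) filterlim_Suc])
  have TNtop: "filterlim (\<lambda>j. T (N (Suc j))) at_top sequentially"
    by (rule filterlim_compose[OF lim NSuc])
  have LLtop: "filterlim (\<lambda>j. LL (T (N (Suc j)))) at_top sequentially"
    by (rule filterlim_compose[OF LL_at_top TNtop])
  have "eventually (\<lambda>j. T (N (Suc j)) \<le> 2 * \<theta> ^ Suc j) sequentially"
    by (rule eventually_sequentially_Suc[THEN iffD2, OF N(4)])
  moreover have "eventually (\<lambda>j. \<forall>k<N (Suc j). c k * sqrt (LL (T (N (Suc j)))) \<le> \<delta> * sqrt (T (N (Suc j)))) sequentially"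
    by (rule eventually_compose_filterlim[OF csmall NSuc])
  moreover have "eventually (\<lambda>j. LL (T (N (Suc j))) \<ge> max 1 (ln 8 * (4 / \<eta>\<^sup>2))) sequentially"
    using LLtop unfolding filterlim_at_top by blast
  moreover have "eventually (\<lambda>j. T (N (Suc j)) > 1) sequentially" using TNtop by (simp add: filterlim_at_top_dense)
  ultimately have "eventually (\<lambda>j. T (N j) \<le> 2 * \<theta> ^ j \<and> T (N (Suc j)) \<le> 2 * \<theta> ^ Suc j \<and>
      (\<forall>k<N (Suc j). c k * sqrt (LL (T (N (Suc j)))) \<le> \<delta> * sqrt (T (N (Suc j)))) \<and>
      LL (T (N (Suc j))) \<ge> max 1 (ln 8 * (4 / \<eta>\<^sup>2)) \<and> T (N (Suc j)) > 1) sequentially"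
    using N(4) by eventually_elim auto
  then obtain j0 where j0: "\<And>j. j \<ge> j0 \<Longrightarrow> T (N j) \<le> 2 * \<theta> ^ j \<and> T (N (Suc j)) \<le> 2 * \<theta> ^ Suc j \<and>
      (\<forall>k<N (Suc j). c k * sqrt (LL (T (N (Suc j)))) \<le> \<delta> * sqrt (T (N (Suc j)))) \<and>
      LL (T (N (Suc j))) \<ge> max 1 (ln 8 * (4 / \<eta>\<^sup>2)) \<and> T (N (Suc j)) > 1"
    unfolding eventually_sequentially by blast
  have Tj: "T (N j) \<le> (2 / \<theta>) * T (N (Suc j))" if "j \<ge> j0" for j
  proof -
    have "T (N j) \<le> 2 * \<theta> ^ j" using j0[OF that] by blast
    also have "\<dots> = (2 / \<theta>) * \<theta> ^ Suc j" using \<theta> by simp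
    also have "\<dots> \<le> (2 / \<theta>) * T (N (Suc j))" using N(1)[of "Suc j"] \<theta> by (intro mult_left_mono) auto
    finally show ?thesis .
  qed
  have q1: "q j \<ge> (1 - 2 / \<theta>) * T (N (Suc j))" if "j \<ge> j0" for j
    using Tj[OF that] unfolding q_def left_diff_distrib by linarith
  have t2: "2 / \<theta> \<le> 1 / 2" using \<theta> by (simp add: field_simps)
  have q2: "2 * q j \<ge> T (N (Suc j))" if "j \<ge> j0" for j
  proof -
    have "1 / 2 * T (N (Suc j)) \<le> (1 - 2 / \<theta>) * T (N (Suc j))"
      using t2 j0[OF that] by (intro mult_right_mono) auto
    then show ?thesis using q1[OF that] by linarith
  qed
  have q0: "q j > 0" if "j \<ge> j0" for j using q2[OF that] j0[OF that] by linarith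
  have l0: "l j \<ge> 0" if "j \<ge> j0" for j
    unfolding l_def using j0[OF that] q0[OF that] \<gamma> by (intro real_sqrt_ge_zero divide_nonneg_nonneg mult_nonneg_nonneg) auto
  have lq: "(l j)\<^sup>2 * q j = 2 * \<gamma> * LL (T (N (Suc j)))" if "j \<ge> j0" for j
    unfolding l_def using j0[OF that] q0[OF that] \<gamma> by simp
  have lq2: "l j * q j = sqrt (2 * \<gamma> * q j * LL (T (N (Suc j))))" if "j \<ge> j0" for j
  proof -
    have "l j * q j = sqrt ((l j * q j)\<^sup>2)" using l0[OF that] q0[OF that] by simp
    also have "(l j * q j)\<^sup>2 = ((l j)\<^sup>2 * q j) * q j" by (simp add: power2_eq_square)
    also have "\<dots> = 2 * \<gamma> * q j * LL (T (N (Suc j)))" unfolding lq[OF that] by simp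
    finally show ?thesis .
  qed
  have lc: "l j * c k \<le> 2 * \<delta>" if "j \<ge> j0" "k < N (Suc j)" for j k
  proof -
    have "(l j * c k)\<^sup>2 * q j = 2 * \<gamma> * (c k * sqrt (LL (T (N (Suc j)))))\<^sup>2"
    proof -
      have "(l j * c k)\<^sup>2 * q j = (c k)\<^sup>2 * ((l j)\<^sup>2 * q j)"
        unfolding power_mult_distrib by (simp only: mult_ac)
      moreover have "(sqrt (LL (T (N (Suc j)))))\<^sup>2 = LL (T (N (Suc j)))" using j0[OF that(1)] by simp
      ultimately show ?thesis unfolding lq[OF that(1)] power_mult_distrib by (simp only: mult_ac)
    qed
    also have "\<dots> \<le> 2 * 1 * (\<delta> * sqrt (T (N (Suc j))))\<^sup>2"
    proof -
      have "(c k * sqrt (LL (T (N (Suc j)))))\<^sup>2 \<le> (\<delta> * sqrt (T (N (Suc j))))\<^sup>2"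
      proof (rule power_mono)
        show "c k * sqrt (LL (T (N (Suc j)))) \<le> \<delta> * sqrt (T (N (Suc j)))" using j0[OF that(1)] that(2) by blast
        have "0 \<le> LL (T (N (Suc j)))" using j0[OF that(1)] by simp
        then show "0 \<le> c k * sqrt (LL (T (N (Suc j))))" using c_nonneg[of k] by simp
      qed
      moreover have "2 * \<gamma> \<le> 2 * 1" using \<gamma> by simp
      ultimately show ?thesis by (intro mult_mono[of "2 * \<gamma>"]) simp_all
    qed
    also have "\<dots> = 2 * \<delta>\<^sup>2 * T (N (Suc j))"
      unfolding power_mult_distrib using j0[OF that(1)] by simp
    also have "\<dots> \<le> 2 * \<delta>\<^sup>2 * (2 * q j)" using q2[OF that(1)] by (intro mult_left_mono) auto
    finally have "(l j * c k)\<^sup>2 * q j \<le> (2 * \<delta>)\<^sup>2 * q j"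
      unfolding power_mult_distrib by simp
    then have "(l j * c k)\<^sup>2 \<le> (2 * \<delta>)\<^sup>2" using q0[OF that(1)] by (rule mult_right_le_imp_le)
    moreover have "0 \<le> 2 * \<delta>" using \<delta> by simp
    ultimately show ?thesis by (rule power2_le_imp_le)
  qed
  have block: "prob (G \<inter> A j) \<ge> p j * prob G" if j: "j \<ge> j0" and G: "G \<in> sets (F (N j))" for j G
  proof -
    have a: "prob (G \<inter> A j) \<ge> prob G / 2 * exp (- (1 / 2 + 2 * \<eta>) * ((l j)\<^sup>2 * q j))"
      unfolding A_def
    proof (rule prob_block_lower[where \<nu>=\<nu>])
      show "0 \<le> \<nu>" "\<nu> \<le> \<eta>\<^sup>2 / 20" by (simp_all add: \<nu>_def)
      fix \<omega> assume w: "\<omega> \<in> space M"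
      have "N j \<le> N (Suc j)" by (intro N(3)) auto
      then have "(1 - \<kappa>) * q j \<le> brak (N j) (N (Suc j)) \<omega>" "brak (N j) (N (Suc j)) \<omega> \<le> (1 + \<kappa>) * q j"
        unfolding q_def using brak_upper[OF Vup[OF w]] brak_lower[OF Vlo[OF w]] by blast+
      moreover have "(1 - \<nu>) * q j \<le> (1 - \<kappa>) * q j" "(1 + \<kappa>) * q j \<le> (1 + \<nu>) * q j"
        using q0[OF j] \<kappa> unfolding \<nu>_def by (auto intro!: mult_right_mono)
      ultimately show "(1 - \<nu>) * q j \<le> brak (N j) (N (Suc j)) \<omega>" "brak (N j) (N (Suc j)) \<omega> \<le> (1 + \<nu>) * q j"
        by linarith+
    next
      fix k assume k: "k \<in> {N j..<N (Suc j)}"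
      have "(1 + \<eta>) * (l j * c k) \<le> (5 / 4) * (2 * \<delta>)"
        using lc[OF j, of k] k \<eta> \<delta> l0[OF j] c_nonneg[of k] by (intro mult_mono[of "1 + \<eta>"]) auto
      also have "\<dots> \<le> \<nu> / 3" using \<delta> by (simp add: \<nu>_def)
      finally show "(1 + \<eta>) * l j * c k \<le> \<nu> / 3" by (simp add: mult.assoc)
    next
      have g: "\<gamma> \<ge> 1 / 2" using \<eta> by (simp add: \<gamma>_def field_simps)
      have "ln 8 = \<eta>\<^sup>2 / 4 * (ln 8 * (4 / \<eta>\<^sup>2))" using \<eta> by simp
      also have "\<dots> \<le> \<eta>\<^sup>2 / 4 * LL (T (N (Suc j)))" using j0[OF j] by (intro mult_left_mono) auto
      also have "\<dots> \<le> \<eta>\<^sup>2 / 4 * ((l j)\<^sup>2 * q j)"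
      proof -
        have "1 * LL (T (N (Suc j))) \<le> 2 * \<gamma> * LL (T (N (Suc j)))"
          using g j0[OF j] by (intro mult_right_mono) auto
        then show ?thesis unfolding lq[OF j] by (intro mult_left_mono) auto
      qed
      finally have "exp (- (\<eta>\<^sup>2 / 4 * ((l j)\<^sup>2 * q j))) \<le> exp (- ln 8)" by simp
      also have "\<dots> = 1 / 8" by (simp add: exp_minus)
      finally show "exp (- (\<eta>\<^sup>2 / 4 * ((l j)\<^sup>2 * q j))) \<le> 1 / 8" .
    qed (use G N(3) \<eta> l0[OF j] q0[OF j] in auto)
    have b: "exp (- (1 / 2 + 2 * \<eta>) * ((l j)\<^sup>2 * q j)) = 1 / ln (T (N (Suc j)))"
    proof -
      have "(1 / 2 + 2 * \<eta>) * (2 * \<gamma>) = 1" using \<eta> by (simp add: \<gamma>_def field_simps)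
      then have "- (1 / 2 + 2 * \<eta>) * ((l j)\<^sup>2 * q j) = - LL (T (N (Suc j)))"
        unfolding lq[OF j] mult_minus_left mult.assoc[symmetric] by (simp only: mult_1)
      then show ?thesis using j0[OF j] by (simp add: exp_minus exp_LL inverse_eq_divide)
    qed
    have "prob G / 2 * (1 / ln (T (N (Suc j)))) \<ge> p j * prob G"
    proof -
      have "ln (T (N (Suc j))) \<le> ln (2 * \<theta> ^ Suc j)" using j0[OF j] \<theta> by (intro ln_mono) auto
      also have "\<dots> = ln 2 + ln \<theta> * real (Suc j)"
        using \<theta> by (subst ln_mult) (simp_all add: ln_realpow mult.commute del: power_Suc)
      finally have "1 / (2 * (ln 2 + ln \<theta> * real (Suc j))) \<le> 1 / (2 * ln (T (N (Suc j))))"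
        using j0[OF j] by (intro divide_left_mono mult_pos_pos ln_gt_zero) (auto intro!: add_pos_nonneg mult_nonneg_nonneg simp: \<theta> less_imp_le)
      then have "p j \<le> 1 / (2 * ln (T (N (Suc j))))" unfolding p_def by (simp add: algebra_simps)
      then have "p j * prob G \<le> 1 / (2 * ln (T (N (Suc j)))) * prob G" by (intro mult_right_mono) auto
      then show ?thesis by simp
    qed
    then show ?thesis using a unfolding b by (rule order_trans)
  qed
  have A_F: "A i \<in> sets (F (N j))" if "i < j" for i j
  proof -
    have "mart (N i) (N (Suc i)) \<in> borel_measurable (F (N j))"
      using that by (intro mart_meas N(3)) auto
    then have "{\<omega>\<in>space (F (N j)). mart (N i) (N (Suc i)) \<omega> \<ge> (1 - \<eta>) * (l i * q i)} \<in> sets (F (N j))"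
      by measurable
    then show ?thesis by (simp add: A_def)
  qed
  have space_in_F: "space M \<in> sets (F n)" for n using sets.top[of "F n"] by simp
  have freq: "AE \<omega> in M. frequently (\<lambda>j. \<omega> \<in> A j) sequentially"
  proof (rule AE_frequently_of_lower_bounds[where p=p and ?j0.0=j0])
    show "A j \<in> events" for j using A_F[of j "Suc j"] sets_F by blast
    fix J j assume J: "j0 \<le> J" "J \<le> j"
    show "p j * prob ((\<Inter>i\<in>{J..<j}. space M - A i) \<inter> space M) \<le> prob ((\<Inter>i\<in>{J..<j}. space M - A i) \<inter> space M \<inter> A j)"
    proof (rule block)
      have D: "space M - A i \<in> sets (F (N j))" if "i \<in> {J..<j}" for i
        using A_F[of i j] that space_in_F by (intro sets.Diff) auto
      show "(\<Inter>i\<in>{J..<j}. space M - A i) \<inter> space M \<in> sets (F (N j))"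
      proof (cases "{J..<j} = {}")
        case True
        then show ?thesis using space_in_F by simp
      next
        case False
        then show ?thesis using D space_in_F by (intro sets.Int sets.finite_INT) auto
      qed
    qed (use J in auto)
  next
    show "0 \<le> p j" for j using \<theta> by (auto simp: p_def intro!: divide_nonneg_nonneg add_nonneg_nonneg mult_nonneg_nonneg)
    show "\<not> summable p" unfolding p_def[abs_def] using \<theta> by (intro not_summable_inverse_linear) auto
  qed
  interpret neg: bounded_mds M F "\<lambda>k \<omega>. - D k \<omega>" V c by (rule uminus_bounded_mds)
  have neg_mart: "neg.mart 0 n \<omega> = - mart 0 n \<omega>" for n \<omega>
    by (simp add: mart_def neg.mart_def sum_negf)
  \<comment> \<open>A crude constant is enough for the past, since the choice of
    \<open>\<theta>\<close> absorbs it.\<close>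
  have "AE \<omega> in M. eventually (\<lambda>n. neg.mart 0 n \<omega> \<le> (1 + 1) * sqrt (2 * T n * LL (T n))) sequentially"
  proof (rule neg.lil_upper[OF mono lim ratio T0 Vup _ csmall])
    have "exp (2 * \<delta>) \<le> 1 + 2 * \<delta> + (2 * \<delta>)\<^sup>2" using \<delta> \<eta>2 by (intro exp_bound) auto
    also have "(2 * \<delta>)\<^sup>2 \<le> 2 * \<delta> * 1" unfolding power2_eq_square using \<delta> \<eta>2 by (intro mult_left_mono) auto
    finally have "exp (2 * \<delta>) \<le> 3 / 2" using \<delta> \<eta>2 by linarith
    moreover have "1 + \<kappa> \<le> 5 / 4" using \<kappa> \<eta>2 by linarith
    ultimately have "exp (2 * \<delta>) * (1 + \<kappa>) \<le> 3 / 2 * (5 / 4)" using \<kappa> by (intro mult_mono) auto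
    then show "exp (2 * \<delta>) * (1 + \<kappa>) < 1 + 1" by simp
  qed (use \<kappa> \<delta> in auto)
  then show ?thesis using freq AE_space
  proof eventually_elim
    case (elim \<omega>)
    then have "eventually (\<lambda>j. - mart 0 (N j) \<omega> \<le> (1 + 1) * sqrt (2 * T (N j) * LL (T (N j)))) sequentially"
      unfolding neg_mart using eventually_compose_filterlim[OF _ N(5)] by blast
    then have "eventually (\<lambda>j. \<omega> \<in> A j \<longrightarrow> (1 - 5 * \<eta>) * sqrt (2 * T (N (Suc j)) * LL (T (N (Suc j)))) \<le> mart 0 (N (Suc j)) \<omega>) sequentially"
      using eventually_ge_at_top[of "Suc j0"]
    proof eventually_elim
      case (elim j)
      show ?case
      proof
        assume "\<omega> \<in> A j"
        have j: "j \<ge> j0" using elim by simp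
        define K where "K = 2 * T (N (Suc j)) * LL (T (N (Suc j)))"
        have K0: "0 \<le> K" using j0[OF j] by (simp add: K_def)
        \<comment> \<open>The facts about \<open>T (N j)\<close> are those of \<open>j0\<close> at
          index \<open>j - 1\<close>; this is why \<open>j\<close> starts at
          \<open>Suc j0\<close>.\<close>
        have jm: "j - 1 \<ge> j0" "Suc (j - 1) = j" using elim by auto
        have Tj1: "1 < T (N j)" and LLj: "0 \<le> LL (T (N j))"
          using j0[OF jm(1)] unfolding jm(2) by auto
        have "mart 0 (N (Suc j)) \<omega> = mart 0 (N j) \<omega> + mart (N j) (N (Suc j)) \<omega>"
          by (intro mart_split N(3)) auto
        moreover have "mart (N j) (N (Suc j)) \<omega> \<ge> (1 - 4 * \<eta>) * sqrt K"
        proof -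
          have sg: "sqrt \<gamma> \<ge> 1 - 2 * \<eta>"
          proof (rule real_le_rsqrt)
            have "(1 - 2 * \<eta>)\<^sup>2 * (1 + 4 * \<eta>) = 1 - 4 * \<eta>\<^sup>2 * (3 - 4 * \<eta>)"
              by (simp add: power2_eq_square algebra_simps)
            also have "\<dots> \<le> 1" using \<eta> by simp
            finally have "(1 - 2 * \<eta>)\<^sup>2 * (1 + 4 * \<eta>) \<le> 1" .
            moreover have "0 < 1 + 4 * \<eta>" using \<eta> by simp
            ultimately show "(1 - 2 * \<eta>)\<^sup>2 \<le> \<gamma>" unfolding \<gamma>_def by (simp only: pos_le_divide_eq)
          qed
          have st: "sqrt (1 - 2 / \<theta>) \<ge> 1 - \<eta>"
          proof (rule real_le_rsqrt)
            have "2 / \<theta> = \<eta>\<^sup>2 / 50" by (simp add: \<theta>_def)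
            moreover have "\<eta>\<^sup>2 \<le> \<eta>" using \<eta> by (simp add: power2_eq_square mult_left_le)
            moreover have "(1 - \<eta>)\<^sup>2 = 1 - 2 * \<eta> + \<eta>\<^sup>2" by (simp add: power2_eq_square algebra_simps)
            ultimately show "(1 - \<eta>)\<^sup>2 \<le> 1 - 2 / \<theta>" using \<eta> by linarith
          qed
          have a1: "(1 - 2 * \<eta>) * (1 - \<eta>) \<le> sqrt \<gamma> * sqrt (1 - 2 / \<theta>)"
            by (rule mult_mono[OF sg st]) (use \<eta> \<gamma> in auto)
          have "sqrt \<gamma> * sqrt (1 - 2 / \<theta>) * sqrt K = sqrt (2 * \<gamma> * LL (T (N (Suc j))) * ((1 - 2 / \<theta>) * T (N (Suc j))))"
            unfolding real_sqrt_mult[symmetric] K_def by (intro arg_cong[where f=sqrt]) (simp only: mult_ac)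
          also have "\<dots> \<le> sqrt (2 * \<gamma> * LL (T (N (Suc j))) * q j)"
          proof (intro real_sqrt_le_mono mult_left_mono q1[OF j])
            have "0 \<le> LL (T (N (Suc j)))" using j0[OF j] by simp
            then show "0 \<le> 2 * \<gamma> * LL (T (N (Suc j)))" using \<gamma> by simp
          qed
          also have "\<dots> = l j * q j" unfolding lq2[OF j] by (intro arg_cong[where f=sqrt]) (simp only: mult_ac)
          finally have a2: "sqrt \<gamma> * sqrt (1 - 2 / \<theta>) * sqrt K \<le> l j * q j" .
          have "(1 - 2 * \<eta>) * (1 - \<eta>) * sqrt K \<le> sqrt \<gamma> * sqrt (1 - 2 / \<theta>) * sqrt K"
            by (rule mult_right_mono[OF a1]) (use K0 in simp)
          also have "\<dots> \<le> l j * q j" by (rule a2)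
          finally have a3: "(1 - 2 * \<eta>) * (1 - \<eta>) * sqrt K \<le> l j * q j" .
          have "(1 - \<eta>) * ((1 - 2 * \<eta>) * (1 - \<eta>)) * sqrt K = (1 - \<eta>) * ((1 - 2 * \<eta>) * (1 - \<eta>) * sqrt K)"
            by (simp only: mult.assoc)
          also have "\<dots> \<le> (1 - \<eta>) * (l j * q j)" by (rule mult_left_mono[OF a3]) (use \<eta> in simp)
          also have "\<dots> \<le> mart (N j) (N (Suc j)) \<omega>" using \<open>\<omega> \<in> A j\<close> by (simp add: A_def)
          finally have "(1 - \<eta>) * ((1 - 2 * \<eta>) * (1 - \<eta>)) * sqrt K \<le> mart (N j) (N (Suc j)) \<omega>" .
          moreover have "1 - 4 * \<eta> \<le> (1 - \<eta>) * ((1 - 2 * \<eta>) * (1 - \<eta>))"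
          proof -
            have "(1 - \<eta>) * ((1 - 2 * \<eta>) * (1 - \<eta>)) = 1 - 4 * \<eta> + \<eta>\<^sup>2 * (5 - 2 * \<eta>)"
              by (simp add: power2_eq_square algebra_simps)
            moreover have "0 \<le> \<eta>\<^sup>2 * (5 - 2 * \<eta>)" using \<eta> by (intro mult_nonneg_nonneg) auto
            ultimately show ?thesis by linarith
          qed
          then have "(1 - 4 * \<eta>) * sqrt K \<le> (1 - \<eta>) * ((1 - 2 * \<eta>) * (1 - \<eta>)) * sqrt K"
            using K0 by (intro mult_right_mono) auto
          ultimately show ?thesis by linarith
        qed
        moreover have "mart 0 (N j) \<omega> \<ge> - (\<eta> * sqrt K)"
        proof -
          have "2 * T (N j) * LL (T (N j)) \<le> (2 * ((2 / \<theta>) * T (N (Suc j)))) * LL (T (N (Suc j)))"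
          proof (rule mult_mono)
            have "T (N j) \<le> T (N (Suc j))" by (rule lift_Suc_mono_le[of T, OF mono N(3)]) simp
            then show "LL (T (N j)) \<le> LL (T (N (Suc j)))" using Tj1 by (intro LL_mono)
          qed (use Tj[OF j] Tj1 LLj in auto)
          also have "\<dots> = (2 / \<theta>) * K" by (simp add: K_def)
          finally have "(1 + 1) * sqrt (2 * T (N j) * LL (T (N j))) \<le> 2 * sqrt ((2 / \<theta>) * K)" by simp
          also have "\<dots> = sqrt (4 * ((2 / \<theta>) * K))" unfolding real_sqrt_mult[of 4] by simp
          also have "\<dots> \<le> sqrt (\<eta>\<^sup>2 * K)"
          proof (intro real_sqrt_le_mono)
            have "4 * (2 / \<theta>) \<le> \<eta>\<^sup>2" by (simp add: \<theta>_def)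
            then have "4 * (2 / \<theta>) * K \<le> \<eta>\<^sup>2 * K" using K0 by (rule mult_right_mono)
            then show "4 * (2 / \<theta> * K) \<le> \<eta>\<^sup>2 * K" by (simp only: mult.assoc)
          qed
          also have "\<dots> = \<eta> * sqrt K" using \<eta> by (simp add: real_sqrt_mult)
          finally show ?thesis using elim(1) by linarith
        qed
        moreover have "(1 - 5 * \<eta>) * sqrt K = (1 - 4 * \<eta>) * sqrt K - \<eta> * sqrt K" by (simp add: algebra_simps)
        ultimately have "(1 - 5 * \<eta>) * sqrt K \<le> mart 0 (N (Suc j)) \<omega>" by linarith
        then show "(1 - 5 * \<eta>) * sqrt (2 * T (N (Suc j)) * LL (T (N (Suc j)))) \<le> mart 0 (N (Suc j)) \<omega>"
          unfolding K_def .
      qed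
    qed
    then have "frequently (\<lambda>j. (1 - 5 * \<eta>) * sqrt (2 * T (N (Suc j)) * LL (T (N (Suc j)))) \<le> mart 0 (N (Suc j)) \<omega>) sequentially"
      using elim(2) by (rule frequently_rev_mp[rotated])
    then show ?case
    proof (rule contrapos_pp)
      assume "\<not> frequently (\<lambda>n. (1 - 5 * \<eta>) * sqrt (2 * T n * LL (T n)) \<le> mart 0 n \<omega>) sequentially"
      then have "eventually (\<lambda>n. \<not> (1 - 5 * \<eta>) * sqrt (2 * T n * LL (T n)) \<le> mart 0 n \<omega>) sequentially"
        by (simp add: not_frequently)
      from eventually_compose_filterlim[OF this NSuc]
      show "\<not> frequently (\<lambda>j. (1 - 5 * \<eta>) * sqrt (2 * T (N (Suc j)) * LL (T (N (Suc j)))) \<le> mart 0 (N (Suc j)) \<omega>) sequentially"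
        by (simp add: not_frequently)
    qed
  qed
qed

end

section \<open>The reinforced walk with a sign\<close>

fun rstep :: "real \<Rightarrow> (nat \<Rightarrow> real) \<Rightarrow> (nat \<Rightarrow> bool) \<Rightarrow> (nat \<Rightarrow> nat) \<Rightarrow> nat \<Rightarrow> real" where
  "rstep s x e u n =
     (if n \<ge> 2 \<and> e n \<and> u n \<in> {1..<n} then s * rstep s x e u (u n) else x n)"

declare rstep.simps [simp del]

lemma pos_step_eq: "pos_step x e u n = rstep 1 x e u n"
  by (induction n rule: less_induct) (subst pos_step.simps, subst rstep.simps, auto)

lemma neg_step_eq: "neg_step x e u n = rstep (- 1) x e u n"
  by (induction n rule: less_induct) (subst neg_step.simps, subst rstep.simps, auto)

locale signed_reinforcement = step_reinforcement M p X \<epsilon> U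
  for M :: "'a measure" and p and X and \<epsilon> and U +
  fixes s :: real
  assumes s: "s = 1 \<or> s = - 1" and p: "0 < p" "p < 1"
    and X_square: "integrable M (\<lambda>\<omega>. (X 1 \<omega>)\<^sup>2)"
begin

definition W :: "var_index \<Rightarrow> 'a \<Rightarrow> real" where
  "W i = (case i of Innovation n \<Rightarrow> X n
     | Decision n \<Rightarrow> (\<lambda>\<omega>. of_bool (\<epsilon> n \<omega>))
     | Choice n \<Rightarrow> (\<lambda>\<omega>. real (U n \<omega>)))"

definition indices :: "var_index set" where
  "indices = Innovation ` {1..} \<union> Decision ` {2..} \<union> Choice ` {2..}"

text \<open>What is known strictly before step \<open>n\<close>. Thus \<open>Y n\<close> will be
  \<open>F (Suc n)\<close>-measurable, in agreement with the indexing of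
  \<open>bounded_mds\<close>.\<close>

definition past :: "nat \<Rightarrow> var_index set" where
  "past n = Innovation ` {1..<n} \<union> Decision ` {2..<n} \<union> Choice ` {2..<n}"

definition present :: "nat \<Rightarrow> var_index set" where
  "present n = {Innovation n, Decision n, Choice n}"

text \<open>Generated by the past as one vector, because independence of disjoint groups of
  variables is used in terms of such vectors.\<close>

definition F :: "nat \<Rightarrow> 'a measure" where
  "F n = vimage_algebra (space M) (\<lambda>\<omega>. \<lambda>i\<in>past n. W i \<omega>) (PiM (past n) (\<lambda>_. borel))"

lemma indep_W: "indep_vars (\<lambda>_. borel) W indices"
  using indep unfolding W_def[abs_def] indices_def .

lemma W_meas: "i \<in> indices \<Longrightarrow> W i \<in> borel_measurable M"
  using indep_W by (simp add: indep_vars_def)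

lemma past_subset: "past n \<subseteq> indices"
  by (auto simp: past_def indices_def)

lemma present_subset: "2 \<le> n \<Longrightarrow> present n \<subseteq> indices"
  by (auto simp: present_def indices_def)

lemma past_present: "past n \<inter> present n = {}"
  by (auto simp: past_def present_def)

lemma restrict_W_meas: "A \<subseteq> indices \<Longrightarrow> (\<lambda>\<omega>. \<lambda>i\<in>A. W i \<omega>) \<in> measurable M (PiM A (\<lambda>_. borel))"
  by (intro measurable_restrict W_meas) auto

lemma W_meas_F: "i \<in> past n \<Longrightarrow> W i \<in> borel_measurable (F n)"
proof -
  assume i: "i \<in> past n"
  have "(\<lambda>\<omega>. \<lambda>i\<in>past n. W i \<omega>) \<in> measurable (F n) (PiM (past n) (\<lambda>_. borel))"
    unfolding F_def by (intro measurable_vimage_algebra1) (auto simp: space_PiM)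
  from measurable_compose[OF this measurable_component_singleton[OF i]]
  show ?thesis using i by simp
qed

sublocale filtered_prob_space M F
proof
  show "subalgebra M (F n)" for n
    unfolding subalgebra_def F_def
    using sets_image_in_sets[OF refl restrict_W_meas[OF past_subset]] by simp
  have "(\<lambda>\<omega>. \<lambda>i\<in>past n. W i \<omega>) \<in> measurable (F (Suc n)) (PiM (past n) (\<lambda>_. borel))" for n
    by (intro measurable_restrict W_meas_F) (auto simp: past_def)
  then show "sets (F n) \<subseteq> sets (F (Suc n))" for n
    unfolding F_def[of n] by (intro sets_image_in_sets) (simp_all add: F_def)
qed

lemma indep_restrict:
  assumes "A \<inter> B = {}" "A \<subseteq> indices" "B \<subseteq> indices"
    and "f \<in> borel_measurable (PiM A (\<lambda>_. borel))" "g \<in> borel_measurable (PiM B (\<lambda>_. borel))"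
  shows "indep_var borel (\<lambda>\<omega>. f (\<lambda>i\<in>A. W i \<omega>) :: real) borel (\<lambda>\<omega>. g (\<lambda>i\<in>B. W i \<omega>) :: real)"
  using indep_var_compose[OF indep_var_restrict[OF indep_W assms(1-3)] assms(4,5)] by (simp add: comp_def)

text \<open>An \<open>F n\<close>-measurable \<open>f\<close> is not given as a function of the past
  vector, so the argument compares generated \<sigma>-algebras: the one of \<open>f\<close> lies in
  \<open>F n\<close>, the one of the function \<open>g\<close> of the present lies in the one
  generated by the present vector.\<close>

lemma indep_past:
  assumes n: "2 \<le> n" and f: "f \<in> borel_measurable (F n)"
    and g: "g \<in> borel_measurable (PiM (present n) (\<lambda>_. borel))"
  shows "indep_var borel (f :: 'a \<Rightarrow> real) borel (\<lambda>\<omega>. g (\<lambda>i\<in>present n. W i \<omega>) :: real)"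
proof -
  let ?P = "\<lambda>\<omega>. \<lambda>i\<in>past n. W i \<omega>" and ?Q = "\<lambda>\<omega>. \<lambda>i\<in>present n. W i \<omega>"
  let ?g = "\<lambda>\<omega>. g (?Q \<omega>)"
  have ind: "indep_set (sigma_sets (space M) {?P -` A \<inter> space M |A. A \<in> sets (PiM (past n) (\<lambda>_. borel))})
      (sigma_sets (space M) {?Q -` A \<inter> space M |A. A \<in> sets (PiM (present n) (\<lambda>_. borel))})"
    using indep_var_restrict[OF indep_W past_present past_subset present_subset[OF n]]
    unfolding indep_var_eq by blast
  have Qm: "?Q \<in> measurable M (PiM (present n) (\<lambda>_. borel))" by (rule restrict_W_meas[OF present_subset[OF n]])
  have gm: "?g \<in> borel_measurable M" by (rule measurable_compose[OF Qm g])
  have F_sets: "sigma_sets (space M) {?P -` A \<inter> space M |A. A \<in> sets (PiM (past n) (\<lambda>_. borel))} = sets (F n)"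
    unfolding F_def sets_vimage_algebra ..
  have f_sets: "{f -` A \<inter> space M |A. A \<in> sets borel} \<subseteq> sets (F n)"
    using measurable_sets[OF f] by auto
  have f_sub: "sigma_sets (space M) {f -` A \<inter> space M |A. A \<in> sets borel} \<subseteq> sets (F n)"
    using sets.sigma_sets_subset[OF f_sets] by simp
  have g_sub: "sigma_sets (space M) {?g -` A \<inter> space M |A. A \<in> sets borel}
    \<subseteq> sigma_sets (space M) {?Q -` A \<inter> space M |A. A \<in> sets (PiM (present n) (\<lambda>_. borel))}"
  proof (rule sigma_sets_mono, safe)
    fix A :: "real set" assume A: "A \<in> sets borel"
    have eq: "?g -` A \<inter> space M = ?Q -` (g -` A \<inter> space (PiM (present n) (\<lambda>_. borel))) \<inter> space M"
      using measurable_space[OF Qm] by auto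
    then show "?g -` A \<inter> space M \<in> sigma_sets (space M) {?Q -` A \<inter> space M |A. A \<in> sets (PiM (present n) (\<lambda>_. borel))}"
      unfolding eq by (intro sigma_sets.Basic) (use measurable_sets[OF g A] in blast)
  qed
  have "indep_set (sigma_sets (space M) {f -` A \<inter> space M |A. A \<in> sets borel})
      (sigma_sets (space M) {?g -` A \<inter> space M |A. A \<in> sets borel})"
    unfolding indep_set_def
    by (rule indep_sets_mono_sets[OF ind[unfolded F_sets indep_set_def]]) (use f_sub g_sub in \<open>auto split: bool.split\<close>)
  then show ?thesis unfolding indep_var_eq using meas_F[OF f] gm by blast
qed

lemma expectation_decision: "2 \<le> n \<Longrightarrow> expectation (W (Decision n)) = p"
proof -
  assume n: "2 \<le> n"
  have "expectation (W (Decision n)) = (\<integral>b. of_bool b \<partial>distr M (count_space UNIV) (\<epsilon> n))"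
    unfolding W_def using eps_rv[OF n] by (simp add: integral_distr)
  also have "\<dots> = p" unfolding eps_bernoulli[OF n] using p by simp
  finally show ?thesis .
qed

lemma expectation_choice:
  assumes n: "2 \<le> n" and j: "j \<in> {1..<n}"
  shows "expectation (\<lambda>\<omega>. indicator {real j} (W (Choice n) \<omega>) :: real) = 1 / real (n - 1)"
proof -
  have "expectation (\<lambda>\<omega>. indicator {real j} (W (Choice n) \<omega>) :: real) = (\<integral>i. indicator {j} i \<partial>distr M (count_space UNIV) (U n))"
  proof -
    have "expectation (\<lambda>\<omega>. indicator {real j} (W (Choice n) \<omega>) :: real) = expectation (\<lambda>\<omega>. indicator {j} (U n \<omega>) :: real)"
      by (intro Bochner_Integration.integral_cong) (auto simp: W_def indicator_def)
    also have "\<dots> = (\<integral>i. indicator {j} i \<partial>distr M (count_space UNIV) (U n))"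
      by (rule integral_distr[symmetric, OF U_rv[OF n]]) simp
    finally show ?thesis .
  qed
  also have "\<dots> = measure (measure_pmf (pmf_of_set {1..<n})) {j}"
    unfolding U_uniform[OF n] by simp
  also have "\<dots> = 1 / real (n - 1)"
    using n j by (subst measure_pmf_of_set) (auto simp: Int_absorb1)
  finally show ?thesis .
qed

lemma AE_choice: "2 \<le> n \<Longrightarrow> AE \<omega> in M. U n \<omega> \<in> {1..<n}"
proof -
  assume n: "2 \<le> n"
  have "AE i in distr M (count_space UNIV) (U n). i \<in> {1..<n}"
    unfolding U_uniform[OF n] using n by (auto simp: AE_measure_pmf_iff)
  then show ?thesis using U_rv[OF n] by (simp add: AE_distr_iff)
qed

lemma integrable_X: "integrable M (\<phi> \<circ> X 1) \<Longrightarrow> \<phi> \<in> borel_measurable borel \<Longrightarrow> 1 \<le> n \<Longrightarrow> integrable M (\<lambda>\<omega>. \<phi> (X n \<omega>) :: real)"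
proof -
  assume a: "integrable M (\<phi> \<circ> X 1)" "\<phi> \<in> borel_measurable borel" "1 \<le> n"
  have "integrable (distr M borel (X 1)) \<phi>"
    using a X_rv[of 1] by (subst integrable_distr_eq) (auto simp: comp_def)
  then have "integrable (distr M borel (X n)) \<phi>" using X_ident[OF a(3)] by simp
  then show ?thesis using a X_rv[OF a(3)] by (subst (asm) integrable_distr_eq) auto
qed

lemma expectation_X: "\<phi> \<in> borel_measurable borel \<Longrightarrow> 1 \<le> n \<Longrightarrow> expectation (\<lambda>\<omega>. \<phi> (X n \<omega>) :: real) = expectation (\<lambda>\<omega>. \<phi> (X 1 \<omega>))"
proof -
  assume a: "\<phi> \<in> borel_measurable borel" "1 \<le> n"
  have "expectation (\<lambda>\<omega>. \<phi> (X k \<omega>)) = integral\<^sup>L (distr M borel (X k)) \<phi>" if "1 \<le> k" for k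
    using a X_rv[OF that] by (subst integral_distr) auto
  then show ?thesis using X_ident[OF a(2)] a(2) by simp
qed

section \<open>The steps and their conditional expectations\<close>

definition Y :: "nat \<Rightarrow> 'a \<Rightarrow> real" where
  "Y n \<omega> = rstep s (\<lambda>i. X i \<omega>) (\<lambda>i. \<epsilon> i \<omega>) (\<lambda>i. U i \<omega>) n"

lemma Y_rec: "Y n \<omega> = (if n \<ge> 2 \<and> \<epsilon> n \<omega> \<and> U n \<omega> \<in> {1..<n} then s * Y (U n \<omega>) \<omega> else X n \<omega>)"
  unfolding Y_def by (subst rstep.simps) simp

lemma Y_1: "Y (Suc 0) = X 1"
  by (rule ext) (simp add: Y_rec[of "Suc 0"])

text \<open>Resolves the random index of a copied step into a finite sum whose terms factor into a
  function of the present variables and a function of the past, the form to which independence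
  applies. The condition on the range of \<open>U n\<close> holds almost surely.\<close>

lemma Y_decomp:
  fixes \<phi> :: "real \<Rightarrow> real"
  assumes "2 \<le> n" "U n \<omega> \<in> {1..<n}"
  shows "\<phi> (Y n \<omega>) = (1 - W (Decision n) \<omega>) * \<phi> (X n \<omega>)
    + (\<Sum>j\<in>{1..<n}. W (Decision n) \<omega> * indicator {real j} (W (Choice n) \<omega>) * \<phi> (s * Y j \<omega>))"
proof -
  have "(\<Sum>j\<in>{1..<n}. W (Decision n) \<omega> * indicator {real j} (W (Choice n) \<omega>) * \<phi> (s * Y j \<omega>))
     = (\<Sum>j\<in>{1..<n}. if j = U n \<omega> then W (Decision n) \<omega> * \<phi> (s * Y j \<omega>) else 0)"
    by (intro sum.cong) (auto simp: W_def)
  also have "\<dots> = W (Decision n) \<omega> * \<phi> (s * Y (U n \<omega>) \<omega>)" using assms by simp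
  finally show ?thesis using assms by (subst Y_rec) (auto simp: W_def)
qed

lemma Y_meas_F: "1 \<le> j \<Longrightarrow> j < n \<Longrightarrow> Y j \<in> borel_measurable (F n)"
proof (induction j rule: less_induct)
  case (less j)
  have X: "X j \<in> borel_measurable (F n)"
    using W_meas_F[of "Innovation j" n] less by (simp add: past_def W_def)
  show ?case
  proof (cases "2 \<le> j")
    case False
    then have "j = Suc 0" using less by simp
    then show ?thesis using X by (simp add: Y_1)
  next
    case True
    have D: "W (Decision j) \<in> borel_measurable (F n)" using True less by (intro W_meas_F) (auto simp: past_def)
    have C: "W (Choice j) \<in> borel_measurable (F n)" using True less by (intro W_meas_F) (auto simp: past_def)
    have [measurable]: "Y i \<in> borel_measurable (F n)" if "i \<in> {1..<j}" for i using less that by auto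
    \<comment> \<open>Measurability is needed at every sample point, so this formula also covers a
      choice outside \<open>{1..<j}\<close>: the weight of \<open>X j\<close> is one minus the total
      copying weight.\<close>
    have eq: "Y j = (\<lambda>\<omega>. (\<Sum>i\<in>{1..<j}. (W (Decision j) \<omega> * indicator {real i} (W (Choice j) \<omega>)) * (s * Y i \<omega>))
         + (1 - (\<Sum>i\<in>{1..<j}. W (Decision j) \<omega> * indicator {real i} (W (Choice j) \<omega>))) * X j \<omega>)" (is "_ = ?R")
    proof
      fix \<omega>
      have a: "(\<Sum>i\<in>{1..<j}. (W (Decision j) \<omega> * indicator {real i} (W (Choice j) \<omega>)) * f i)
        = (if U j \<omega> \<in> {1..<j} then W (Decision j) \<omega> * f (U j \<omega>) else 0)" for f :: "nat \<Rightarrow> real"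
      proof -
        have "(\<Sum>i\<in>{1..<j}. (W (Decision j) \<omega> * indicator {real i} (W (Choice j) \<omega>)) * f i)
          = (\<Sum>i\<in>{1..<j}. if i = U j \<omega> then W (Decision j) \<omega> * f i else 0)"
          by (intro sum.cong) (auto simp: W_def)
        then show ?thesis by simp
      qed
      show "Y j \<omega> = ?R \<omega>" unfolding a[of "\<lambda>i. s * Y i \<omega>"] a[of "\<lambda>_. 1", unfolded mult_1_right]
        using True by (subst Y_rec) (auto simp: W_def)
    qed
    note [measurable] = X D C
    show ?thesis unfolding eq by measurable
  qed
qed

lemma Y_meas [measurable]: "1 \<le> j \<Longrightarrow> Y j \<in> borel_measurable M"
  using Y_meas_F[of j "Suc j"] meas_F by blast

text \<open>The conditional expectation of \<open>\<phi> (Y n)\<close> given \<open>F n\<close>, in closed form.\<close>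

definition cexp :: "nat \<Rightarrow> (real \<Rightarrow> real) \<Rightarrow> 'a \<Rightarrow> real" where
  "cexp n \<phi> \<omega> = (1 - p) * expectation (\<lambda>\<omega>. \<phi> (X 1 \<omega>)) + p / real (n - 1) * (\<Sum>j\<in>{1..<n}. \<phi> (s * Y j \<omega>))"

lemma cexp_meas_F: "\<phi> \<in> borel_measurable borel \<Longrightarrow> cexp n \<phi> \<in> borel_measurable (F n)"
proof -
  assume [measurable]: "\<phi> \<in> borel_measurable borel"
  have [measurable]: "Y j \<in> borel_measurable (F n)" if "j \<in> {1..<n}" for j using Y_meas_F[of j n] that by auto
  show ?thesis unfolding cexp_def[abs_def] by measurable
qed

lemma integrable_decision: "2 \<le> n \<Longrightarrow> integrable M (W (Decision n))"
  by (rule integrable_const_bound[of _ 1]) (use W_meas[of "Decision n"] in \<open>auto simp: indices_def W_def\<close>)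

text \<open>In \<open>Y_decomp\<close> the decision is independent of the choice and of the new
  innovation, and all three are independent of \<open>F n\<close>, so every term factors.
  Integrability along the steps, instead of boundedness of \<open>\<phi>\<close>, lets the
  invariance of the law below reach unbounded functions such as squares and excesses.\<close>

lemma conditional_step:
  assumes n: "2 \<le> n" and \<phi>[measurable]: "\<phi> \<in> borel_measurable borel"
    and iX: "integrable M (\<lambda>\<omega>. \<phi> (X 1 \<omega>))" and iY: "\<And>j. j \<in> {1..<n} \<Longrightarrow> integrable M (\<lambda>\<omega>. \<phi> (s * Y j \<omega>))"
    and H: "H \<in> borel_measurable (F n)" "\<And>\<omega>. \<omega> \<in> space M \<Longrightarrow> \<bar>H \<omega>\<bar> \<le> B"
  shows "expectation (\<lambda>\<omega>. H \<omega> * \<phi> (Y n \<omega>)) = expectation (\<lambda>\<omega>. H \<omega> * cexp n \<phi> \<omega>)"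
    and "integrable M (\<lambda>\<omega>. \<phi> (Y n \<omega>))"
proof -
  let ?D = "W (Decision n)" and ?C = "\<lambda>j \<omega>. indicator {real j} (W (Choice n) \<omega>) :: real"
  have idx: "Innovation n \<in> indices" "Decision n \<in> indices" "Choice n \<in> indices"
    using n by (auto simp: indices_def)
  note [measurable] = W_meas[OF idx(2)] W_meas[OF idx(3)] meas_F[OF H(1)]
  have [measurable]: "X n \<in> borel_measurable M" using X_rv[of n] n by simp
  have [measurable]: "Y j \<in> borel_measurable M" if "j \<in> {1..<n}" for j using that by (intro Y_meas) auto
  have D01: "0 \<le> ?D \<omega>" "?D \<omega> \<le> 1" for \<omega> by (auto simp: W_def)
  have iXn: "integrable M (\<lambda>\<omega>. \<phi> (X n \<omega>))" using integrable_X[of \<phi> n] iX \<phi> n by (simp add: comp_def)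
  have iDX: "integrable M (\<lambda>\<omega>. (1 - ?D \<omega>) * \<phi> (X n \<omega>))"
    by (rule Bochner_Integration.integrable_bound[OF iXn]) (auto simp: abs_mult D01 intro!: mult_left_le_one_le AE_I2)
  have iDY: "integrable M (\<lambda>\<omega>. ?D \<omega> * ?C j \<omega> * \<phi> (s * Y j \<omega>))" if j: "j \<in> {1..<n}" for j
  proof (rule Bochner_Integration.integrable_bound[OF iY[OF j]])
    show "(\<lambda>\<omega>. ?D \<omega> * ?C j \<omega> * \<phi> (s * Y j \<omega>)) \<in> borel_measurable M" using j by measurable
  qed (auto simp: abs_mult D01 indicator_def intro!: mult_left_le_one_le AE_I2)
  have AE: "AE \<omega> in M. \<phi> (Y n \<omega>) = (1 - ?D \<omega>) * \<phi> (X n \<omega>) + (\<Sum>j\<in>{1..<n}. ?D \<omega> * ?C j \<omega> * \<phi> (s * Y j \<omega>))"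
    using AE_choice[OF n] by eventually_elim (rule Y_decomp[OF n])
  have iR: "integrable M (\<lambda>\<omega>. (1 - ?D \<omega>) * \<phi> (X n \<omega>) + (\<Sum>j\<in>{1..<n}. ?D \<omega> * ?C j \<omega> * \<phi> (s * Y j \<omega>)))"
    using iDX iDY by (intro Bochner_Integration.integrable_add Bochner_Integration.integrable_sum) auto
  have Yn[measurable]: "Y n \<in> borel_measurable M" using n by (intro Y_meas) auto
  show "integrable M (\<lambda>\<omega>. \<phi> (Y n \<omega>))"
    by (rule integrable_cong_AE_imp[OF iR]) (use AE in \<open>auto elim!: AE_mp\<close>)
  have iH: "integrable M (\<lambda>\<omega>. H \<omega> * f \<omega>)" if "integrable M f" for f
  proof (rule Bochner_Integration.integrable_bound[of M "\<lambda>\<omega>. B * f \<omega>"])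
    show "AE \<omega> in M. norm (H \<omega> * f \<omega>) \<le> norm (B * f \<omega>)"
      using H(2) by (intro AE_I2) (auto simp: abs_mult intro!: mult_right_mono order_trans[OF H(2) abs_ge_self])
  qed (use that in auto)
  have iH1: "integrable M H" using iH[of "\<lambda>_. 1"] by simp
  have term1: "expectation (\<lambda>\<omega>. H \<omega> * ((1 - ?D \<omega>) * \<phi> (X n \<omega>))) = (1 - p) * expectation (\<lambda>\<omega>. \<phi> (X 1 \<omega>)) * expectation H"
  proof -
    have "indep_var borel H borel (\<lambda>\<omega>. (\<lambda>f. (1 - f (Decision n)) * \<phi> (f (Innovation n))) (\<lambda>i\<in>present n. W i \<omega>))"
      by (rule indep_past[OF n H(1)]) (simp add: present_def)
    then have i: "indep_var borel H borel (\<lambda>\<omega>. (1 - ?D \<omega>) * \<phi> (X n \<omega>))"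
      by (simp add: present_def W_def[of "Innovation n"])
    have "indep_var borel (\<lambda>\<omega>. (\<lambda>f. 1 - f (Decision n)) (\<lambda>i\<in>{Decision n}. W i \<omega>)) borel (\<lambda>\<omega>. (\<lambda>f. \<phi> (f (Innovation n))) (\<lambda>i\<in>{Innovation n}. W i \<omega>))"
      using idx by (intro indep_restrict) auto
    then have i2: "indep_var borel (\<lambda>\<omega>. 1 - ?D \<omega>) borel (\<lambda>\<omega>. \<phi> (X n \<omega>))"
      by (simp add: W_def[of "Innovation n"])
    have "expectation (\<lambda>\<omega>. (1 - ?D \<omega>) * \<phi> (X n \<omega>)) = expectation (\<lambda>\<omega>. 1 - ?D \<omega>) * expectation (\<lambda>\<omega>. \<phi> (X n \<omega>))"
      using integrable_decision[OF n] iXn by (intro indep_var_lebesgue_integral i2) auto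
    also have "expectation (\<lambda>\<omega>. 1 - ?D \<omega>) = 1 - p"
      using integrable_decision[OF n] expectation_decision[OF n] by (simp add: prob_space)
    also have "expectation (\<lambda>\<omega>. \<phi> (X n \<omega>)) = expectation (\<lambda>\<omega>. \<phi> (X 1 \<omega>))"
      using n by (intro expectation_X) auto
    finally have e: "expectation (\<lambda>\<omega>. (1 - ?D \<omega>) * \<phi> (X n \<omega>)) = (1 - p) * expectation (\<lambda>\<omega>. \<phi> (X 1 \<omega>))" .
    show ?thesis by (subst indep_var_lebesgue_integral[OF i iH1 iDX]) (simp add: e)
  qed
  have term2: "expectation (\<lambda>\<omega>. H \<omega> * (?D \<omega> * ?C j \<omega> * \<phi> (s * Y j \<omega>))) = p / real (n - 1) * expectation (\<lambda>\<omega>. H \<omega> * \<phi> (s * Y j \<omega>))"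
    if j: "j \<in> {1..<n}" for j
  proof -
    have "(\<lambda>\<omega>. H \<omega> * \<phi> (s * Y j \<omega>)) \<in> borel_measurable (F n)"
    proof -
      have [measurable]: "Y j \<in> borel_measurable (F n)" using j by (intro Y_meas_F) auto
      show ?thesis using H(1) by measurable
    qed
    then have "indep_var borel (\<lambda>\<omega>. H \<omega> * \<phi> (s * Y j \<omega>)) borel (\<lambda>\<omega>. (\<lambda>f. f (Decision n) * indicator {real j} (f (Choice n))) (\<lambda>i\<in>present n. W i \<omega>))"
      by (rule indep_past[OF n]) (simp add: present_def)
    then have i: "indep_var borel (\<lambda>\<omega>. H \<omega> * \<phi> (s * Y j \<omega>)) borel (\<lambda>\<omega>. ?D \<omega> * ?C j \<omega>)"
      by (simp add: present_def)
    have "indep_var borel (\<lambda>\<omega>. (\<lambda>f. f (Decision n)) (\<lambda>i\<in>{Decision n}. W i \<omega>)) borel (\<lambda>\<omega>. (\<lambda>f. indicator {real j} (f (Choice n))) (\<lambda>i\<in>{Choice n}. W i \<omega>))"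
      using idx by (intro indep_restrict) auto
    then have i2: "indep_var borel ?D borel (?C j)" by simp
    have iC: "integrable M (?C j)" by (rule integrable_const_bound[of _ 1]) auto
    have e: "expectation (\<lambda>\<omega>. ?D \<omega> * ?C j \<omega>) = p / real (n - 1)"
      using indep_var_lebesgue_integral[OF i2 integrable_decision[OF n] iC] expectation_decision[OF n] expectation_choice[OF n j]
      by simp
    have iDC: "integrable M (\<lambda>\<omega>. ?D \<omega> * ?C j \<omega>)" by (rule indep_var_integrable[OF i2 integrable_decision[OF n] iC])
    have "expectation (\<lambda>\<omega>. H \<omega> * (?D \<omega> * ?C j \<omega> * \<phi> (s * Y j \<omega>))) = expectation (\<lambda>\<omega>. (H \<omega> * \<phi> (s * Y j \<omega>)) * (?D \<omega> * ?C j \<omega>))"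
      by (simp only: mult_ac)
    also have "\<dots> = expectation (\<lambda>\<omega>. H \<omega> * \<phi> (s * Y j \<omega>)) * (p / real (n - 1))"
      by (subst indep_var_lebesgue_integral[OF i iH[OF iY[OF j]] iDC]) (simp add: e)
    finally show ?thesis by (simp only: mult_ac)
  qed
  have "expectation (\<lambda>\<omega>. H \<omega> * \<phi> (Y n \<omega>)) = expectation (\<lambda>\<omega>. H \<omega> * ((1 - ?D \<omega>) * \<phi> (X n \<omega>)) + (\<Sum>j\<in>{1..<n}. H \<omega> * (?D \<omega> * ?C j \<omega> * \<phi> (s * Y j \<omega>))))"
    by (rule integral_cong_AE) (use AE in \<open>auto elim!: AE_mp simp: distrib_left sum_distrib_left\<close>)
  also have "\<dots> = (1 - p) * expectation (\<lambda>\<omega>. \<phi> (X 1 \<omega>)) * expectation H + (\<Sum>j\<in>{1..<n}. p / real (n - 1) * expectation (\<lambda>\<omega>. H \<omega> * \<phi> (s * Y j \<omega>)))"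
  proof -
    have "expectation (\<lambda>\<omega>. H \<omega> * ((1 - ?D \<omega>) * \<phi> (X n \<omega>)) + (\<Sum>j\<in>{1..<n}. H \<omega> * (?D \<omega> * ?C j \<omega> * \<phi> (s * Y j \<omega>))))
      = expectation (\<lambda>\<omega>. H \<omega> * ((1 - ?D \<omega>) * \<phi> (X n \<omega>))) + expectation (\<lambda>\<omega>. \<Sum>j\<in>{1..<n}. H \<omega> * (?D \<omega> * ?C j \<omega> * \<phi> (s * Y j \<omega>)))"
      by (intro Bochner_Integration.integral_add Bochner_Integration.integrable_sum iH[OF iDX] iH[OF iDY])
    also have "expectation (\<lambda>\<omega>. \<Sum>j\<in>{1..<n}. H \<omega> * (?D \<omega> * ?C j \<omega> * \<phi> (s * Y j \<omega>)))
      = (\<Sum>j\<in>{1..<n}. expectation (\<lambda>\<omega>. H \<omega> * (?D \<omega> * ?C j \<omega> * \<phi> (s * Y j \<omega>))))"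
      by (intro Bochner_Integration.integral_sum iH[OF iDY])
    also have "\<dots> = (\<Sum>j\<in>{1..<n}. p / real (n - 1) * expectation (\<lambda>\<omega>. H \<omega> * \<phi> (s * Y j \<omega>)))"
      by (intro sum.cong term2 refl)
    finally show ?thesis unfolding term1 .
  qed
  also have "\<dots> = expectation (\<lambda>\<omega>. (1 - p) * expectation (\<lambda>\<omega>. \<phi> (X 1 \<omega>)) * H \<omega> + (\<Sum>j\<in>{1..<n}. p / real (n - 1) * (H \<omega> * \<phi> (s * Y j \<omega>))))"
  proof -
    have "expectation (\<lambda>\<omega>. (1 - p) * expectation (\<lambda>\<omega>. \<phi> (X 1 \<omega>)) * H \<omega> + (\<Sum>j\<in>{1..<n}. p / real (n - 1) * (H \<omega> * \<phi> (s * Y j \<omega>))))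
      = expectation (\<lambda>\<omega>. (1 - p) * expectation (\<lambda>\<omega>. \<phi> (X 1 \<omega>)) * H \<omega>) + expectation (\<lambda>\<omega>. \<Sum>j\<in>{1..<n}. p / real (n - 1) * (H \<omega> * \<phi> (s * Y j \<omega>)))"
      by (intro Bochner_Integration.integral_add Bochner_Integration.integrable_sum integrable_mult_right iH1 iH[OF iY])
    also have "expectation (\<lambda>\<omega>. \<Sum>j\<in>{1..<n}. p / real (n - 1) * (H \<omega> * \<phi> (s * Y j \<omega>)))
      = (\<Sum>j\<in>{1..<n}. expectation (\<lambda>\<omega>. p / real (n - 1) * (H \<omega> * \<phi> (s * Y j \<omega>))))"
      by (intro Bochner_Integration.integral_sum integrable_mult_right iH[OF iY])
    finally show ?thesis unfolding integral_mult_right_zero by (rule sym)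
  qed
  also have "\<dots> = expectation (\<lambda>\<omega>. H \<omega> * cexp n \<phi> \<omega>)"
    unfolding cexp_def distrib_left sum_distrib_left by (simp only: mult_ac)
  finally show "expectation (\<lambda>\<omega>. H \<omega> * \<phi> (Y n \<omega>)) = expectation (\<lambda>\<omega>. H \<omega> * cexp n \<phi> \<omega>)" .
qed

end

section \<open>A strong law for the steps\<close>

lemma cesaro_null:
  fixes x :: "nat \<Rightarrow> real"
  assumes "x \<longlonglongrightarrow> 0"
  shows "(\<lambda>n. (\<Sum>k<n. x k) / real n) \<longlonglongrightarrow> 0"
proof (rule LIMSEQ_I)
  fix e :: real assume e: "0 < e"
  obtain K where K: "\<And>k. k \<ge> K \<Longrightarrow> \<bar>x k\<bar> < e / 2"
    using LIMSEQ_D[OF assms, of "e / 2"] e by auto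
  define C where "C = (\<Sum>k<K. \<bar>x k\<bar>)"
  obtain N where N: "2 * C / e < real N" using reals_Archimedean2 by blast
  show "\<exists>N. \<forall>n\<ge>N. norm ((\<Sum>k<n. x k) / real n - 0) < e"
  proof (intro exI allI impI)
    fix n assume n: "max (Suc N) K \<le> n"
    have "\<bar>\<Sum>k<n. x k\<bar> \<le> (\<Sum>k<n. \<bar>x k\<bar>)" by (rule sum_abs)
    also have "\<dots> = C + (\<Sum>k=K..<n. \<bar>x k\<bar>)"
      unfolding C_def using n sum.atLeastLessThan_concat[of 0 K n "\<lambda>k. \<bar>x k\<bar>"] by (simp add: atLeast0LessThan)
    also have "(\<Sum>k=K..<n. \<bar>x k\<bar>) \<le> (\<Sum>k=K..<n. e / 2)" using K by (intro sum_mono) (auto intro: less_imp_le)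
    also have "\<dots> \<le> real n * (e / 2)" using e by (simp add: mult_right_mono)
    finally have a: "\<bar>\<Sum>k<n. x k\<bar> \<le> C + real n * (e / 2)" by simp
    have "2 * C / e < real n" using N n by simp
    then have "C < real n * (e / 2)" using e by (simp add: field_simps)
    then have "\<bar>\<Sum>k<n. x k\<bar> < real n * e" using a by (simp add: field_simps)
    moreover have "0 < real n" using n by simp
    ultimately show "norm ((\<Sum>k<n. x k) / real n - 0) < e" by (simp add: field_simps)
  qed
qed

text \<open>With nonnegative terms no summation by parts is needed: past a fixed index the weighted
  sum is at most \<open>b n\<close> times a tail of the series.\<close>

lemma kronecker_nonneg:
  fixes x b :: "nat \<Rightarrow> real"
  assumes x: "\<And>k. 0 \<le> x k" "summable x" and b: "\<And>k. 0 \<le> b k" "eventually (\<lambda>n. \<forall>k<n. b k \<le> b n) sequentially" "filterlim b at_top sequentially"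
  shows "(\<lambda>n. (\<Sum>k<n. b k * x k) / b n) \<longlonglongrightarrow> 0"
proof (rule LIMSEQ_I)
  fix e :: real assume e: "0 < e"
  obtain K where K: "\<And>m n. m \<ge> K \<Longrightarrow> norm (sum x {m..<n}) < e / 2"
    using x(2) e unfolding summable_Cauchy by (meson half_gt_zero)
  define C where "C = (\<Sum>k<K. b k * x k)"
  have C0: "0 \<le> C" unfolding C_def using x b by (intro sum_nonneg mult_nonneg_nonneg)
  have "eventually (\<lambda>n. b n > 2 * C / e) sequentially" using b(3) by (simp add: filterlim_at_top_dense)
  moreover have "eventually (\<lambda>n. b n > 0) sequentially" using b(3) by (simp add: filterlim_at_top_dense)
  ultimately have "eventually (\<lambda>n. norm ((\<Sum>k<n. b k * x k) / b n - 0) < e) sequentially"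
    using b(2) eventually_ge_at_top[of K]
  proof eventually_elim
    case (elim n)
    have "(\<Sum>k<n. b k * x k) = C + (\<Sum>k=K..<n. b k * x k)"
      unfolding C_def using elim sum.atLeastLessThan_concat[of 0 K n "\<lambda>k. b k * x k"] by (simp add: atLeast0LessThan)
    also have "(\<Sum>k=K..<n. b k * x k) \<le> (\<Sum>k=K..<n. b n * x k)"
      using elim x by (intro sum_mono mult_right_mono) auto
    also have "\<dots> = b n * (\<Sum>k=K..<n. x k)" by (simp add: sum_distrib_left)
    also have "\<dots> \<le> b n * (e / 2)" using K[of K n] elim by (intro mult_left_mono) auto
    finally have a: "(\<Sum>k<n. b k * x k) \<le> C + b n * (e / 2)" by simp
    have "C < b n * (e / 2)" using elim(1) e by (simp add: field_simps)
    then have "(\<Sum>k<n. b k * x k) < b n * e" using a by (simp add: field_simps)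
    moreover have "0 \<le> (\<Sum>k<n. b k * x k)" using x b by (intro sum_nonneg mult_nonneg_nonneg)
    ultimately show ?case using elim by (simp add: field_simps)
  qed
  then show "\<exists>N. \<forall>n\<ge>N. norm ((\<Sum>k<n. b k * x k) / b n - 0) < e" by (simp add: eventually_sequentially)
qed

text \<open>If \<open>L\<close> is the upper limit of \<open>b\<close>, then
  \<open>L \<le> p * L\<close>, so \<open>L = 0\<close>. The proof iterates instead of forming
  \<open>L\<close>: each eventual bound improves by the factor \<open>(1 + p) / 2\<close>, whose
  slack above \<open>p\<close> absorbs the error and the early terms.\<close>

lemma averaging_contraction:
  fixes b e :: "nat \<Rightarrow> real"
  assumes b: "\<And>n. 0 \<le> b n" and rec: "\<And>n. 1 \<le> n \<Longrightarrow> b n \<le> p / real n * (\<Sum>k<n. b k) + e n"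
    and e: "e \<longlonglongrightarrow> 0" and p: "0 \<le> p" "p < 1"
  shows "b \<longlonglongrightarrow> 0"
proof -
  obtain E where E: "\<And>n. \<bar>e n\<bar> \<le> E" using convergent_imp_Bseq[OF convergentI[OF e]] by (auto simp: Bseq_def)
  \<comment> \<open>Chosen with \<open>p * K + E \<le> K\<close>, so that the bound reproduces
    itself in the recursion.\<close>
  define K where "K = max (b 0) (E / (1 - p)) + 1"
  have E0: "0 \<le> E" using E[of 0] by linarith
  have K0: "0 < K" using b[of 0] by (simp add: K_def)
  have EK: "E \<le> (1 - p) * K"
  proof -
    have "E / (1 - p) \<le> K" by (simp add: K_def)
    then show ?thesis using p by (simp add: field_simps)
  qed
  have bound: "b n \<le> K" for n
  proof (induction n rule: less_induct)
    case (less n)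
    show ?case
    proof (cases "n = 0")
      case True
      then show ?thesis by (simp add: K_def)
    next
      case False
      have "(\<Sum>k<n. b k) \<le> (\<Sum>k<n. K)" using less by (intro sum_mono) auto
      then have "p / real n * (\<Sum>k<n. b k) \<le> p / real n * (real n * K)" using p by (intro mult_left_mono) auto
      also have "\<dots> = p * K" using False by simp
      finally have "b n \<le> p * K + e n" using rec[of n] False by linarith
      also have "\<dots> \<le> p * K + (1 - p) * K" using EK E[of n] by linarith
      finally show ?thesis by (simp add: algebra_simps)
    qed
  qed
  define q where "q = (1 + p) / 2"
  have q: "0 \<le> q" "q < 1" using p by (simp_all add: q_def)
  have step: "eventually (\<lambda>n. b n \<le> q * L) sequentially" if L: "0 < L" "eventually (\<lambda>n. b n \<le> L) sequentially" for L
  proof -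
    have "(\<lambda>n. max (b n - L) 0) \<longlonglongrightarrow> 0"
      by (rule tendsto_eventually) (use L(2) in eventually_elim, auto)
    from cesaro_null[OF this] have "(\<lambda>n. p * ((\<Sum>k<n. max (b k - L) 0) / real n) + e n) \<longlonglongrightarrow> p * 0 + 0"
      by (intro tendsto_intros e)
    then have "eventually (\<lambda>n. p * ((\<Sum>k<n. max (b k - L) 0) / real n) + e n < (1 - p) / 2 * L) sequentially"
      by (rule order_tendstoD(2)) (use L p in auto)
    then show ?thesis using eventually_ge_at_top[of 1]
    proof eventually_elim
      case (elim n)
      have "(\<Sum>k<n. b k) \<le> (\<Sum>k<n. max (b k - L) 0 + L)" by (intro sum_mono) auto
      also have "\<dots> = (\<Sum>k<n. max (b k - L) 0) + real n * L" by (simp add: sum.distrib)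
      finally have "p / real n * (\<Sum>k<n. b k) \<le> p / real n * ((\<Sum>k<n. max (b k - L) 0) + real n * L)"
        using p by (intro mult_left_mono) auto
      also have "\<dots> = p * ((\<Sum>k<n. max (b k - L) 0) / real n) + p * L" using elim by (simp add: field_simps)
      finally have "b n \<le> p * L + (1 - p) / 2 * L" using rec[OF elim(2)] elim(1) by linarith
      also have "\<dots> = q * L" by (simp add: q_def field_simps)
      finally show ?case .
    qed
  qed
  have iter: "eventually (\<lambda>n. b n \<le> q ^ i * K) sequentially" for i
  proof (induction i)
    case 0
    then show ?case using bound by simp
  next
    case (Suc i)
    have "0 < q" using p by (simp add: q_def)
    then show ?case using step[OF _ Suc] K0 by (simp add: mult.assoc)
  qed
  show ?thesis
  proof (rule LIMSEQ_I)
    fix r :: real assume r: "0 < r"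
    have "(\<lambda>i. q ^ i * K) \<longlonglongrightarrow> 0 * K" using q by (intro tendsto_intros LIMSEQ_realpow_zero)
    then have "eventually (\<lambda>i. q ^ i * K < r) sequentially" using r by (intro order_tendstoD(2)) auto
    then obtain i where i: "q ^ i * K < r" by (auto simp: eventually_sequentially)
    have "eventually (\<lambda>n. norm (b n - 0) < r) sequentially"
      by (rule eventually_mono[OF iter[of i]]) (use b i in auto)
    then show "\<exists>N. \<forall>n\<ge>N. norm (b n - 0) < r" by (simp add: eventually_sequentially)
  qed
qed

section \<open>A strong law for martingale differences\<close>

context filtered_prob_space
begin

text \<open>Letting the horizon \<open>n\<close> grow, the probability of ever reaching
  \<open>\<delta>\<close> after time \<open>m\<close> is at most \<open>r m / \<delta>\<close>;
  letting \<open>m\<close> grow excludes infinitely many such times.\<close>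

lemma AE_tendsto_0_of_maximal:
  fixes Z :: "nat \<Rightarrow> 'a \<Rightarrow> real"
  assumes [measurable]: "\<And>n. Z n \<in> borel_measurable M" and nonneg: "\<And>n \<omega>. \<omega> \<in> space M \<Longrightarrow> 0 \<le> Z n \<omega>"
    and bound: "\<And>\<delta> m n. 0 < \<delta> \<Longrightarrow> m \<le> n \<Longrightarrow> \<delta> * prob {\<omega>\<in>space M. \<exists>i\<in>{m..n}. Z i \<omega> \<ge> \<delta>} \<le> r m"
    and r: "r \<longlonglongrightarrow> 0"
  shows "AE \<omega> in M. (\<lambda>n. Z n \<omega>) \<longlonglongrightarrow> 0"
proof -
  have ae: "AE \<omega> in M. eventually (\<lambda>n. Z n \<omega> < \<delta>) sequentially" if \<delta>: "0 < \<delta>" for \<delta>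
  proof -
    define B where "B m n = {\<omega>\<in>space M. \<exists>i\<in>{m..n}. Z i \<omega> \<ge> \<delta>}" for m n
    have [measurable]: "B m n \<in> events" for m n unfolding B_def by measurable
    define L where "L m = (\<Union>n. B m n)" for m
    have [measurable]: "L m \<in> events" for m unfolding L_def by measurable
    have L_le: "prob (L m) \<le> r m / \<delta>" for m
    proof (rule LIMSEQ_le_const2)
      show "(\<lambda>n. prob (B m n)) \<longlonglongrightarrow> prob (L m)"
        unfolding L_def
      proof (rule finite_Lim_measure_incseq)
        show "incseq (B m)" unfolding incseq_def
        proof safe
          fix k n \<omega> assume "k \<le> n" "\<omega> \<in> B m k"
          then obtain i where "\<omega> \<in> space M" "i \<in> {m..k}" "Z i \<omega> \<ge> \<delta>" by (auto simp: B_def)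
          with \<open>k \<le> n\<close> show "\<omega> \<in> B m n" by (auto simp: B_def intro!: bexI[of _ i])
        qed
      qed auto
      have "prob (B m n) \<le> r m / \<delta>" if "m \<le> n" for n
        using bound[OF \<delta> that] \<delta> by (simp add: B_def field_simps)
      then show "\<exists>N. \<forall>n\<ge>N. prob (B m n) \<le> r m / \<delta>" by blast
    qed
    have "prob (\<Inter>m. L m) \<le> 0"
    proof (rule LIMSEQ_le_const)
      show "(\<lambda>m. r m / \<delta>) \<longlonglongrightarrow> 0" using tendsto_divide[OF r tendsto_const, of \<delta>] \<delta> by simp
      show "\<exists>N. \<forall>n\<ge>N. prob (\<Inter>m. L m) \<le> r n / \<delta>"
      proof (intro exI[of _ 0] allI impI)
        fix n
        have "prob (\<Inter>m. L m) \<le> prob (L n)" by (intro finite_measure_mono) auto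
        then show "prob (\<Inter>m. L m) \<le> r n / \<delta>" using L_le[of n] by linarith
      qed
    qed
    then have z: "prob (\<Inter>m. L m) = 0"
      using measure_nonneg[of M "\<Inter>m. L m"] by linarith
    have "(\<Inter>m. L m) \<in> null_sets M"
      by (intro null_setsI) (simp_all add: emeasure_eq_measure z)
    then have "AE \<omega> in M. \<omega> \<notin> (\<Inter>m. L m)" by (rule AE_not_in)
    then show ?thesis using AE_space
    proof eventually_elim
      case (elim \<omega>)
      then obtain m where m: "\<omega> \<notin> L m" by blast
      have "Z n \<omega> < \<delta>" if "n \<ge> m" for n
      proof -
        have "\<omega> \<notin> B m n" using m by (auto simp: L_def)
        then show ?thesis using that elim(2) by (auto simp: B_def not_le)
      qed
      then show ?case by (auto simp: eventually_sequentially)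
    qed
  qed
  have "AE \<omega> in M. \<forall>k. eventually (\<lambda>n. Z n \<omega> < 1 / real (Suc k)) sequentially"
    unfolding AE_all_countable by (intro allI ae) simp
  then show ?thesis using AE_space
  proof eventually_elim
    case (elim \<omega>)
    show ?case
    proof (rule LIMSEQ_I)
      fix e :: real assume "0 < e"
      then obtain k where k: "1 / real (Suc k) < e" using nat_approx_posE by blast
      have "eventually (\<lambda>n. norm (Z n \<omega> - 0) < e) sequentially"
        using elim(1)[rule_format, of k] by eventually_elim (use k nonneg[OF elim(2)] in auto)
      then show "\<exists>N. \<forall>n\<ge>N. norm (Z n \<omega> - 0) < e" by (simp add: eventually_sequentially)
    qed
  qed
qed

text \<open>The route of Hajek and Renyi: the maximal inequality is applied to the squared partial
  sum over \<open>(n + 1)\<^sup>2\<close>, whose drift is at most the new variance over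
  \<open>(k + 1)\<^sup>2\<close> and hence summable. The bounds \<open>C k\<close> serve
  integrability only and may grow with \<open>k\<close>.\<close>

lemma lln_mds:
  fixes \<xi> :: "nat \<Rightarrow> 'a \<Rightarrow> real" and C :: "nat \<Rightarrow> real"
  assumes \<xi>_meas: "\<And>k. \<xi> k \<in> borel_measurable (F (Suc k))"
    and \<xi>_bound: "\<And>k \<omega>. \<omega> \<in> space M \<Longrightarrow> \<bar>\<xi> k \<omega>\<bar> \<le> C k"
    and centered: "\<And>k H B. H \<in> borel_measurable (F k) \<Longrightarrow> (\<And>\<omega>. \<omega> \<in> space M \<Longrightarrow> \<bar>H \<omega>\<bar> \<le> B) \<Longrightarrow> expectation (\<lambda>\<omega>. H \<omega> * \<xi> k \<omega>) = 0"
    and sum: "summable (\<lambda>k. expectation (\<lambda>\<omega>. (\<xi> k \<omega>)\<^sup>2) / (real (Suc k))\<^sup>2)"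
  shows "AE \<omega> in M. (\<lambda>n. (\<Sum>k<n. \<xi> k \<omega>) / real n) \<longlonglongrightarrow> 0"
proof -
  define S where "S n \<omega> = (\<Sum>k<n. \<xi> k \<omega>)" for n \<omega>
  define v where "v k = expectation (\<lambda>\<omega>. (\<xi> k \<omega>)\<^sup>2)" for k
  define Z where "Z n \<omega> = (S n \<omega>)\<^sup>2 / (real (Suc n))\<^sup>2" for n \<omega>
  define x where "x k = v k / (real (Suc k))\<^sup>2" for k
  have [measurable]: "\<xi> k \<in> borel_measurable M" for k using \<xi>_meas meas_F by blast
  have S_F: "S n \<in> borel_measurable (F n)" for n
    unfolding S_def by (intro borel_measurable_sum meas_F_mono[OF \<xi>_meas]) auto
  then have [measurable]: "S n \<in> borel_measurable M" for n using meas_F by blast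
  have S_bound: "\<bar>S n \<omega>\<bar> \<le> (\<Sum>k<n. C k)" if "\<omega> \<in> space M" for n \<omega>
    unfolding S_def by (rule order_trans[OF sum_abs]) (intro sum_mono \<xi>_bound that)
  have C0: "0 \<le> C k" for k
  proof -
    obtain \<omega> where "\<omega> \<in> space M" using not_empty by blast
    then show ?thesis using \<xi>_bound[of \<omega> k] by linarith
  qed
  have int_bdd: "integrable M f" if "f \<in> borel_measurable M" "\<And>\<omega>. \<omega> \<in> space M \<Longrightarrow> \<bar>f \<omega>\<bar> \<le> (B::real)" for f B
    by (rule integrable_const_bound[of _ B]) (use that in auto)
  have \<xi>2: "(\<xi> k \<omega>)\<^sup>2 \<le> (C k)\<^sup>2" if "\<omega> \<in> space M" for k \<omega>
    using \<xi>_bound[OF that, of k] C0[of k] abs_le_square_iff[of "\<xi> k \<omega>" "C k"] by simp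
  have S2: "(S k \<omega>)\<^sup>2 \<le> (\<Sum>i<k. C i)\<^sup>2" if "\<omega> \<in> space M" for k \<omega>
    using S_bound[OF that, of k] abs_le_square_iff[of "S k \<omega>" "\<Sum>i<k. C i"] C0 by (simp add: sum_nonneg)
  have sq: "expectation (\<lambda>\<omega>. indicator A \<omega> * (S (Suc k) \<omega>)\<^sup>2) \<le> expectation (\<lambda>\<omega>. indicator A \<omega> * (S k \<omega>)\<^sup>2) + v k"
    if A: "A \<in> sets (F k)" for A k
  proof -
    have [measurable]: "A \<in> events" using A sets_F by blast
    have i1: "integrable M (\<lambda>\<omega>. indicator A \<omega> * (S k \<omega>)\<^sup>2)"
      by (rule int_bdd[of _ "(\<Sum>i<k. C i)\<^sup>2"]) (use S2 in \<open>auto simp: indicator_def\<close>)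
    have i2: "integrable M (\<lambda>\<omega>. (indicator A \<omega> * S k \<omega>) * \<xi> k \<omega>)"
      by (rule int_bdd[of _ "(\<Sum>i<k. C i) * C k"]) (use S_bound \<xi>_bound C0 in \<open>auto simp: abs_mult indicator_def intro!: mult_mono sum_nonneg mult_nonneg_nonneg\<close>)
    have i3: "integrable M (\<lambda>\<omega>. (\<xi> k \<omega>)\<^sup>2)" by (rule int_bdd[of _ "(C k)\<^sup>2"]) (use \<xi>2 in auto)
    have i4: "integrable M (\<lambda>\<omega>. indicator A \<omega> * (\<xi> k \<omega>)\<^sup>2)" by (rule int_bdd[of _ "(C k)\<^sup>2"]) (use \<xi>2 in \<open>auto simp: indicator_def\<close>)
    have c: "expectation (\<lambda>\<omega>. (indicator A \<omega> * S k \<omega>) * \<xi> k \<omega>) = 0"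
      by (rule centered[of _ _ "\<Sum>i<k. C i"]) (use A S_F[of k] S_bound C0 in \<open>auto simp: indicator_def sum_nonneg\<close>)
    have "expectation (\<lambda>\<omega>. indicator A \<omega> * (S (Suc k) \<omega>)\<^sup>2)
      = expectation (\<lambda>\<omega>. indicator A \<omega> * (S k \<omega>)\<^sup>2 + 2 * ((indicator A \<omega> * S k \<omega>) * \<xi> k \<omega>) + indicator A \<omega> * (\<xi> k \<omega>)\<^sup>2)"
      by (intro Bochner_Integration.integral_cong) (auto simp: S_def power2_eq_square algebra_simps)
    also have "\<dots> = expectation (\<lambda>\<omega>. indicator A \<omega> * (S k \<omega>)\<^sup>2) + expectation (\<lambda>\<omega>. indicator A \<omega> * (\<xi> k \<omega>)\<^sup>2)"
      using i1 i2 i4 c by simp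
    also have "expectation (\<lambda>\<omega>. indicator A \<omega> * (\<xi> k \<omega>)\<^sup>2) \<le> v k"
      unfolding v_def using i3 i4 by (intro integral_mono) (auto simp: indicator_def)
    finally show ?thesis by simp
  qed
  have v0: "0 \<le> v k" for k unfolding v_def by (intro Bochner_Integration.integral_nonneg_AE AE_I2) simp
  have Z_int: "integrable M (Z n)" for n
    unfolding Z_def[abs_def] by (intro Bochner_Integration.integrable_divide int_bdd[of _ "(\<Sum>i<n. C i)\<^sup>2"]) (use S2 in auto)
  have space_in_F: "space M \<in> sets (F n)" for n using sets.top[of "F n"] by simp
  have EZ: "expectation (Z m) \<le> (\<Sum>k<m. v k) / (real (Suc m))\<^sup>2" for m
  proof -
    have "expectation (\<lambda>\<omega>. (S m \<omega>)\<^sup>2) \<le> (\<Sum>k<m. v k)"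
    proof (induction m)
      case 0
      then show ?case by (simp add: S_def)
    next
      case (Suc m)
      have eq: "expectation (\<lambda>\<omega>. indicator (space M) \<omega> * f \<omega>) = expectation f" for f :: "'a \<Rightarrow> real"
        by (intro Bochner_Integration.integral_cong) auto
      show ?case using sq[OF space_in_F, of m] Suc unfolding eq by simp
    qed
    then show ?thesis unfolding Z_def by (simp add: divide_right_mono)
  qed
  have step: "expectation (\<lambda>\<omega>. indicator A \<omega> * Z (Suc k) \<omega>) \<le> expectation (\<lambda>\<omega>. indicator A \<omega> * Z k \<omega>) + x k"
    if A: "A \<in> sets (F k)" for A k
  proof -
    have [measurable]: "A \<in> events" using A sets_F by blast
    \<comment> \<open>The denominator is lowered from \<open>(k + 2)\<^sup>2\<close> to
      \<open>(k + 1)\<^sup>2\<close>, that of \<open>Z k\<close>.\<close>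
    have "expectation (\<lambda>\<omega>. indicator A \<omega> * Z (Suc k) \<omega>) \<le> expectation (\<lambda>\<omega>. indicator A \<omega> * (S (Suc k) \<omega>)\<^sup>2 / (real (Suc k))\<^sup>2)"
    proof (rule integral_mono)
      show "integrable M (\<lambda>\<omega>. indicator A \<omega> * Z (Suc k) \<omega>)"
        using integrable_real_mult_indicator[OF _ Z_int, of A "Suc k"] by (simp add: mult.commute)
      show "integrable M (\<lambda>\<omega>. indicator A \<omega> * (S (Suc k) \<omega>)\<^sup>2 / (real (Suc k))\<^sup>2)"
        by (intro Bochner_Integration.integrable_divide int_bdd[of _ "(\<Sum>i<Suc k. C i)\<^sup>2"]) (use S2[of _ "Suc k"] in \<open>auto simp: indicator_def\<close>)
      show "indicator A \<omega> * Z (Suc k) \<omega> \<le> indicator A \<omega> * (S (Suc k) \<omega>)\<^sup>2 / (real (Suc k))\<^sup>2" for \<omega>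
        unfolding Z_def by (auto simp: indicator_def intro!: divide_left_mono power_mono mult_pos_pos zero_less_power)
    qed
    also have "\<dots> = expectation (\<lambda>\<omega>. indicator A \<omega> * (S (Suc k) \<omega>)\<^sup>2) / (real (Suc k))\<^sup>2" by simp
    also have "\<dots> \<le> (expectation (\<lambda>\<omega>. indicator A \<omega> * (S k \<omega>)\<^sup>2) + v k) / (real (Suc k))\<^sup>2"
      by (intro divide_right_mono sq A) auto
    also have "\<dots> = expectation (\<lambda>\<omega>. indicator A \<omega> * Z k \<omega>) + x k"
      by (simp add: add_divide_distrib x_def Z_def)
    finally show ?thesis .
  qed
  \<comment> \<open>A bound for the mean of \<open>Z m\<close> plus all later drift; its first part
    vanishes by the Kronecker lemma, its second is the tail of a convergent series.\<close>
  define r where "r m = (\<Sum>k<m. v k) / (real (Suc m))\<^sup>2 + (suminf x - (\<Sum>k<m. x k))" for m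
  have xs: "summable x" using sum by (simp add: x_def[abs_def] v_def)
  have x0: "0 \<le> x k" for k using v0 by (simp add: x_def)
  have r0: "r \<longlonglongrightarrow> 0"
  proof -
    have "(\<lambda>m. (\<Sum>k<m. (real (Suc k))\<^sup>2 * x k) / (real (Suc m))\<^sup>2) \<longlonglongrightarrow> 0"
    proof (rule kronecker_nonneg[OF x0 xs])
      show "filterlim (\<lambda>n. (real (Suc n))\<^sup>2) at_top sequentially" by real_asymp
    qed (auto intro!: power_mono always_eventually)
    moreover have "(real (Suc k))\<^sup>2 * x k = v k" for k by (simp add: x_def)
    ultimately have "(\<lambda>m. (\<Sum>k<m. v k) / (real (Suc m))\<^sup>2) \<longlonglongrightarrow> 0" by simp
    moreover have "(\<lambda>m. suminf x - (\<Sum>k<m. x k)) \<longlonglongrightarrow> suminf x - suminf x"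
      using summable_LIMSEQ[OF xs] by (intro tendsto_intros)
    ultimately have "r \<longlonglongrightarrow> 0 + (suminf x - suminf x)"
      unfolding r_def by (rule tendsto_add)
    then show ?thesis by simp
  qed
  have "AE \<omega> in M. (\<lambda>n. Z n \<omega>) \<longlonglongrightarrow> 0"
  proof (rule AE_tendsto_0_of_maximal[OF _ _ _ r0])
    show "Z n \<in> borel_measurable M" for n unfolding Z_def by measurable
    show "0 \<le> Z n \<omega>" for n \<omega> by (simp add: Z_def)
    fix \<delta> :: real and m n :: nat assume \<delta>: "0 < \<delta>" and mn: "m \<le> n"
    have "\<delta> * prob {\<omega>\<in>space M. \<exists>i\<in>{m..n}. Z i \<omega> \<ge> \<delta>} \<le> expectation (Z m) + (\<Sum>i=m..<n. x i)"
    proof (rule maximal_inequality)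
      show "Z n \<in> borel_measurable (F n)" for n unfolding Z_def using S_F[of n] by measurable
      show "0 \<le> Z n \<omega>" for n \<omega> by (simp add: Z_def)
    qed (use Z_int step mn in auto)
    also have "expectation (Z m) + (\<Sum>i=m..<n. x i) \<le> r m"
    proof -
      have "(\<Sum>i=m..<n. x i) + (\<Sum>i<m. x i) = (\<Sum>i<n. x i)"
        using sum.atLeastLessThan_concat[of 0 m n x] mn by (simp add: atLeast0LessThan add.commute)
      moreover have "(\<Sum>i<n. x i) \<le> suminf x" using xs x0 by (intro sum_le_suminf) auto
      ultimately show ?thesis using EZ[of m] unfolding r_def by linarith
    qed
    finally show "\<delta> * prob {\<omega>\<in>space M. \<exists>i\<in>{m..n}. Z i \<omega> \<ge> \<delta>} \<le> r m" .
  qed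
  then show ?thesis
  proof eventually_elim
    case (elim \<omega>)
    then have "(\<lambda>n. sqrt (Z n \<omega>)) \<longlonglongrightarrow> sqrt 0" by (intro tendsto_intros)
    then have "(\<lambda>n. \<bar>S n \<omega> / real (Suc n)\<bar>) \<longlonglongrightarrow> 0" by (simp add: Z_def real_sqrt_divide abs_divide)
    then have "(\<lambda>n. S n \<omega> / real (Suc n)) \<longlonglongrightarrow> 0" by (rule tendsto_rabs_zero_cancel)
    moreover have "(\<lambda>n. real (Suc n) / real n) \<longlonglongrightarrow> 1" by real_asymp
    ultimately have "(\<lambda>n. S n \<omega> / real (Suc n) * (real (Suc n) / real n)) \<longlonglongrightarrow> 0 * 1" by (rule tendsto_mult)
    then show ?case unfolding S_def by (simp del: of_nat_Suc)
  qed
qed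

end

text \<open>The tail of the inverse squares telescopes to at most \<open>1 / m\<close> for the least
  \<open>m \<ge> y\<close>. Integrated with \<open>y\<close> the absolute value of an integrable
  variable, this gives summable variances for truncation at level \<open>k\<close>.\<close>

lemma sum_inverse_square_tail:
  fixes y :: real
  assumes "0 \<le> y"
  shows "(\<Sum>k<n. y\<^sup>2 * of_bool (y \<le> real k) / (real (Suc k))\<^sup>2) \<le> y"
proof (cases "y = 0")
  case False
  then have y: "0 < y" using assms by simp
  have tail: "(\<Sum>k=m..<n. 1 / (real (Suc k))\<^sup>2) \<le> 1 / real m - 1 / real (max m n)" if "1 \<le> m" for m
  proof (induction n)
    case (Suc n)
    show ?case
    proof (cases "m \<le> n")
      case True
      then have n: "0 < real n" using that by simp
      have "1 / (real (Suc n))\<^sup>2 \<le> 1 / (real n * real (Suc n))"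
        using n by (intro divide_left_mono mult_pos_pos) (auto simp: power2_eq_square intro!: mult_right_mono)
      also have "\<dots> = 1 / real n - 1 / real (Suc n)" using n by (simp add: field_simps)
      finally show ?thesis using Suc True by (simp add: max_def del: of_nat_Suc)
    next
      case False
      then have "{m..<Suc n} = {} \<and> max m (Suc n) = m" by auto
      then show ?thesis by simp
    qed
  qed simp
  define m where "m = nat \<lceil>y\<rceil>"
  have m: "1 \<le> m" "y \<le> real m" "\<And>k. y \<le> real k \<Longrightarrow> m \<le> k"
  proof -
    show "1 \<le> m" using y by (simp add: m_def Suc_le_eq)
    show "y \<le> real m" unfolding m_def by (rule real_nat_ceiling_ge)
    show "m \<le> k" if "y \<le> real k" for k using that by (simp add: m_def nat_ceiling_le_eq)
  qed
  have "(\<Sum>k<n. y\<^sup>2 * of_bool (y \<le> real k) / (real (Suc k))\<^sup>2) \<le> (\<Sum>k\<in>{..<n} \<inter> {m..}. y\<^sup>2 * (1 / (real (Suc k))\<^sup>2))"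
    unfolding sum.inter_restrict[OF finite_lessThan]
    by (intro sum_mono) (use m(3) in auto)
  also have "{..<n} \<inter> {m..} = {m..<n}" by auto
  also have "(\<Sum>k\<in>{m..<n}. y\<^sup>2 * (1 / (real (Suc k))\<^sup>2)) = y\<^sup>2 * (\<Sum>k=m..<n. 1 / (real (Suc k))\<^sup>2)"
    by (simp add: sum_distrib_left)
  also have "\<dots> \<le> y\<^sup>2 * (1 / real m)"
  proof (rule mult_left_mono)
    have "0 \<le> 1 / real (max m n)" by simp
    then show "(\<Sum>k=m..<n. 1 / (real (Suc k))\<^sup>2) \<le> 1 / real m" using tail[OF m(1)] by linarith
  qed simp
  also have "\<dots> \<le> y\<^sup>2 * (1 / y)" using m y by (intro mult_left_mono divide_left_mono) auto
  also have "\<dots> = y" using y by (simp add: power2_eq_square)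
  finally show ?thesis .
qed simp

text \<open>Integrated, this makes the probabilities of exceeding level \<open>k\<close> summable,
  so that only finitely many steps are changed by truncation.\<close>

lemma sum_indicator_less:
  fixes y :: real
  assumes "0 \<le> y"
  shows "(\<Sum>k<n. of_bool (real k < y)) \<le> y + 1"
proof -
  have "(\<Sum>k<n. of_bool (real k < y) :: real) = real (card {k. k < n \<and> real k < y})"
    by (simp add: of_bool_def sum.If_cases Int_def)
  also have "\<dots> \<le> real (card {..<nat \<lceil>y\<rceil>})"
  proof -
    have "{k. k < n \<and> real k < y} \<subseteq> {..<nat \<lceil>y\<rceil>}" by (auto simp: zless_nat_eq_int_zless less_ceiling_iff)
    then show ?thesis by (intro of_nat_mono card_mono) auto
  qed
  also have "\<dots> \<le> y + 1" using assms by simp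
  finally show ?thesis .
qed

section \<open>Laws and innovations of the steps\<close>

context signed_reinforcement
begin

lemma s_mult [simp]: "s * (s * x) = x"
  using s by auto

text \<open>A step is a fresh innovation with probability \<open>1 - p\<close> and otherwise a
  uniformly chosen earlier step times \<open>s\<close>, so by induction it inherits the mean of
  every function that the factor \<open>s\<close> does not affect. This is what makes moment
  estimates for \<open>X 1\<close> available for all steps despite their dependence.\<close>

lemma invariant_law:
  assumes \<phi>[measurable]: "\<phi> \<in> borel_measurable borel" and inv: "\<And>x. \<phi> (s * x) = (\<phi> x :: real)"
    and int: "integrable M (\<lambda>\<omega>. \<phi> (X 1 \<omega>))" and "1 \<le> n"
  shows "integrable M (\<lambda>\<omega>. \<phi> (Y n \<omega>)) \<and> expectation (\<lambda>\<omega>. \<phi> (Y n \<omega>)) = expectation (\<lambda>\<omega>. \<phi> (X 1 \<omega>))"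
  using \<open>1 \<le> n\<close>
proof (induction n rule: less_induct)
  case (less n)
  show ?case
  proof (cases "2 \<le> n")
    case False
    then have "n = Suc 0" using less by simp
    then show ?thesis using int by (simp add: Y_1)
  next
    case True
    have IH: "integrable M (\<lambda>\<omega>. \<phi> (s * Y j \<omega>))" "expectation (\<lambda>\<omega>. \<phi> (s * Y j \<omega>)) = expectation (\<lambda>\<omega>. \<phi> (X 1 \<omega>))" if "j \<in> {1..<n}" for j
      using less.IH[of j] that by (auto simp: inv)
    note cs = conditional_step[OF True \<phi> int IH(1), where H="\<lambda>_. 1" and B=1]
    have "expectation (\<lambda>\<omega>. \<phi> (Y n \<omega>)) = expectation (\<lambda>\<omega>. cexp n \<phi> \<omega>)" using cs(1) by simp
    also have "\<dots> = (1 - p) * expectation (\<lambda>\<omega>. \<phi> (X 1 \<omega>)) + p / real (n - 1) * (\<Sum>j\<in>{1..<n}. expectation (\<lambda>\<omega>. \<phi> (s * Y j \<omega>)))"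
    proof -
      have i: "integrable M (\<lambda>\<omega>. \<Sum>j\<in>{1..<n}. \<phi> (s * Y j \<omega>))" using IH(1) by (intro Bochner_Integration.integrable_sum)
      have "expectation (\<lambda>\<omega>. \<Sum>j\<in>{1..<n}. \<phi> (s * Y j \<omega>)) = (\<Sum>j\<in>{1..<n}. expectation (\<lambda>\<omega>. \<phi> (s * Y j \<omega>)))"
        using IH(1) by (intro Bochner_Integration.integral_sum)
      then show ?thesis unfolding cexp_def
        by (subst Bochner_Integration.integral_add[OF integrable_const integrable_mult_right[OF i]])
          (simp only: integral_mult_right_zero lebesgue_integral_const prob_space scaleR_one)
    qed
    also have "\<dots> = (1 - p) * expectation (\<lambda>\<omega>. \<phi> (X 1 \<omega>)) + p / real (n - 1) * (real (n - 1) * expectation (\<lambda>\<omega>. \<phi> (X 1 \<omega>)))"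
      using IH(2) by simp
    also have "\<dots> = expectation (\<lambda>\<omega>. \<phi> (X 1 \<omega>))" using True by (simp add: field_simps)
    finally show ?thesis using cs(2) by simp
  qed
qed

definition innov :: "nat \<Rightarrow> (real \<Rightarrow> real) \<Rightarrow> 'a \<Rightarrow> real" where
  "innov n \<phi> \<omega> = \<phi> (Y n \<omega>) - cexp n \<phi> \<omega>"

lemma cexp_bound:
  assumes "2 \<le> n" "\<phi> \<in> borel_measurable borel" "\<And>x. \<bar>\<phi> x\<bar> \<le> C"
  shows "\<bar>cexp n \<phi> \<omega>\<bar> \<le> C"
proof -
  have C: "0 \<le> C" using assms(3)[of 0] by linarith
  have i: "integrable M (\<lambda>\<omega>. \<phi> (X 1 \<omega>))"
    by (rule integrable_const_bound[of _ C]) (use assms X_rv[of 1] in auto)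
  have "\<bar>expectation (\<lambda>\<omega>. \<phi> (X 1 \<omega>))\<bar> \<le> expectation (\<lambda>\<omega>. \<bar>\<phi> (X 1 \<omega>)\<bar>)" by (rule integral_abs_bound)
  also have "\<dots> \<le> expectation (\<lambda>_. C)" using i assms by (intro integral_mono) auto
  finally have a: "\<bar>expectation (\<lambda>\<omega>. \<phi> (X 1 \<omega>))\<bar> \<le> C" by (simp add: prob_space)
  have "\<bar>\<Sum>j\<in>{1..<n}. \<phi> (s * Y j \<omega>)\<bar> \<le> (\<Sum>j\<in>{1..<n}. \<bar>\<phi> (s * Y j \<omega>)\<bar>)" by (rule sum_abs)
  also have "\<dots> \<le> (\<Sum>j\<in>{1..<n}. C)" by (intro sum_mono assms)
  finally have b: "\<bar>\<Sum>j\<in>{1..<n}. \<phi> (s * Y j \<omega>)\<bar> \<le> real (n - 1) * C" by simp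
  have "\<bar>cexp n \<phi> \<omega>\<bar> \<le> \<bar>(1 - p) * expectation (\<lambda>\<omega>. \<phi> (X 1 \<omega>))\<bar> + \<bar>p / real (n - 1) * (\<Sum>j\<in>{1..<n}. \<phi> (s * Y j \<omega>))\<bar>"
    unfolding cexp_def by (rule abs_triangle_ineq)
  also have "\<dots> = (1 - p) * \<bar>expectation (\<lambda>\<omega>. \<phi> (X 1 \<omega>))\<bar> + p / real (n - 1) * \<bar>\<Sum>j\<in>{1..<n}. \<phi> (s * Y j \<omega>)\<bar>"
    using p by (simp add: abs_mult)
  also have "\<dots> \<le> (1 - p) * C + p / real (n - 1) * (real (n - 1) * C)"
    using p a b by (intro add_mono mult_left_mono) auto
  also have "\<dots> = C" using assms(1) by (simp add: field_simps)
  finally show ?thesis .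
qed

lemma innov_bound:
  assumes "2 \<le> n" "\<phi> \<in> borel_measurable borel" "\<And>x. \<bar>\<phi> x\<bar> \<le> C"
  shows "\<bar>innov n \<phi> \<omega>\<bar> \<le> 2 * C"
  using cexp_bound[OF assms] assms(3)[of "Y n \<omega>"] unfolding innov_def by (smt (verit))

lemma innov_meas_F: "1 \<le> n \<Longrightarrow> \<phi> \<in> borel_measurable borel \<Longrightarrow> innov n \<phi> \<in> borel_measurable (F (Suc n))"
proof -
  assume n: "1 \<le> n" and [measurable]: "\<phi> \<in> borel_measurable borel"
  have [measurable]: "Y n \<in> borel_measurable (F (Suc n))" using n by (intro Y_meas_F) auto
  have [measurable]: "cexp n \<phi> \<in> borel_measurable (F (Suc n))" by (intro meas_F_mono[OF cexp_meas_F]) auto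
  show ?thesis unfolding innov_def[abs_def] by measurable
qed

context
  fixes n :: nat and \<phi> :: "real \<Rightarrow> real" and C :: real
  assumes n: "2 \<le> n" and \<phi>[measurable]: "\<phi> \<in> borel_measurable borel" and C: "\<And>x. \<bar>\<phi> x\<bar> \<le> C"
begin

lemma innov_centered:
  assumes H: "H \<in> borel_measurable (F n)" "\<And>\<omega>. \<omega> \<in> space M \<Longrightarrow> \<bar>H \<omega>\<bar> \<le> B"
  shows "expectation (\<lambda>\<omega>. H \<omega> * innov n \<phi> \<omega>) = 0"
proof -
  have [measurable]: "H \<in> borel_measurable M" "cexp n \<phi> \<in> borel_measurable M" "Y n \<in> borel_measurable M"
    using H(1) cexp_meas_F[OF \<phi>, of n] n by (auto intro: meas_F)
  have B0: "0 \<le> B" using H(2) not_empty by fastforce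
  have C0: "0 \<le> C" using C[of 0] by linarith
  have i: "integrable M (\<lambda>\<omega>. \<phi> (X 1 \<omega>))" "\<And>j. j \<in> {1..<n} \<Longrightarrow> integrable M (\<lambda>\<omega>. \<phi> (s * Y j \<omega>))"
    using C X_rv[of 1] Y_meas by (auto intro!: integrable_const_bound[of _ C])
  have "integrable M (\<lambda>\<omega>. H \<omega> * \<phi> (Y n \<omega>))" "integrable M (\<lambda>\<omega>. H \<omega> * cexp n \<phi> \<omega>)"
    using H(2) C cexp_bound[OF n \<phi> C] B0 C0
    by (auto intro!: integrable_const_bound[of _ "B * C"] mult_mono AE_I2 simp: abs_mult)
  then show ?thesis using conditional_step(1)[OF n \<phi> i H] unfolding innov_def by (simp add: right_diff_distrib)
qed

text \<open>Write the square as \<open>\<phi>\<^sup>2 - c\<^sup>2 - 2 * c * (\<phi> - c)\<close>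
  with \<open>c\<close> the conditional mean; the last term is centred because \<open>H * c\<close>
  is again a bounded test function of the past.\<close>

lemma innov_variance:
  assumes H: "H \<in> borel_measurable (F n)" "\<And>\<omega>. \<omega> \<in> space M \<Longrightarrow> \<bar>H \<omega>\<bar> \<le> B"
  shows "expectation (\<lambda>\<omega>. H \<omega> * (innov n \<phi> \<omega>)\<^sup>2) = expectation (\<lambda>\<omega>. H \<omega> * (cexp n (\<lambda>x. (\<phi> x)\<^sup>2) \<omega> - (cexp n \<phi> \<omega>)\<^sup>2))"
proof -
  have [measurable]: "H \<in> borel_measurable M" "cexp n \<phi> \<in> borel_measurable M" "Y n \<in> borel_measurable M"
    using H(1) cexp_meas_F[OF \<phi>, of n] n by (auto intro: meas_F)
  have [measurable]: "cexp n (\<lambda>x. (\<phi> x)\<^sup>2) \<in> borel_measurable M" by (rule meas_F[OF cexp_meas_F]) measurable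
  have B0: "0 \<le> B" using H(2) not_empty by fastforce
  have C0: "0 \<le> C" using C[of 0] by linarith
  have C2: "\<bar>(\<phi> x)\<^sup>2\<bar> \<le> C\<^sup>2" for x using C[of x] C0 abs_le_square_iff[of "\<phi> x" C] by simp
  note ce = cexp_bound[OF n \<phi> C]
  have ce2: "\<bar>(cexp n \<phi> \<omega>)\<^sup>2\<bar> \<le> C\<^sup>2" for \<omega> using ce[of \<omega>] C0 abs_le_square_iff[of "cexp n \<phi> \<omega>" C] by simp
  have i: "integrable M (\<lambda>\<omega>. (\<phi> (X 1 \<omega>))\<^sup>2)" "\<And>j. j \<in> {1..<n} \<Longrightarrow> integrable M (\<lambda>\<omega>. (\<phi> (s * Y j \<omega>))\<^sup>2)"
    using C2 X_rv[of 1] Y_meas by (auto intro!: integrable_const_bound[of _ "C\<^sup>2"])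
  have ceB: "\<bar>cexp n (\<lambda>x. (\<phi> x)\<^sup>2) \<omega>\<bar> \<le> C\<^sup>2" for \<omega> by (rule cexp_bound[OF n _ C2]) measurable
  have j1: "integrable M (\<lambda>\<omega>. H \<omega> * (\<phi> (Y n \<omega>))\<^sup>2)"
    by (rule integrable_const_bound[of _ "B * C\<^sup>2"]) (use H(2) C2 B0 C0 in \<open>auto intro!: mult_mono AE_I2 simp: abs_mult\<close>)
  have j2: "integrable M (\<lambda>\<omega>. H \<omega> * (cexp n \<phi> \<omega>)\<^sup>2)"
    by (rule integrable_const_bound[of _ "B * C\<^sup>2"]) (use H(2) ce2 B0 C0 in \<open>auto intro!: mult_mono AE_I2 simp: abs_mult\<close>)
  have j3: "integrable M (\<lambda>\<omega>. H \<omega> * cexp n (\<lambda>x. (\<phi> x)\<^sup>2) \<omega>)"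
    by (rule integrable_const_bound[of _ "B * C\<^sup>2"]) (use H(2) ceB B0 C0 in \<open>auto intro!: mult_mono AE_I2 simp: abs_mult\<close>)
  have j4: "integrable M (\<lambda>\<omega>. (H \<omega> * cexp n \<phi> \<omega>) * innov n \<phi> \<omega>)"
  proof (rule integrable_const_bound[of _ "(B * C) * (2 * C)"])
    have [measurable]: "innov n \<phi> \<in> borel_measurable M" by (rule meas_F[OF innov_meas_F]) (use n in auto)
    show "(\<lambda>\<omega>. (H \<omega> * cexp n \<phi> \<omega>) * innov n \<phi> \<omega>) \<in> borel_measurable M" by measurable
    show "AE \<omega> in M. norm (H \<omega> * cexp n \<phi> \<omega> * innov n \<phi> \<omega>) \<le> B * C * (2 * C)"
      using H(2) ce innov_bound[OF n \<phi> C] B0 C0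
      by (intro AE_I2) (simp only: real_norm_def abs_mult, intro mult_mono mult_nonneg_nonneg, auto)
  qed
  have z: "expectation (\<lambda>\<omega>. (H \<omega> * cexp n \<phi> \<omega>) * innov n \<phi> \<omega>) = 0"
  proof (rule innov_centered[of _ "B * C"])
    show "(\<lambda>\<omega>. H \<omega> * cexp n \<phi> \<omega>) \<in> borel_measurable (F n)" using H(1) cexp_meas_F[OF \<phi>, of n] by simp
    show "\<bar>H \<omega> * cexp n \<phi> \<omega>\<bar> \<le> B * C" if "\<omega> \<in> space M" for \<omega>
      unfolding abs_mult using H(2)[OF that] ce B0 by (intro mult_mono) auto
  qed
  have "expectation (\<lambda>\<omega>. H \<omega> * (innov n \<phi> \<omega>)\<^sup>2)
    = expectation (\<lambda>\<omega>. H \<omega> * (\<phi> (Y n \<omega>))\<^sup>2 - H \<omega> * (cexp n \<phi> \<omega>)\<^sup>2 - 2 * ((H \<omega> * cexp n \<phi> \<omega>) * innov n \<phi> \<omega>))"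
    by (intro Bochner_Integration.integral_cong) (auto simp: innov_def power2_eq_square algebra_simps)
  also have "\<dots> = expectation (\<lambda>\<omega>. H \<omega> * (\<phi> (Y n \<omega>))\<^sup>2) - expectation (\<lambda>\<omega>. H \<omega> * (cexp n \<phi> \<omega>)\<^sup>2)"
    using j1 j2 j4 z by simp
  also have "expectation (\<lambda>\<omega>. H \<omega> * (\<phi> (Y n \<omega>))\<^sup>2) = expectation (\<lambda>\<omega>. H \<omega> * cexp n (\<lambda>x. (\<phi> x)\<^sup>2) \<omega>)"
    by (rule conditional_step(1)[OF n _ i H]) measurable
  finally show ?thesis using j2 j3 by (simp add: right_diff_distrib)
qed

end

end

text \<open>The pathwise half of the strong law. Up to errors with vanishing averages, a step is
  \<open>(1 - p) * m\<close> plus \<open>p * t\<close> times the average of the earlier steps.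
  Subtracting the fixed point of this relation leaves the recursion of
  \<open>averaging_contraction\<close>.\<close>

lemma reinforced_average:
  fixes a \<mu> :: "nat \<Rightarrow> real"
  assumes ev: "eventually (\<lambda>k. \<bar>a k\<bar> \<le> real k) sequentially"
    and lim: "(\<lambda>n. (\<Sum>k<n. if 2 \<le> k then a k * of_bool (\<bar>a k\<bar> \<le> real k)
        - ((1 - p) * \<mu> k + p / real (k - 1) * (\<Sum>j\<in>{1..<k}. t * (a j * of_bool (\<bar>a j\<bar> \<le> real k)))) else 0) / real n) \<longlonglongrightarrow> 0"
    and \<mu>: "\<mu> \<longlonglongrightarrow> m" and p: "0 \<le> p" "p < 1" and t: "\<bar>t\<bar> = 1"
  shows "(\<lambda>n. (\<Sum>j=1..n. a j) / real n) \<longlonglongrightarrow> (1 - p) * m / (1 - p * t)"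
proof -
  define m' where "m' = (1 - p) * m / (1 - p * t)"
  have "t \<le> 1" using t by linarith
  then have pt: "p * t < 1" using p mult_left_mono[of t 1 p] by linarith
  have m': "(1 - p) * m + p * t * m' = m'" using pt by (simp add: m'_def field_simps)
  define A where "A n = (\<Sum>j=1..n. a j) / real n" for n
  define x where "x k = (if 2 \<le> k then a k * of_bool (\<bar>a k\<bar> \<le> real k)
        - ((1 - p) * \<mu> k + p / real (k - 1) * (\<Sum>j\<in>{1..<k}. t * (a j * of_bool (\<bar>a j\<bar> \<le> real k)))) else 0)" for k
  define y where "y k = (if 2 \<le> k then a k - (1 - p) * m - p * t * A (k - 1) else 0)" for k
  have yx: "(\<lambda>k. y k - x k) \<longlonglongrightarrow> 0"
  proof -
    obtain K where K: "\<And>k. k \<ge> K \<Longrightarrow> \<bar>a k\<bar> \<le> real k" using ev by (auto simp: eventually_sequentially)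
    define C where "C = (\<Sum>j<K. \<bar>a j\<bar>)"
    \<comment> \<open>Earlier steps are cut at the current level \<open>k\<close>, not at their own
      index. For \<open>j \<ge> K\<close> the cut never acts, so the discrepancy is bounded and
      disappears after division by \<open>k - 1\<close>.\<close>
    have diff: "\<bar>(\<Sum>j\<in>{1..<k}. a j) - (\<Sum>j\<in>{1..<k}. a j * of_bool (\<bar>a j\<bar> \<le> real k))\<bar> \<le> C" for k
    proof -
      have "(\<Sum>j\<in>{1..<k}. a j) - (\<Sum>j\<in>{1..<k}. a j * of_bool (\<bar>a j\<bar> \<le> real k)) = (\<Sum>j\<in>{1..<k}. a j * of_bool (\<bar>a j\<bar> > real k))"
        unfolding sum_subtractf[symmetric] by (intro sum.cong) auto
      also have "\<bar>\<dots>\<bar> \<le> (\<Sum>j\<in>{1..<k}. \<bar>a j * of_bool (\<bar>a j\<bar> > real k)\<bar>)" by (rule sum_abs)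
      also have "\<dots> \<le> (\<Sum>j\<in>{1..<k}. if j < K then \<bar>a j\<bar> else 0)"
      proof (intro sum_mono)
        fix j assume j: "j \<in> {1..<k}"
        show "\<bar>a j * of_bool (\<bar>a j\<bar> > real k)\<bar> \<le> (if j < K then \<bar>a j\<bar> else 0)"
          using K[of j] j by (auto simp: abs_mult not_less)
      qed
      also have "\<dots> = (\<Sum>j\<in>{1..<k} \<inter> {..<K}. \<bar>a j\<bar>)" by (simp add: sum.inter_restrict)
      also have "\<dots> \<le> C" unfolding C_def by (intro sum_mono2) auto
      finally show ?thesis .
    qed
    have C0: "0 \<le> C" by (simp add: C_def sum_nonneg)
    have l1: "(\<lambda>k. (1 - p) * \<bar>\<mu> k - m\<bar> + p * (C / real (k - 1))) \<longlonglongrightarrow> (1 - p) * \<bar>m - m\<bar> + p * 0"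
    proof (intro tendsto_intros \<mu>)
      show "(\<lambda>k. C / real (k - 1)) \<longlonglongrightarrow> 0"
        by (rule LIMSEQ_imp_Suc) (simp, real_asymp)
    qed
    show ?thesis
    proof (rule Lim_null_comparison)
      show "(\<lambda>k. (1 - p) * \<bar>\<mu> k - m\<bar> + p * (C / real (k - 1))) \<longlonglongrightarrow> 0" using l1 by simp
      show "eventually (\<lambda>k. norm (y k - x k) \<le> (1 - p) * \<bar>\<mu> k - m\<bar> + p * (C / real (k - 1))) sequentially"
        using eventually_ge_at_top[of "max 2 K"]
      proof eventually_elim
        case (elim k)
        let ?B = "\<Sum>j\<in>{1..<k}. a j * of_bool (\<bar>a j\<bar> \<le> real k)" and ?T = "\<Sum>j\<in>{1..<k}. a j"
        have k: "0 < real (k - 1)" using elim by simp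
        have iv: "{1..k - 1} = {1..<k}" using elim by auto
        have "y k - x k = (1 - p) * (\<mu> k - m) - p * t * (A (k - 1) - ?B / real (k - 1))"
          using elim K[of k] by (simp add: y_def x_def sum_distrib_left[symmetric] algebra_simps)
        also have "A (k - 1) - ?B / real (k - 1) = (?T - ?B) / real (k - 1)"
          unfolding A_def iv by (simp add: diff_divide_distrib)
        finally have "norm (y k - x k) \<le> \<bar>(1 - p) * (\<mu> k - m)\<bar> + \<bar>p * t * ((?T - ?B) / real (k - 1))\<bar>"
          using abs_triangle_ineq4[of "(1 - p) * (\<mu> k - m)" "p * t * ((?T - ?B) / real (k - 1))"] by (simp only: real_norm_def)
        also have "\<dots> = (1 - p) * \<bar>\<mu> k - m\<bar> + p * (\<bar>?T - ?B\<bar> / real (k - 1))"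
          using p t by (simp add: abs_mult)
        also have "\<dots> \<le> (1 - p) * \<bar>\<mu> k - m\<bar> + p * (C / real (k - 1))"
          using diff[of k] p k by (intro add_left_mono mult_left_mono divide_right_mono) auto
        finally show ?case .
      qed
    qed
  qed
  have ylim: "(\<lambda>n. (\<Sum>k<n. y k) / real n) \<longlonglongrightarrow> 0"
  proof -
    have "(\<lambda>n. (\<Sum>k<n. x k) / real n + (\<Sum>k<n. y k - x k) / real n) \<longlonglongrightarrow> 0 + 0"
      by (rule tendsto_add[OF lim[folded x_def] cesaro_null[OF yx]])
    moreover have "(\<Sum>k<n. x k) / real n + (\<Sum>k<n. y k - x k) / real n = (\<Sum>k<n. y k) / real n" for n
      unfolding add_divide_distrib[symmetric] sum.distrib[symmetric] by simp
    ultimately show ?thesis by simp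
  qed
  define b where "b n = \<bar>A n - m'\<bar>" for n
  \<comment> \<open>The average in \<open>averaging_contraction\<close> starts at index 0, the
    recursion for \<open>A\<close> at 1; the terms with \<open>A 0\<close> make up the
    difference.\<close>
  define e where "e n = \<bar>(a 1 - m' + p * t * (A 0 - m')) / real n + (\<Sum>k<Suc n. y k) / real n\<bar> + 2 * \<bar>p * (A 0 - m')\<bar> / real n" for n
  have "b \<longlonglongrightarrow> 0"
  proof (rule averaging_contraction[OF _ _ _ p])
    show "0 \<le> b n" for n by (simp add: b_def)
    have "(\<lambda>n. (\<Sum>k<Suc n. y k) / real (Suc n) * (real (Suc n) / real n)) \<longlonglongrightarrow> 0 * 1"
      by (intro tendsto_mult LIMSEQ_Suc[OF ylim]) real_asymp
    then have l2: "(\<lambda>n. (\<Sum>k<Suc n. y k) / real n) \<longlonglongrightarrow> 0" by (simp del: of_nat_Suc)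
    have l3: "(\<lambda>n. c / real n) \<longlonglongrightarrow> 0" for c :: real by real_asymp
    have "e \<longlonglongrightarrow> \<bar>0 + 0\<bar> + 0" unfolding e_def by (intro tendsto_intros l2 l3)
    then show "e \<longlonglongrightarrow> 0" by simp
    fix n :: nat assume n: "1 \<le> n"
    \<comment> \<open>The one-step recursions added up: \<open>y\<close> enters up to index
      \<open>n\<close>, the averages only up to \<open>n - 1\<close>.\<close>
    have key: "real n * (A n - m') = a 1 - m' + (\<Sum>k<Suc n. y k) + p * t * (\<Sum>k=1..<n. A k - m')"
      using n
    proof (induction n rule: dec_induct)
      case base
      have "{..<Suc 1} = {0, 1::nat}" by auto
      then show ?case by (simp add: A_def y_def)
    next
      case (step n)
      have "real (Suc n) * A (Suc n) = real n * A n + a (Suc n)"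
        using step by (simp add: A_def del: of_nat_Suc)
      moreover have "y (Suc n) = a (Suc n) - (1 - p) * m - p * t * A n" using step by (simp add: y_def)
      moreover have "(\<Sum>k<Suc (Suc n). y k) = (\<Sum>k<Suc n. y k) + y (Suc n)" by simp
      moreover have S: "(\<Sum>k=1..<Suc n. A k - m') = (\<Sum>k=1..<n. A k - m') + (A n - m')" using step by simp
      moreover have "real (Suc n) * (A (Suc n) - m') = real (Suc n) * A (Suc n) - real n * m' - m'" by (simp add: algebra_simps)
      moreover have "real n * (A n - m') = real n * A n - real n * m'" by (simp add: algebra_simps)
      moreover have "p * t * (\<Sum>k=1..<Suc n. A k - m') = p * t * (\<Sum>k=1..<n. A k - m') + p * t * A n - p * t * m'"
        unfolding S by (simp add: algebra_simps)
      ultimately show ?case using step.IH m' by linarith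
    qed
    have sp: "(\<Sum>k<n. A k - m') = (A 0 - m') + (\<Sum>k=1..<n. A k - m')"
      using n sum.atLeastLessThan_concat[of 0 1 n "\<lambda>k. A k - m'"] by (simp add: atLeast0LessThan)
    have "A n - m' = (a 1 - m' + (\<Sum>k<Suc n. y k) + p * t * (\<Sum>k=1..<n. A k - m')) / real n"
      using key n by (simp add: field_simps)
    also have "p * t * (\<Sum>k=1..<n. A k - m') = p * t * (\<Sum>k<n. A k - m') - p * t * (A 0 - m')"
      unfolding sp by (simp add: algebra_simps)
    finally have E: "A n - m' = (a 1 - m' + p * t * (A 0 - m')) / real n + (\<Sum>k<Suc n. y k) / real n
        - 2 * (p * t * (A 0 - m')) / real n + p * t * (\<Sum>k<n. A k - m') / real n"
      by (simp add: add_divide_distrib diff_divide_distrib)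
    have "\<bar>u - v + w\<bar> \<le> \<bar>u\<bar> + \<bar>v\<bar> + \<bar>w\<bar>" for u v w :: real by linarith
    then have "b n \<le> \<bar>(a 1 - m' + p * t * (A 0 - m')) / real n + (\<Sum>k<Suc n. y k) / real n\<bar>
        + \<bar>2 * (p * t * (A 0 - m')) / real n\<bar> + \<bar>p * t * (\<Sum>k<n. A k - m') / real n\<bar>"
      unfolding b_def E by blast
    also have "\<bar>2 * (p * t * (A 0 - m')) / real n\<bar> = 2 * \<bar>p * (A 0 - m')\<bar> / real n"
      using t by (simp add: abs_mult)
    also have "\<bar>p * t * (\<Sum>k<n. A k - m') / real n\<bar> = p / real n * \<bar>\<Sum>k<n. A k - m'\<bar>"
      using t p by (simp add: abs_mult)
    also have "\<dots> \<le> p / real n * (\<Sum>k<n. b k)"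
      unfolding b_def using p by (intro mult_left_mono sum_abs) auto
    finally show "b n \<le> p / real n * (\<Sum>k<n. b k) + e n" unfolding e_def by linarith
  qed
  then have "(\<lambda>n. A n - m') \<longlonglongrightarrow> 0" unfolding b_def by (rule tendsto_rabs_zero_cancel)
  then have "A \<longlonglongrightarrow> m'" by (rule LIM_zero_cancel)
  then show ?thesis unfolding A_def m'_def .
qed

context signed_reinforcement
begin

text \<open>A conditional variance is at most the conditional second moment, whose mean is that of
  \<open>X 1\<close> by \<open>invariant_law\<close>.\<close>

lemma innov_second_moment:
  assumes n: "2 \<le> n" and \<phi>[measurable]: "\<phi> \<in> borel_measurable borel" and C: "\<And>x. \<bar>\<phi> x\<bar> \<le> C"
    and inv: "\<And>x. (\<phi> (s * x))\<^sup>2 = (\<phi> x)\<^sup>2"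
  shows "expectation (\<lambda>\<omega>. (innov n \<phi> \<omega>)\<^sup>2) \<le> expectation (\<lambda>\<omega>. (\<phi> (X 1 \<omega>))\<^sup>2)"
proof -
  have C0: "0 \<le> C" using C[of 0] by linarith
  have C2: "\<bar>(\<phi> x)\<^sup>2\<bar> \<le> C\<^sup>2" for x using C[of x] C0 abs_le_square_iff[of "\<phi> x" C] by simp
  have [measurable]: "cexp n \<phi> \<in> borel_measurable M" by (rule meas_F[OF cexp_meas_F[OF \<phi>]])
  have [measurable]: "cexp n (\<lambda>x. (\<phi> x)\<^sup>2) \<in> borel_measurable M" by (rule meas_F[OF cexp_meas_F]) measurable
  have i: "integrable M (\<lambda>\<omega>. (\<phi> (X 1 \<omega>))\<^sup>2)" "\<And>j. j \<in> {1..<n} \<Longrightarrow> integrable M (\<lambda>\<omega>. (\<phi> (s * Y j \<omega>))\<^sup>2)"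
    using C2 X_rv[of 1] Y_meas by (auto intro!: integrable_const_bound[of _ "C\<^sup>2"])
  have ce2: "\<bar>(cexp n \<phi> \<omega>)\<^sup>2\<bar> \<le> C\<^sup>2" for \<omega>
    using cexp_bound[OF n \<phi> C, of \<omega>] C0 abs_le_square_iff[of "cexp n \<phi> \<omega>" C] by simp
  have ceB: "\<bar>cexp n (\<lambda>x. (\<phi> x)\<^sup>2) \<omega>\<bar> \<le> C\<^sup>2" for \<omega> by (rule cexp_bound[OF n _ C2]) measurable
  have j: "integrable M (cexp n (\<lambda>x. (\<phi> x)\<^sup>2))" "integrable M (\<lambda>\<omega>. (cexp n \<phi> \<omega>)\<^sup>2)"
    using ce2 ceB by (auto intro!: integrable_const_bound[of _ "C\<^sup>2"])
  have "expectation (\<lambda>\<omega>. (innov n \<phi> \<omega>)\<^sup>2) = expectation (\<lambda>\<omega>. cexp n (\<lambda>x. (\<phi> x)\<^sup>2) \<omega> - (cexp n \<phi> \<omega>)\<^sup>2)"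
    using innov_variance[OF n \<phi> C, of "\<lambda>_. 1" 1] by simp
  also have "\<dots> \<le> expectation (cexp n (\<lambda>x. (\<phi> x)\<^sup>2))"
    using j by (intro integral_mono) auto
  also have "\<dots> = expectation (\<lambda>\<omega>. (\<phi> (Y n \<omega>))\<^sup>2)"
    using conditional_step(1)[OF n _ i, of "\<lambda>_. 1" 1] by simp
  also have "\<dots> = expectation (\<lambda>\<omega>. (\<phi> (X 1 \<omega>))\<^sup>2)"
    using invariant_law[of "\<lambda>x. (\<phi> x)\<^sup>2" n] inv i(1) n by simp
  finally show ?thesis .
qed

lemma X1_meas [measurable]: "X 1 \<in> borel_measurable M" "X (Suc 0) \<in> borel_measurable M"
  using X_rv[of 1] by simp_all

text \<open>Truncate step \<open>k\<close> at level \<open>k\<close>: the variances are summable by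
  \<open>sum_inverse_square_tail\<close>, and only finitely many truncations act by Borel-Cantelli,
  both because the steps have the law of \<open>X 1\<close> up to sign. Here \<open>t\<close> is the
  parity of \<open>g\<close>, and the limit is the fixed point of averaging fresh values and copies
  with weights \<open>1 - p\<close> and \<open>p * t\<close>.\<close>

lemma lln_steps:
  assumes g[measurable]: "g \<in> borel_measurable borel" and int: "integrable M (\<lambda>\<omega>. g (X 1 \<omega>) :: real)"
    and t: "\<bar>t\<bar> = 1" and gs: "\<And>x. g (s * x) = t * g x"
  shows "AE \<omega> in M. (\<lambda>n. (\<Sum>j=1..n. g (Y j \<omega>)) / real n) \<longlonglongrightarrow> (1 - p) * expectation (\<lambda>\<omega>. g (X 1 \<omega>)) / (1 - p * t)"
proof -
  define tr where "tr k x = g x * of_bool (\<bar>g x\<bar> \<le> real k)" for k :: nat and x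
  have [measurable]: "tr k \<in> borel_measurable borel" for k unfolding tr_def[abs_def] of_bool_def by measurable
  have trB: "\<bar>tr k x\<bar> \<le> real k" for k x by (simp add: tr_def)
  have ags: "\<bar>g (s * x)\<bar> = \<bar>g x\<bar>" for x using t by (simp add: gs abs_mult)
  have trs: "tr k (s * x) = t * tr k x" for k x unfolding tr_def ags by (simp add: gs)
  have tr2: "(tr k (s * x))\<^sup>2 = (tr k x)\<^sup>2" for k x
    unfolding trs power_mult_distrib using t by (metis mult_1 one_power2 power2_abs)
  have aint: "integrable M (\<lambda>\<omega>. \<bar>g (X 1 \<omega>)\<bar>)" using int by (rule integrable_abs)
  define \<xi> where "\<xi> k = (if 2 \<le> k then innov k (tr k) else (\<lambda>_. 0))" for k
  have tr_lim: "(\<lambda>k. expectation (\<lambda>\<omega>. tr k (X 1 \<omega>))) \<longlonglongrightarrow> expectation (\<lambda>\<omega>. g (X 1 \<omega>))"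
  proof (rule integral_dominated_convergence[where w="\<lambda>\<omega>. \<bar>g (X 1 \<omega>)\<bar>"])
    show "AE \<omega> in M. (\<lambda>k. tr k (X 1 \<omega>)) \<longlonglongrightarrow> g (X 1 \<omega>)"
    proof (rule AE_I2)
      fix \<omega>
      obtain K where "\<bar>g (X 1 \<omega>)\<bar> \<le> real K" using real_arch_simple by blast
      then have "eventually (\<lambda>k. tr k (X 1 \<omega>) = g (X 1 \<omega>)) sequentially"
        using eventually_ge_at_top[of K] by (elim eventually_mono) (auto simp: tr_def)
      then show "(\<lambda>k. tr k (X 1 \<omega>)) \<longlonglongrightarrow> g (X 1 \<omega>)" by (rule tendsto_eventually)
    qed
    show "AE \<omega> in M. norm (tr k (X 1 \<omega>)) \<le> \<bar>g (X 1 \<omega>)\<bar>" for k by (simp add: tr_def)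
  qed (use aint in auto)
  have "AE \<omega> in M. (\<lambda>n. (\<Sum>k<n. \<xi> k \<omega>) / real n) \<longlonglongrightarrow> 0"
  proof (rule lln_mds)
    show "\<xi> k \<in> borel_measurable (F (Suc k))" for k
      unfolding \<xi>_def by (auto intro!: innov_meas_F)
    show "\<bar>\<xi> k \<omega>\<bar> \<le> 2 * real k" for k \<omega>
      unfolding \<xi>_def using innov_bound[of k "tr k" "real k" \<omega>] trB by auto
    show "expectation (\<lambda>\<omega>. H \<omega> * \<xi> k \<omega>) = 0" if "H \<in> borel_measurable (F k)" "\<And>\<omega>. \<omega> \<in> space M \<Longrightarrow> \<bar>H \<omega>\<bar> \<le> B" for k H B
      unfolding \<xi>_def using innov_centered[of k "tr k" "real k" H B] trB that by auto
    let ?v = "\<lambda>k. expectation (\<lambda>\<omega>. (tr k (X 1 \<omega>))\<^sup>2)"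
    have tr_int: "integrable M (\<lambda>\<omega>. (tr k (X 1 \<omega>))\<^sup>2 / (real (Suc k))\<^sup>2)" for k
    proof (intro Bochner_Integration.integrable_divide integrable_const_bound[of _ "(real k)\<^sup>2"] AE_I2)
      show "norm ((tr k (X 1 \<omega>))\<^sup>2) \<le> (real k)\<^sup>2" for \<omega>
        using trB[of k "X 1 \<omega>"] abs_le_square_iff[of "tr k (X 1 \<omega>)" "real k"] by simp
    qed measurable
    have "summable (\<lambda>k. ?v k / (real (Suc k))\<^sup>2)"
    proof (rule summableI_nonneg_bounded[where x="expectation (\<lambda>\<omega>. \<bar>g (X 1 \<omega>)\<bar>)"])
      show "0 \<le> ?v k / (real (Suc k))\<^sup>2" for k by (intro divide_nonneg_nonneg Bochner_Integration.integral_nonneg_AE AE_I2) auto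
      fix n
      have "(\<Sum>k<n. ?v k / (real (Suc k))\<^sup>2) = (\<Sum>k<n. expectation (\<lambda>\<omega>. (tr k (X 1 \<omega>))\<^sup>2 / (real (Suc k))\<^sup>2))" by simp
      also have "\<dots> = expectation (\<lambda>\<omega>. \<Sum>k<n. (tr k (X 1 \<omega>))\<^sup>2 / (real (Suc k))\<^sup>2)"
        by (rule Bochner_Integration.integral_sum[symmetric]) (rule tr_int)
      also have "\<dots> \<le> expectation (\<lambda>\<omega>. \<bar>g (X 1 \<omega>)\<bar>)"
      proof (rule integral_mono[OF Bochner_Integration.integrable_sum[OF tr_int] aint])
        fix \<omega>
        have "(\<Sum>k<n. (tr k (X 1 \<omega>))\<^sup>2 / (real (Suc k))\<^sup>2) = (\<Sum>k<n. \<bar>g (X 1 \<omega>)\<bar>\<^sup>2 * of_bool (\<bar>g (X 1 \<omega>)\<bar> \<le> real k) / (real (Suc k))\<^sup>2)"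
          by (intro sum.cong) (auto simp: tr_def)
        then show "(\<Sum>k<n. (tr k (X 1 \<omega>))\<^sup>2 / (real (Suc k))\<^sup>2) \<le> \<bar>g (X 1 \<omega>)\<bar>"
          using sum_inverse_square_tail[of "\<bar>g (X 1 \<omega>)\<bar>" n] by simp
      qed
      finally show "(\<Sum>k<n. ?v k / (real (Suc k))\<^sup>2) \<le> expectation (\<lambda>\<omega>. \<bar>g (X 1 \<omega>)\<bar>)" .
    qed
    then show "summable (\<lambda>k. expectation (\<lambda>\<omega>. (\<xi> k \<omega>)\<^sup>2) / (real (Suc k))\<^sup>2)"
    proof (rule summable_comparison_test_ev[rotated])
      show "eventually (\<lambda>k. norm (expectation (\<lambda>\<omega>. (\<xi> k \<omega>)\<^sup>2) / (real (Suc k))\<^sup>2) \<le> ?v k / (real (Suc k))\<^sup>2) sequentially"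
        using eventually_ge_at_top[of 2]
      proof eventually_elim
        case (elim k)
        have "expectation (\<lambda>\<omega>. (\<xi> k \<omega>)\<^sup>2) \<le> ?v k"
          using innov_second_moment[of k "tr k" "real k"] elim trB tr2 by (simp add: \<xi>_def)
        moreover have "0 \<le> expectation (\<lambda>\<omega>. (\<xi> k \<omega>)\<^sup>2)" by (intro Bochner_Integration.integral_nonneg_AE AE_I2) auto
        ultimately show ?case by (simp add: divide_right_mono)
      qed
    qed
  qed
  moreover have "AE \<omega> in M. eventually (\<lambda>k. \<bar>g (Y k \<omega>)\<bar> \<le> real k) sequentially"
  proof -
    define A where "A k = {\<omega>\<in>space M. 1 \<le> k \<and> real k < \<bar>g (Y k \<omega>)\<bar>}" for k
    have A_meas[measurable]: "A k \<in> events" for k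
    proof (cases "1 \<le> k")
      case True
      then have [measurable]: "Y k \<in> borel_measurable M" by (rule Y_meas)
      show ?thesis unfolding A_def by measurable
    qed (simp add: A_def)
    have bint: "integrable M (\<lambda>\<omega>. of_bool (real k < \<bar>g (X 1 \<omega>)\<bar>) :: real)" for k
      by (rule integrable_const_bound[of _ 1]) (auto simp: of_bool_def)
    have PA: "prob (A k) \<le> expectation (\<lambda>\<omega>. of_bool (real k < \<bar>g (X 1 \<omega>)\<bar>))" for k
    proof (cases "1 \<le> k")
      case True
      have "prob (A k) = expectation (indicator (A k))" by simp
      also have "\<dots> = expectation (\<lambda>\<omega>. of_bool (real k < \<bar>g (Y k \<omega>)\<bar>))"
        using True by (intro Bochner_Integration.integral_cong) (auto simp: A_def)
      also have "\<dots> = expectation (\<lambda>\<omega>. of_bool (real k < \<bar>g (X 1 \<omega>)\<bar>))"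
        using invariant_law[of "\<lambda>x. of_bool (real k < \<bar>g x\<bar>)" k] True bint by (simp add: ags of_bool_def)
      finally show ?thesis by simp
    next
      case False
      then show ?thesis by (auto simp: A_def intro!: Bochner_Integration.integral_nonneg_AE AE_I2)
    qed
    have "summable (\<lambda>k. prob (A k))"
    proof (rule summableI_nonneg_bounded[where x="expectation (\<lambda>\<omega>. \<bar>g (X 1 \<omega>)\<bar> + 1)"])
      fix n
      have "(\<Sum>k<n. prob (A k)) \<le> (\<Sum>k<n. expectation (\<lambda>\<omega>. of_bool (real k < \<bar>g (X 1 \<omega>)\<bar>)))"
        by (intro sum_mono PA)
      also have "\<dots> = expectation (\<lambda>\<omega>. \<Sum>k<n. of_bool (real k < \<bar>g (X 1 \<omega>)\<bar>))"
        by (rule Bochner_Integration.integral_sum[symmetric]) (rule bint)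
      also have "\<dots> \<le> expectation (\<lambda>\<omega>. \<bar>g (X 1 \<omega>)\<bar> + 1)"
      proof (rule integral_mono[OF Bochner_Integration.integrable_sum[OF bint]])
        show "integrable M (\<lambda>\<omega>. \<bar>g (X 1 \<omega>)\<bar> + 1)" using aint by simp
        show "(\<Sum>k<n. of_bool (real k < \<bar>g (X 1 \<omega>)\<bar>)) \<le> \<bar>g (X 1 \<omega>)\<bar> + 1" for \<omega>
          by (rule sum_indicator_less) simp
      qed
      finally show "(\<Sum>k<n. prob (A k)) \<le> expectation (\<lambda>\<omega>. \<bar>g (X 1 \<omega>)\<bar> + 1)" .
    qed simp
    then have "AE \<omega> in M. eventually (\<lambda>k. \<omega> \<in> space M - A k) sequentially"
      by (intro borel_cantelli_AE1) (auto simp: emeasure_eq_measure)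
    then show ?thesis
    proof eventually_elim
      case (elim \<omega>)
      then show ?case using eventually_ge_at_top[of 1]
        by eventually_elim (auto simp: A_def not_less)
    qed
  qed
  ultimately show ?thesis
  proof eventually_elim
    case (elim \<omega>)
    show ?case
    proof (rule reinforced_average[OF elim(2) _ tr_lim _ p(2) t])
      have "\<xi> k \<omega> = (if 2 \<le> k then g (Y k \<omega>) * of_bool (\<bar>g (Y k \<omega>)\<bar> \<le> real k)
        - ((1 - p) * expectation (\<lambda>\<omega>. tr k (X 1 \<omega>)) + p / real (k - 1) * (\<Sum>j\<in>{1..<k}. t * (g (Y j \<omega>) * of_bool (\<bar>g (Y j \<omega>)\<bar> \<le> real k)))) else 0)" for k
        unfolding \<xi>_def innov_def cexp_def trs by (simp add: tr_def)
      then show "(\<lambda>n. (\<Sum>k<n. if 2 \<le> k then g (Y k \<omega>) * of_bool (\<bar>g (Y k \<omega>)\<bar> \<le> real k)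
        - ((1 - p) * expectation (\<lambda>\<omega>. tr k (X 1 \<omega>)) + p / real (k - 1) * (\<Sum>j\<in>{1..<k}. t * (g (Y j \<omega>) * of_bool (\<bar>g (Y j \<omega>)\<bar> \<le> real k)))) else 0) / real n) \<longlonglongrightarrow> 0"
        using elim(1) by simp
    qed (use p in simp)
  qed
qed

section \<open>The drift and the truncated conditional moments\<close>

definition \<mu> :: real where "\<mu> = (1 - p) * expectation (X 1) / (1 - p * s)"
definition m2 :: real where "m2 = expectation (\<lambda>\<omega>. (X 1 \<omega>)\<^sup>2)"

lemma ps_less: "p * s < 1" using s p by auto

lemma ps_greater: "- 1 < p * s" using s p by auto

text \<open>\<open>\<mu>\<close> is the average at which the next step has the same conditional
  mean. It is the mean of \<open>X 1\<close> for \<open>s = 1\<close> and the \<open>\<mu>'\<close>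
  of the theorem for \<open>s = - 1\<close>.\<close>

lemma \<mu>_eq: "(1 - p) * expectation (X 1) + p * s * \<mu> = \<mu>"
  using ps_less by (simp add: \<mu>_def field_simps)

lemma integrable_X1: "integrable M (X 1)"
proof (rule Bochner_Integration.integrable_bound[of M "\<lambda>\<omega>. 1 + (X 1 \<omega>)\<^sup>2"])
  show "integrable M (\<lambda>\<omega>. 1 + (X 1 \<omega>)\<^sup>2)" using X_square by simp
  have "\<bar>x\<bar> \<le> \<bar>1 + x\<^sup>2\<bar>" for x :: real
  proof (cases "\<bar>x\<bar> \<le> 1")
    case False
    then have "\<bar>x\<bar> * 1 \<le> \<bar>x\<bar> * \<bar>x\<bar>" by (intro mult_left_mono) auto
    then show ?thesis by (simp add: power2_eq_square)
  qed (simp add: add_increasing2)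
  then show "AE \<omega> in M. norm (X 1 \<omega>) \<le> norm (1 + (X 1 \<omega>)\<^sup>2)" by simp
qed simp

definition trunc :: "real \<Rightarrow> real \<Rightarrow> real" where "trunc b x = x * of_bool (\<bar>x\<bar> \<le> b)"
definition excess :: "real \<Rightarrow> real \<Rightarrow> real" where "excess b x = x * of_bool (b < \<bar>x\<bar>)"

lemma trunc_meas [measurable]: "trunc b \<in> borel_measurable borel"
  unfolding trunc_def[abs_def] of_bool_def by measurable

lemma excess_meas [measurable]: "excess b \<in> borel_measurable borel"
  unfolding excess_def[abs_def] of_bool_def by measurable

lemma trunc_plus_excess: "trunc b x + excess b x = x"
  by (auto simp: trunc_def excess_def)

lemma abs_s: "\<bar>s\<bar> = 1" using s by auto

lemma trunc_s: "trunc b (s * x) = s * trunc b x"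
  by (simp add: trunc_def abs_mult abs_s)

lemma excess_s: "excess b (s * x) = s * excess b x"
  by (simp add: excess_def abs_mult abs_s)

lemma trunc_bound: "0 \<le> b \<Longrightarrow> \<bar>trunc b x\<bar> \<le> b"
  by (simp add: trunc_def)

lemma s_square: "(s * x)\<^sup>2 = x\<^sup>2"
  using s by auto

text \<open>The strong law is available for fixed levels only. It is used simultaneously for all
  integer levels \<open>K\<close>; once \<open>b k \<ge> K\<close> the excess over
  \<open>b k\<close> is dominated by the excess over \<open>K\<close>, whose limiting mean is small
  for large \<open>K\<close>.\<close>

lemma tail_average_null:
  assumes b: "filterlim b at_top sequentially"
  shows "AE \<omega> in M. (\<lambda>k. (\<Sum>j\<in>{1..<k}. (excess (b k) (Y j \<omega>))\<^sup>2) / real (k - 1)) \<longlonglongrightarrow> 0"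
proof -
  have int: "integrable M (\<lambda>\<omega>. (excess (real K) (X 1 \<omega>))\<^sup>2)" for K
    by (rule Bochner_Integration.integrable_bound[OF X_square]) (auto simp: excess_def)
  have "AE \<omega> in M. (\<lambda>n. (\<Sum>j=1..n. (excess (real K) (Y j \<omega>))\<^sup>2) / real n) \<longlonglongrightarrow> expectation (\<lambda>\<omega>. (excess (real K) (X 1 \<omega>))\<^sup>2)" for K
    using lln_steps[of "\<lambda>x. (excess (real K) x)\<^sup>2" 1] int[of K] p by (simp add: excess_s s_square)
  then have "AE \<omega> in M. \<forall>K. (\<lambda>n. (\<Sum>j=1..n. (excess (real K) (Y j \<omega>))\<^sup>2) / real n) \<longlonglongrightarrow> expectation (\<lambda>\<omega>. (excess (real K) (X 1 \<omega>))\<^sup>2)"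
    by (simp add: AE_all_countable)
  then show ?thesis
  proof eventually_elim
    case (elim \<omega>)
    have lim0: "(\<lambda>K. expectation (\<lambda>\<omega>. (excess (real K) (X 1 \<omega>))\<^sup>2)) \<longlonglongrightarrow> expectation (\<lambda>\<omega>. 0)"
    proof (rule integral_dominated_convergence[OF _ _ X_square])
      show "AE \<omega> in M. (\<lambda>K. (excess (real K) (X 1 \<omega>))\<^sup>2) \<longlonglongrightarrow> 0"
      proof (rule AE_I2)
        fix \<omega>
        obtain K where "\<bar>X 1 \<omega>\<bar> \<le> real K" using real_arch_simple by blast
        then have "eventually (\<lambda>k. (excess (real k) (X 1 \<omega>))\<^sup>2 = 0) sequentially"
          using eventually_ge_at_top[of K] by (elim eventually_mono) (auto simp: excess_def)
        then show "(\<lambda>K. (excess (real K) (X 1 \<omega>))\<^sup>2) \<longlonglongrightarrow> 0" by (rule tendsto_eventually)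
      qed
      show "AE \<omega> in M. norm ((excess (real K) (X 1 \<omega>))\<^sup>2) \<le> (X 1 \<omega>)\<^sup>2" for K by (simp add: excess_def)
    qed auto
    show ?case
    proof (rule LIMSEQ_I)
      fix e :: real assume e: "0 < e"
      have "eventually (\<lambda>K. expectation (\<lambda>\<omega>. (excess (real K) (X 1 \<omega>))\<^sup>2) < e) sequentially"
        using order_tendstoD(2)[OF lim0] e by simp
      then obtain K where K: "expectation (\<lambda>\<omega>. (excess (real K) (X 1 \<omega>))\<^sup>2) < e" by (auto simp: eventually_sequentially)
      have "eventually (\<lambda>n. (\<Sum>j=1..n. (excess (real K) (Y j \<omega>))\<^sup>2) / real n < e) sequentially"
        using order_tendstoD(2)[OF elim[rule_format] K] .
      then have "eventually (\<lambda>n. (\<Sum>j=1..n - 1. (excess (real K) (Y j \<omega>))\<^sup>2) / real (n - 1) < e) sequentially"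
        by (rule eventually_compose_filterlim) (rule filterlim_minus_const_nat_at_top)
      moreover have "eventually (\<lambda>n. b n \<ge> real K) sequentially" using b by (auto simp: filterlim_at_top)
      ultimately have "eventually (\<lambda>k. norm ((\<Sum>j\<in>{1..<k}. (excess (b k) (Y j \<omega>))\<^sup>2) / real (k - 1) - 0) < e) sequentially"
        using eventually_ge_at_top[of 2]
      proof eventually_elim
        case (elim k)
        have iv: "{1..k - 1} = {1..<k}" using elim by auto
        have "(\<Sum>j\<in>{1..<k}. (excess (b k) (Y j \<omega>))\<^sup>2) \<le> (\<Sum>j\<in>{1..<k}. (excess (real K) (Y j \<omega>))\<^sup>2)"
          using elim by (intro sum_mono) (auto simp: excess_def)
        then have "(\<Sum>j\<in>{1..<k}. (excess (b k) (Y j \<omega>))\<^sup>2) / real (k - 1) \<le> (\<Sum>j\<in>{1..<k}. (excess (real K) (Y j \<omega>))\<^sup>2) / real (k - 1)"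
          by (intro divide_right_mono) auto
        also have "\<dots> < e" using elim(1) unfolding iv .
        finally show ?case by (simp add: sum_nonneg)
      qed
      then show "\<exists>N. \<forall>k\<ge>N. norm ((\<Sum>j\<in>{1..<k}. (excess (b k) (Y j \<omega>))\<^sup>2) / real (k - 1) - 0) < e"
        by (simp add: eventually_sequentially)
    qed
  qed
qed

text \<open>The averages of the untruncated steps converge by the strong law, the averages of the
  excesses vanish, and the expectations of the truncated innovations converge by dominated
  convergence.\<close>

lemma truncated_averages:
  assumes b: "filterlim b at_top sequentially"
  shows "AE \<omega> in M. (\<lambda>k. cexp k (trunc (b k)) \<omega>) \<longlonglongrightarrow> \<mu> \<and> (\<lambda>k. cexp k (\<lambda>x. (trunc (b k) x)\<^sup>2) \<omega>) \<longlonglongrightarrow> m2"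
proof -
  have trX: "AE \<omega> in M. eventually (\<lambda>k. trunc (b k) (X 1 \<omega>) = X 1 \<omega>) sequentially"
  proof (rule AE_I2)
    fix \<omega>
    have "eventually (\<lambda>k. b k \<ge> \<bar>X 1 \<omega>\<bar>) sequentially" using b by (auto simp: filterlim_at_top)
    then show "eventually (\<lambda>k. trunc (b k) (X 1 \<omega>) = X 1 \<omega>) sequentially" by eventually_elim (simp add: trunc_def)
  qed
  have E1: "(\<lambda>k. expectation (\<lambda>\<omega>. trunc (b k) (X 1 \<omega>))) \<longlonglongrightarrow> expectation (X 1)"
  proof (rule integral_dominated_convergence[OF _ _ integrable_abs[OF integrable_X1]])
    show "AE \<omega> in M. (\<lambda>k. trunc (b k) (X 1 \<omega>)) \<longlonglongrightarrow> X 1 \<omega>" using trX by eventually_elim (rule tendsto_eventually)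
    show "AE \<omega> in M. norm (trunc (b k) (X 1 \<omega>)) \<le> \<bar>X 1 \<omega>\<bar>" for k by (simp add: trunc_def)
  qed auto
  have E2: "(\<lambda>k. expectation (\<lambda>\<omega>. (trunc (b k) (X 1 \<omega>))\<^sup>2)) \<longlonglongrightarrow> m2"
    unfolding m2_def
  proof (rule integral_dominated_convergence[OF _ _ X_square])
    show "AE \<omega> in M. (\<lambda>k. (trunc (b k) (X 1 \<omega>))\<^sup>2) \<longlonglongrightarrow> (X 1 \<omega>)\<^sup>2"
      using trX by eventually_elim (rule tendsto_eventually, elim eventually_mono, simp)
    show "AE \<omega> in M. norm ((trunc (b k) (X 1 \<omega>))\<^sup>2) \<le> (X 1 \<omega>)\<^sup>2" for k by (simp add: trunc_def)
  qed auto
  have L1: "AE \<omega> in M. (\<lambda>n. (\<Sum>j=1..n. Y j \<omega>) / real n) \<longlonglongrightarrow> \<mu>"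
    using lln_steps[of "\<lambda>x. x" s] integrable_X1 abs_s by (simp add: \<mu>_def)
  have L2: "AE \<omega> in M. (\<lambda>n. (\<Sum>j=1..n. (Y j \<omega>)\<^sup>2) / real n) \<longlonglongrightarrow> m2"
    using lln_steps[of "\<lambda>x. x\<^sup>2" 1] X_square p by (simp add: m2_def s_square)
  show ?thesis using L1 L2 tail_average_null[OF b]
  proof eventually_elim
    case (elim \<omega>)
    have shift: "(\<lambda>k. f (k - 1)) \<longlonglongrightarrow> l" if "f \<longlonglongrightarrow> l" for f :: "nat \<Rightarrow> real" and l
      by (rule filterlim_compose[OF that filterlim_minus_const_nat_at_top])
    have iv: "{1..k - 1} = {1..<k}" for k :: nat by auto
    have A1: "(\<lambda>k. (\<Sum>j\<in>{1..<k}. Y j \<omega>) / real (k - 1)) \<longlonglongrightarrow> \<mu>" using shift[OF elim(1)] unfolding iv .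
    have A2: "(\<lambda>k. (\<Sum>j\<in>{1..<k}. (Y j \<omega>)\<^sup>2) / real (k - 1)) \<longlonglongrightarrow> m2" using shift[OF elim(2)] unfolding iv .
    \<comment> \<open>Once the level is at least 1, an excess is dominated by its own square, so the
      first moments follow from \<open>tail_average_null\<close>.\<close>
    have A3: "(\<lambda>k. (\<Sum>j\<in>{1..<k}. excess (b k) (Y j \<omega>)) / real (k - 1)) \<longlonglongrightarrow> 0"
    proof (rule Lim_null_comparison[OF _ elim(3)])
      have "eventually (\<lambda>k. b k \<ge> 1) sequentially" using b by (auto simp: filterlim_at_top)
      then show "eventually (\<lambda>k. norm ((\<Sum>j\<in>{1..<k}. excess (b k) (Y j \<omega>)) / real (k - 1)) \<le> (\<Sum>j\<in>{1..<k}. (excess (b k) (Y j \<omega>))\<^sup>2) / real (k - 1)) sequentially"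
      proof eventually_elim
        case (elim k)
        have le: "\<bar>excess (b k) x\<bar> \<le> (excess (b k) x)\<^sup>2" for x
        proof (cases "b k < \<bar>x\<bar>")
          case True
          then have "\<bar>x\<bar> * 1 \<le> \<bar>x\<bar> * \<bar>x\<bar>" using elim by (intro mult_left_mono) auto
          then show ?thesis using True by (simp add: excess_def power2_eq_square)
        qed (simp add: excess_def)
        have "\<bar>\<Sum>j\<in>{1..<k}. excess (b k) (Y j \<omega>)\<bar> \<le> (\<Sum>j\<in>{1..<k}. (excess (b k) (Y j \<omega>))\<^sup>2)"
          by (rule order_trans[OF sum_abs]) (intro sum_mono le)
        then show ?case by (simp add: divide_right_mono)
      qed
    qed
    have B1: "(\<lambda>k. (\<Sum>j\<in>{1..<k}. trunc (b k) (Y j \<omega>)) / real (k - 1)) \<longlonglongrightarrow> \<mu>"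
    proof -
      have "trunc (b k) (Y j \<omega>) = Y j \<omega> - excess (b k) (Y j \<omega>)" for k j
        using trunc_plus_excess[of "b k" "Y j \<omega>"] by linarith
      then show ?thesis using tendsto_diff[OF A1 A3] by (simp add: sum_subtractf diff_divide_distrib)
    qed
    have B2: "(\<lambda>k. (\<Sum>j\<in>{1..<k}. (trunc (b k) (Y j \<omega>))\<^sup>2) / real (k - 1)) \<longlonglongrightarrow> m2"
    proof -
      have "(trunc (b k) (Y j \<omega>))\<^sup>2 = (Y j \<omega>)\<^sup>2 - (excess (b k) (Y j \<omega>))\<^sup>2" for k j
        by (auto simp: trunc_def excess_def)
      then show ?thesis using tendsto_diff[OF A2 elim(3)] by (simp add: sum_subtractf diff_divide_distrib)
    qed
    have "(\<lambda>k. (1 - p) * expectation (\<lambda>\<omega>. trunc (b k) (X 1 \<omega>)) + p * s * ((\<Sum>j\<in>{1..<k}. trunc (b k) (Y j \<omega>)) / real (k - 1)))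
        \<longlonglongrightarrow> (1 - p) * expectation (X 1) + p * s * \<mu>"
      by (intro tendsto_intros E1 B1)
    then have c1: "(\<lambda>k. cexp k (trunc (b k)) \<omega>) \<longlonglongrightarrow> \<mu>"
      unfolding \<mu>_eq cexp_def trunc_s by (simp add: sum_distrib_left[symmetric] mult.assoc)
    have "(\<lambda>k. (1 - p) * expectation (\<lambda>\<omega>. (trunc (b k) (X 1 \<omega>))\<^sup>2) + p * ((\<Sum>j\<in>{1..<k}. (trunc (b k) (Y j \<omega>))\<^sup>2) / real (k - 1)))
        \<longlonglongrightarrow> (1 - p) * m2 + p * m2"
      by (intro tendsto_intros E2 B2)
    then have c2: "(\<lambda>k. cexp k (\<lambda>x. (trunc (b k) x)\<^sup>2) \<omega>) \<longlonglongrightarrow> m2"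
      unfolding cexp_def trunc_s s_square by (simp add: algebra_simps)
    show ?case using c1 c2 by blast
  qed
qed

end

section \<open>Truncated innovations\<close>

lemma LL_ge_1: "exp (exp 1) \<le> x \<Longrightarrow> 1 \<le> LL x"
proof -
  assume x: "exp (exp 1) \<le> x"
  then have "exp 1 \<le> ln x" by (metis exp_gt_zero exp_le_cancel_iff exp_ln less_le_trans)
  then have "ln (exp 1) \<le> ln (ln x)" by (intro ln_mono) auto
  then show ?thesis by (simp add: LL_def)
qed

text \<open>The derivative has the sign of \<open>LL z - 1 / ln z\<close>. The monotonicity carries
  the bound on the increment at time \<open>k\<close> to every later time, as the smallness
  condition of \<open>lil_upper\<close> and \<open>lil_lower\<close> demands.\<close>

lemma divide_LL_mono:
  assumes "exp (exp 1) \<le> x" "x \<le> y"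
  shows "x / LL x \<le> y / LL y"
proof (rule DERIV_nonneg_imp_nondecreasing[OF assms(2)])
  fix z assume z: "x \<le> z" "z \<le> y"
  then have ez: "exp (exp 1) \<le> z" using assms by simp
  have LLz: "1 \<le> LL z" by (rule LL_ge_1[OF ez])
  have z0: "0 < z" using ez exp_gt_zero[of "exp 1"] by linarith
  have "1 < exp (exp 1 :: real)" by simp
  then have z1: "1 < z" using ez by linarith
  have "exp 1 \<le> ln z" using ez by (metis exp_gt_zero exp_le_cancel_iff exp_ln less_le_trans)
  then have lnz: "1 \<le> ln z" using exp_ge_add_one_self[of 1] by linarith
  have d: "((\<lambda>z. z / LL z) has_real_derivative ((1 * LL z - z * (1 / z * (1 / ln z))) / (LL z * LL z))) (at z)"
    unfolding LL_def using z1 lnz LLz[unfolded LL_def]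
    by (auto intro!: derivative_eq_intros simp: field_simps)
  have "1 / ln z \<le> 1 / 1" using lnz by (intro divide_left_mono) auto
  then have "z * (1 / z * (1 / ln z)) \<le> 1" using z0 by simp
  then have "0 \<le> (1 * LL z - z * (1 / z * (1 / ln z))) / (LL z * LL z)" using LLz by (intro divide_nonneg_nonneg) auto
  then show "\<exists>D. ((\<lambda>z. z / LL z) has_real_derivative D) (at z) \<and> 0 \<le> D" using d by blast
qed

context prob_space
begin

lemma AE_summable_of_bounded_expectations:
  fixes x :: "nat \<Rightarrow> 'a \<Rightarrow> real"
  assumes int: "\<And>k. integrable M (x k)" and nonneg: "\<And>k \<omega>. \<omega> \<in> space M \<Longrightarrow> 0 \<le> x k \<omega>"
    and bound: "\<And>n. (\<Sum>k<n. expectation (x k)) \<le> B"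
  shows "AE \<omega> in M. summable (\<lambda>k. x k \<omega>)"
proof -
  have [measurable]: "x k \<in> borel_measurable M" for k using int by blast
  have "(\<integral>\<^sup>+\<omega>. (\<Sum>k. ennreal (x k \<omega>)) \<partial>M) = (\<Sum>k. \<integral>\<^sup>+\<omega>. ennreal (x k \<omega>) \<partial>M)"
    by (rule nn_integral_suminf) auto
  also have "\<dots> = (\<Sum>k. ennreal (expectation (x k)))"
    by (intro suminf_cong nn_integral_eq_integral int AE_I2 nonneg)
  also have "\<dots> \<le> ennreal B"
  proof (rule suminf_le_const)
    have e0: "0 \<le> expectation (x k)" for k by (intro Bochner_Integration.integral_nonneg_AE AE_I2 nonneg)
    show "(\<Sum>k<n. ennreal (expectation (x k))) \<le> ennreal B" for n
      using e0 bound[of n] by (simp add: sum_ennreal ennreal_leI)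
  qed auto
  also have "\<dots> < \<infinity>" by simp
  finally have "AE \<omega> in M. (\<Sum>k. ennreal (x k \<omega>)) \<noteq> \<infinity>" by (intro nn_integral_PInf_AE) auto
  then show ?thesis using AE_space
    by eventually_elim (rule summable_suminf_not_top, auto simp: nonneg)
qed

end

context signed_reinforcement
begin

lemma excess_expectation:
  assumes "1 \<le> j"
  shows "integrable M (\<lambda>\<omega>. \<bar>excess b (Y j \<omega>)\<bar>)" "expectation (\<lambda>\<omega>. \<bar>excess b (Y j \<omega>)\<bar>) = expectation (\<lambda>\<omega>. \<bar>excess b (X 1 \<omega>)\<bar>)"
    and "integrable M (\<lambda>\<omega>. \<bar>excess b (X 1 \<omega>)\<bar>)"
proof -
  show i: "integrable M (\<lambda>\<omega>. \<bar>excess b (X 1 \<omega>)\<bar>)"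
    by (rule Bochner_Integration.integrable_bound[OF integrable_X1]) (auto simp: excess_def)
  have "\<bar>excess b (s * x)\<bar> = \<bar>excess b x\<bar>" for x by (simp add: excess_s abs_mult abs_s)
  with invariant_law[of "\<lambda>x. \<bar>excess b x\<bar>" j] i assms
  show "integrable M (\<lambda>\<omega>. \<bar>excess b (Y j \<omega>)\<bar>)" "expectation (\<lambda>\<omega>. \<bar>excess b (Y j \<omega>)\<bar>) = expectation (\<lambda>\<omega>. \<bar>excess b (X 1 \<omega>)\<bar>)"
    by auto
qed

text \<open>The step and its conditional mean each contribute one mean absolute excess of
  \<open>X 1\<close>, the latter because it is a convex combination of fresh and earlier
  excesses.\<close>

lemma innov_excess:
  assumes n: "2 \<le> n"
  shows "integrable M (\<lambda>\<omega>. \<bar>innov n (excess b) \<omega>\<bar>)"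
    and "expectation (\<lambda>\<omega>. \<bar>innov n (excess b) \<omega>\<bar>) \<le> 2 * expectation (\<lambda>\<omega>. \<bar>excess b (X 1 \<omega>)\<bar>)"
proof -
  let ?h = "expectation (\<lambda>\<omega>. \<bar>excess b (X 1 \<omega>)\<bar>)"
  let ?R = "\<lambda>\<omega>. \<bar>excess b (Y n \<omega>)\<bar> + ((1 - p) * ?h + p / real (n - 1) * (\<Sum>j\<in>{1..<n}. \<bar>excess b (Y j \<omega>)\<bar>))"
  have n1: "1 \<le> n" using n by simp
  have iS: "integrable M (\<lambda>\<omega>. \<Sum>j\<in>{1..<n}. \<bar>excess b (Y j \<omega>)\<bar>)"
    by (intro Bochner_Integration.integrable_sum excess_expectation(1)) auto
  have iR: "integrable M ?R" using iS excess_expectation(1)[OF n1] by simp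
  have le: "\<bar>innov n (excess b) \<omega>\<bar> \<le> ?R \<omega>" for \<omega>
  proof -
    have "\<bar>cexp n (excess b) \<omega>\<bar> \<le> \<bar>(1 - p) * expectation (\<lambda>\<omega>. excess b (X 1 \<omega>))\<bar> + \<bar>p / real (n - 1) * (\<Sum>j\<in>{1..<n}. excess b (s * Y j \<omega>))\<bar>"
      unfolding cexp_def by (rule abs_triangle_ineq)
    also have "\<dots> = (1 - p) * \<bar>expectation (\<lambda>\<omega>. excess b (X 1 \<omega>))\<bar> + p / real (n - 1) * \<bar>\<Sum>j\<in>{1..<n}. excess b (s * Y j \<omega>)\<bar>"
      using p by (simp add: abs_mult)
    also have "\<dots> \<le> (1 - p) * ?h + p / real (n - 1) * (\<Sum>j\<in>{1..<n}. \<bar>excess b (Y j \<omega>)\<bar>)"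
    proof (intro add_mono mult_left_mono)
      show "\<bar>expectation (\<lambda>\<omega>. excess b (X 1 \<omega>))\<bar> \<le> ?h" by (rule integral_abs_bound)
      show "\<bar>\<Sum>j\<in>{1..<n}. excess b (s * Y j \<omega>)\<bar> \<le> (\<Sum>j\<in>{1..<n}. \<bar>excess b (Y j \<omega>)\<bar>)"
        by (rule order_trans[OF sum_abs]) (simp add: excess_s abs_mult abs_s)
    qed (use p in auto)
    finally show ?thesis unfolding innov_def by (intro order_trans[OF abs_triangle_ineq4] add_left_mono)
  qed
  have [measurable]: "innov n (excess b) \<in> borel_measurable M" by (rule meas_F[OF innov_meas_F[OF n1]]) measurable
  show i: "integrable M (\<lambda>\<omega>. \<bar>innov n (excess b) \<omega>\<bar>)"
  proof (rule Bochner_Integration.integrable_bound[OF iR])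
    show "AE \<omega> in M. norm \<bar>innov n (excess b) \<omega>\<bar> \<le> norm (?R \<omega>)"
    proof (rule AE_I2)
      fix \<omega>
      show "norm \<bar>innov n (excess b) \<omega>\<bar> \<le> norm (?R \<omega>)" unfolding real_norm_def abs_idempotent by (rule order_trans[OF le abs_ge_self])
    qed
  qed measurable
  have "expectation (\<lambda>\<omega>. \<bar>innov n (excess b) \<omega>\<bar>) \<le> expectation ?R"
    by (rule integral_mono[OF i iR le])
  also have "\<dots> = ?h + ((1 - p) * ?h + p / real (n - 1) * (\<Sum>j\<in>{1..<n}. ?h))"
  proof -
    have "expectation (\<lambda>\<omega>. \<Sum>j\<in>{1..<n}. \<bar>excess b (Y j \<omega>)\<bar>) = (\<Sum>j\<in>{1..<n}. expectation (\<lambda>\<omega>. \<bar>excess b (Y j \<omega>)\<bar>))"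
      by (intro Bochner_Integration.integral_sum excess_expectation(1)) auto
    also have "\<dots> = (\<Sum>j\<in>{1..<n}. ?h)" by (intro sum.cong refl excess_expectation(2)) auto
    finally have eS: "expectation (\<lambda>\<omega>. \<Sum>j\<in>{1..<n}. \<bar>excess b (Y j \<omega>)\<bar>) = (\<Sum>j\<in>{1..<n}. ?h)" .
    have "expectation ?R = expectation (\<lambda>\<omega>. \<bar>excess b (Y n \<omega>)\<bar>) + expectation (\<lambda>\<omega>. (1 - p) * ?h + p / real (n - 1) * (\<Sum>j\<in>{1..<n}. \<bar>excess b (Y j \<omega>)\<bar>))"
      using iS by (intro Bochner_Integration.integral_add excess_expectation(1)[OF n1]) auto
    also have "expectation (\<lambda>\<omega>. (1 - p) * ?h + p / real (n - 1) * (\<Sum>j\<in>{1..<n}. \<bar>excess b (Y j \<omega>)\<bar>))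
      = (1 - p) * ?h + p / real (n - 1) * expectation (\<lambda>\<omega>. \<Sum>j\<in>{1..<n}. \<bar>excess b (Y j \<omega>)\<bar>)"
      by (subst Bochner_Integration.integral_add[OF integrable_const integrable_mult_right[OF iS]])
        (simp only: integral_mult_right_zero lebesgue_integral_const prob_space scaleR_one)
    finally show ?thesis unfolding eS excess_expectation(2)[OF n1] .
  qed
  also have "\<dots> = 2 * ?h" using n by (simp add: field_simps)
  finally show "expectation (\<lambda>\<omega>. \<bar>innov n (excess b) \<omega>\<bar>) \<le> 2 * ?h" .
qed

lemma innov_split: "innov n (\<lambda>x. x) \<omega> = innov n (trunc b) \<omega> + innov n (excess b) \<omega>"
proof -
  have i: "integrable M (\<lambda>\<omega>. trunc b (X 1 \<omega>))" "integrable M (\<lambda>\<omega>. excess b (X 1 \<omega>))"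
    by (rule Bochner_Integration.integrable_bound[OF integrable_X1]; auto simp: trunc_def excess_def)+
  have "expectation (X 1) = expectation (\<lambda>\<omega>. trunc b (X 1 \<omega>) + excess b (X 1 \<omega>))"
    by (simp add: trunc_plus_excess)
  also have "\<dots> = expectation (\<lambda>\<omega>. trunc b (X 1 \<omega>)) + expectation (\<lambda>\<omega>. excess b (X 1 \<omega>))"
    using i by simp
  finally have e: "expectation (X 1) = expectation (\<lambda>\<omega>. trunc b (X 1 \<omega>)) + expectation (\<lambda>\<omega>. excess b (X 1 \<omega>))" .
  have S: "(\<Sum>j\<in>{1..<n}. s * Y j \<omega>) = (\<Sum>j\<in>{1..<n}. trunc b (s * Y j \<omega>)) + (\<Sum>j\<in>{1..<n}. excess b (s * Y j \<omega>))"
    unfolding sum.distrib[symmetric] trunc_plus_excess ..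
  have "cexp n (\<lambda>x. x) \<omega> = cexp n (trunc b) \<omega> + cexp n (excess b) \<omega>"
    unfolding cexp_def S e by (simp add: distrib_left)
  then show ?thesis using trunc_plus_excess[of b "Y n \<omega>"] unfolding innov_def by linarith
qed

end

text \<open>
  \<open>T\<close> plays the role of the bracket of the martingale \<open>\<Sum> a k * innov k\<close>. The steps at time \<open>k\<close> are
  truncated at a small multiple of \<open>sqrt (T k / LL (T k)) / a k\<close>, the largest level at which the
  exponential bounds are sharp; \<open>weight_sum\<close> makes the part above that level summable.
\<close>

locale reinforced_scale = signed_reinforcement M p X \<epsilon> U s
  for M :: "'a measure" and p and X and \<epsilon> and U and s +
  fixes a T :: "nat \<Rightarrow> real"
  assumes a_pos: "0 < a k"
    and T_mono: "T k \<le> T (Suc k)" and T_nonneg: "0 \<le> T 0" and T_lim: "filterlim T at_top sequentially"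
    and T_ratio: "(\<lambda>k. T (Suc k) / T k) \<longlonglongrightarrow> 1"
    and v_pos: "0 < m2 - \<mu>\<^sup>2"
    and increments: "(\<lambda>k. (T (Suc k) - T k) / (a k)\<^sup>2) \<longlonglongrightarrow> m2 - \<mu>\<^sup>2"
    and level_lim: "filterlim (\<lambda>k. sqrt (T k / LL (T k)) / a k) at_top sequentially"
    and weight_sum: "\<exists>C k0. (\<forall>k\<ge>k0. exp (exp 1) \<le> T k) \<and>
       (\<forall>n\<ge>k0. (\<Sum>k=k0..n. a k / sqrt (T k * LL (T k))) \<le> C * (sqrt (T n / LL (T n)) / a n))"
begin

definition level :: "nat \<Rightarrow> real" where "level k = sqrt (T k / LL (T k)) / a k"
definition norming :: "nat \<Rightarrow> real" where "norming n = sqrt (2 * T n * LL (T n))"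
text \<open>The first step involves no reinforcement and is left out; the upper end is exclusive, so
  \<open>wsum n\<close> is \<open>F n\<close>-measurable.\<close>

definition wsum :: "nat \<Rightarrow> 'a \<Rightarrow> real" where "wsum n \<omega> = (\<Sum>k=2..<n. a k * innov k (\<lambda>x. x) \<omega>)"

lemma norming_lim: "filterlim norming at_top sequentially"
proof -
  have "filterlim (\<lambda>x. sqrt (2 * x * LL x)) at_top at_top" unfolding LL_def by real_asymp
  from filterlim_compose[OF this T_lim] show ?thesis by (simp add: norming_def[abs_def])
qed

text \<open>By Kronecker it is enough that the excess innovations are absolutely summable with
  weights \<open>a k / sqrt (T k * LL (T k))\<close>. Their means are controlled by the excess of
  \<open>X 1\<close>; after exchanging sum and expectation, \<open>weight_sum\<close> turns the
  weights of all levels below \<open>\<bar>X 1\<bar>\<close> into a multiple of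
  \<open>\<bar>X 1\<bar>\<close>, and the second moment remains.\<close>

lemma excess_negligible:
  assumes \<delta>: "0 < \<delta>"
  shows "AE \<omega> in M. (\<lambda>n. (\<Sum>k=2..<n. a k * innov k (excess (\<delta> * level k)) \<omega>) / norming n) \<longlonglongrightarrow> 0"
proof -
  obtain C k0 where k0: "\<And>k. k0 \<le> k \<Longrightarrow> exp (exp 1) \<le> T k"
    and C: "\<And>n. k0 \<le> n \<Longrightarrow> (\<Sum>k=k0..n. a k / sqrt (T k * LL (T k))) \<le> C * level n"
    using weight_sum unfolding level_def by blast
  define k1 where "k1 = max 2 k0"
  define \<gamma> where "\<gamma> k = a k / sqrt (T k * LL (T k))" for k
  have T1: "1 < T k" if "k0 \<le> k" for k
  proof -
    have "1 < exp (exp 1 :: real)" by simp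
    then show ?thesis using k0[OF that] by linarith
  qed
  have L1: "1 \<le> LL (T k)" if "k0 \<le> k" for k by (rule LL_ge_1[OF k0[OF that]])
  have \<gamma>0: "0 < \<gamma> k" if "k0 \<le> k" for k
    unfolding \<gamma>_def using a_pos[of k] T1[OF that] L1[OF that] by (intro divide_pos_pos) auto
  have lev0: "0 < level k" if "k0 \<le> k" for k
    unfolding level_def using a_pos[of k] T1[OF that] L1[OF that] by (intro divide_pos_pos) auto
  have C0: "0 \<le> C"
  proof -
    have "0 < C * level k0" using C[of k0] \<gamma>0[of k0] unfolding \<gamma>_def by simp
    then show ?thesis using lev0[of k0] by (simp add: zero_less_mult_iff)
  qed
  \<comment> \<open>The levels are not assumed monotone. The induction keeps its bound until the
    next index with \<open>\<delta> * level n < y\<close>, where \<open>weight_sum\<close> at that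
    very index takes over.\<close>
  have below: "(\<Sum>k=k0..<n. \<gamma> k * of_bool (\<delta> * level k < y)) \<le> C / \<delta> * y" if y: "0 \<le> y" for n y
  proof (induction n)
    case 0
    then show ?case using C0 \<delta> y by simp
  next
    case (Suc n)
    show ?case
    proof (cases "k0 \<le> n")
      case False
      then show ?thesis using C0 \<delta> y by simp
    next
      case True
      show ?thesis
      proof (cases "\<delta> * level n < y")
        case True
        have "(\<Sum>k=k0..<Suc n. \<gamma> k * of_bool (\<delta> * level k < y)) \<le> (\<Sum>k=k0..n. \<gamma> k)"
          unfolding atLeastLessThanSuc_atLeastAtMost using \<gamma>0 by (intro sum_mono) (auto simp: less_imp_le)
        also have "\<dots> \<le> C * level n" using C[OF \<open>k0 \<le> n\<close>] by (simp add: \<gamma>_def)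
        also have "\<dots> = C / \<delta> * (\<delta> * level n)" using \<delta> by simp
        also have "\<dots> \<le> C / \<delta> * y" using True C0 \<delta> by (intro mult_left_mono) auto
        finally show ?thesis .
      qed (use Suc \<open>k0 \<le> n\<close> in simp)
    qed
  qed
  define x where "x k = (if k1 \<le> k then (\<lambda>\<omega>. \<gamma> k * \<bar>innov k (excess (\<delta> * level k)) \<omega>\<bar>) else (\<lambda>_. 0))" for k
  have "AE \<omega> in M. summable (\<lambda>k. x k \<omega>)"
  proof (rule AE_summable_of_bounded_expectations[where B="2 * (C / \<delta> * m2)"])
    show "integrable M (x k)" for k unfolding x_def k1_def using innov_excess(1)[of k] by auto
    show "0 \<le> x k \<omega>" for k \<omega> unfolding x_def k1_def using \<gamma>0[of k] by auto
    fix n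
    let ?e = "\<lambda>k \<omega>. \<gamma> k * \<bar>excess (\<delta> * level k) (X 1 \<omega>)\<bar>"
    have ie: "integrable M (?e k)" for k using excess_expectation(3)[of 1] by simp
    have "(\<Sum>k<n. expectation (x k)) \<le> (\<Sum>k\<in>{k1..<n}. 2 * expectation (?e k))"
    proof -
      have "(\<Sum>k<n. expectation (x k)) = (\<Sum>k\<in>{k1..<n}. expectation (x k))"
        by (rule sum.mono_neutral_right) (auto simp: x_def)
      also have "\<dots> \<le> (\<Sum>k\<in>{k1..<n}. 2 * expectation (?e k))"
      proof (rule sum_mono)
        fix k assume k: "k \<in> {k1..<n}"
        have "expectation (x k) = \<gamma> k * expectation (\<lambda>\<omega>. \<bar>innov k (excess (\<delta> * level k)) \<omega>\<bar>)"
          using k by (simp add: x_def)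
        also have "\<dots> \<le> \<gamma> k * (2 * expectation (\<lambda>\<omega>. \<bar>excess (\<delta> * level k) (X 1 \<omega>)\<bar>))"
          using k \<gamma>0[of k] by (intro mult_left_mono innov_excess) (auto simp: k1_def)
        finally show "expectation (x k) \<le> 2 * expectation (?e k)" by simp
      qed
      finally show ?thesis .
    qed
    also have "\<dots> = 2 * expectation (\<lambda>\<omega>. \<Sum>k\<in>{k1..<n}. ?e k \<omega>)"
      unfolding sum_distrib_left[symmetric] by (subst Bochner_Integration.integral_sum[OF ie]) auto
    also have "\<dots> \<le> 2 * expectation (\<lambda>\<omega>. C / \<delta> * (X 1 \<omega>)\<^sup>2)"
    proof (intro mult_left_mono integral_mono Bochner_Integration.integrable_sum ie)
      show "integrable M (\<lambda>\<omega>. C / \<delta> * (X 1 \<omega>)\<^sup>2)" using X_square by simp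
      fix \<omega>
      have "(\<Sum>k\<in>{k1..<n}. ?e k \<omega>) = \<bar>X 1 \<omega>\<bar> * (\<Sum>k\<in>{k1..<n}. \<gamma> k * of_bool (\<delta> * level k < \<bar>X 1 \<omega>\<bar>))"
        unfolding sum_distrib_left by (intro sum.cong) (auto simp: excess_def)
      also have "\<dots> \<le> \<bar>X 1 \<omega>\<bar> * (\<Sum>k\<in>{k0..<n}. \<gamma> k * of_bool (\<delta> * level k < \<bar>X 1 \<omega>\<bar>))"
        using \<gamma>0 by (intro mult_left_mono sum_mono2) (auto simp: k1_def less_imp_le)
      also have "\<dots> \<le> \<bar>X 1 \<omega>\<bar> * (C / \<delta> * \<bar>X 1 \<omega>\<bar>)" by (intro mult_left_mono below) auto
      also have "\<dots> = C / \<delta> * (X 1 \<omega>)\<^sup>2" by (simp add: power2_eq_square)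
      finally show "(\<Sum>k\<in>{k1..<n}. ?e k \<omega>) \<le> C / \<delta> * (X 1 \<omega>)\<^sup>2" .
    qed simp
    also have "\<dots> = 2 * (C / \<delta> * m2)" by (simp add: m2_def)
    finally show "(\<Sum>k<n. expectation (x k)) \<le> 2 * (C / \<delta> * m2)" .
  qed
  then show ?thesis using AE_space
  proof eventually_elim
    case (elim \<omega>)
    \<comment> \<open>Zero before \<open>k1\<close>, where \<open>T k * LL (T k)\<close> need not be
      positive or increasing; the finitely many early terms are collected in
      \<open>G\<close>.\<close>
    define b where "b k = (if k1 \<le> k then sqrt (T k * LL (T k)) else 0)" for k
    have TL: "T i * LL (T i) \<le> T j * LL (T j)" if "k1 \<le> i" "i \<le> j" for i j
    proof (intro mult_mono)
      show Tij: "T i \<le> T j" by (rule lift_Suc_mono_le[of T, OF T_mono that(2)])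
      show "LL (T i) \<le> LL (T j)" using T1[of i] that Tij by (intro LL_mono) (auto simp: k1_def)
      show "0 \<le> T j" using T1[of j] that by (simp add: k1_def)
      show "0 \<le> LL (T i)" using L1[of i] that by (simp add: k1_def)
    qed
    have b_lim: "filterlim b at_top sequentially"
    proof -
      have "filterlim (\<lambda>x. sqrt (x * LL x)) at_top at_top" unfolding LL_def by real_asymp
      from filterlim_compose[OF this T_lim] show ?thesis
        by (rule filterlim_cong[THEN iffD1, rotated -1, OF _ refl refl])
          (use eventually_ge_at_top[of k1] in \<open>eventually_elim, simp add: b_def\<close>)
    qed
    have K: "(\<lambda>n. (\<Sum>k<n. b k * x k \<omega>) / b n) \<longlonglongrightarrow> 0"
    proof (rule kronecker_nonneg[OF _ elim(1) _ _ b_lim])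
      show "0 \<le> x k \<omega>" for k unfolding x_def k1_def using \<gamma>0[of k] by auto
      show b0: "0 \<le> b k" for k
        unfolding b_def using T1[of k] L1[of k] by (auto simp: k1_def)
      show "eventually (\<lambda>n. \<forall>k<n. b k \<le> b n) sequentially"
        using eventually_ge_at_top[of k1]
      proof eventually_elim
        case (elim n)
        show ?case
        proof (intro allI impI)
          fix k assume "k < n"
          then show "b k \<le> b n" using b0[of n] TL[of k n] elim by (cases "k1 \<le> k") (auto simp: b_def)
        qed
      qed
    qed
    have bx: "b k * x k \<omega> = (if k1 \<le> k then \<bar>a k * innov k (excess (\<delta> * level k)) \<omega>\<bar> else 0)" for k
    proof (cases "k1 \<le> k")
      case True
      then have "0 < sqrt (T k * LL (T k))" using T1[of k] L1[of k] by (auto simp: k1_def)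
      then have "sqrt (T k * LL (T k)) * \<gamma> k = a k" unfolding \<gamma>_def times_divide_eq_right by (intro nonzero_mult_div_cancel_left) linarith
      then show ?thesis using True a_pos[of k] by (simp add: b_def x_def abs_mult mult.assoc[symmetric])
    qed (simp add: b_def x_def)
    define G where "G = (\<Sum>k=2..<k1. \<bar>a k * innov k (excess (\<delta> * level k)) \<omega>\<bar>)"
    have b_inv: "(\<lambda>n. G / b n) \<longlonglongrightarrow> 0"
      by (rule tendsto_divide_0[OF tendsto_const filterlim_at_top_imp_at_infinity[OF b_lim]])
    show ?case
    proof (rule Lim_null_comparison)
      show "(\<lambda>n. G / b n + (\<Sum>k<n. b k * x k \<omega>) / b n) \<longlonglongrightarrow> 0" using tendsto_add[OF b_inv K] by simp
      show "eventually (\<lambda>n. norm ((\<Sum>k=2..<n. a k * innov k (excess (\<delta> * level k)) \<omega>) / norming n)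
        \<le> G / b n + (\<Sum>k<n. b k * x k \<omega>) / b n) sequentially"
        using eventually_ge_at_top[of k1]
      proof eventually_elim
        case (elim n)
        have bn: "0 < b n" using elim T1[of n] L1[of n] by (auto simp: b_def k1_def)
        have nb: "b n \<le> norming n"
        proof -
          have "T n * LL (T n) \<le> 2 * T n * LL (T n)" using elim T1[of n] L1[of n] by (auto simp: k1_def)
          then show ?thesis using elim by (simp add: b_def norming_def)
        qed
        have "\<bar>\<Sum>k=2..<n. a k * innov k (excess (\<delta> * level k)) \<omega>\<bar> \<le> (\<Sum>k=2..<n. \<bar>a k * innov k (excess (\<delta> * level k)) \<omega>\<bar>)"
          by (rule sum_abs)
        also have "\<dots> = G + (\<Sum>k=k1..<n. \<bar>a k * innov k (excess (\<delta> * level k)) \<omega>\<bar>)"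
          unfolding G_def using elim by (intro sum.atLeastLessThan_concat[symmetric]) (auto simp: k1_def)
        also have "(\<Sum>k=k1..<n. \<bar>a k * innov k (excess (\<delta> * level k)) \<omega>\<bar>) = (\<Sum>k=k1..<n. b k * x k \<omega>)"
          by (intro sum.cong) (auto simp: bx)
        also have "\<dots> = (\<Sum>k<n. b k * x k \<omega>)" by (rule sum.mono_neutral_left) (auto simp: bx)
        finally have "\<bar>\<Sum>k=2..<n. a k * innov k (excess (\<delta> * level k)) \<omega>\<bar> \<le> G + (\<Sum>k<n. b k * x k \<omega>)" .
        then have "\<bar>\<Sum>k=2..<n. a k * innov k (excess (\<delta> * level k)) \<omega>\<bar> / norming n \<le> (G + (\<Sum>k<n. b k * x k \<omega>)) / b n"
          using bn nb by (intro frac_le) auto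
        then show ?case using bn nb by (simp add: abs_divide add_divide_distrib)
      qed
    qed
  qed
qed

end

context signed_reinforcement
begin

text \<open>The centred decision is bounded, independent of \<open>F n\<close> and of known positive
  variance: the raw material for the substitute increments of the martingale below.\<close>

lemma decision_moments:
  assumes n: "2 \<le> n" and H: "H \<in> borel_measurable (F n)" "\<And>\<omega>. \<omega> \<in> space M \<Longrightarrow> \<bar>H \<omega>\<bar> \<le> B"
  shows "expectation (\<lambda>\<omega>. H \<omega> * (W (Decision n) \<omega> - p)) = 0"
    and "expectation (\<lambda>\<omega>. H \<omega> * (W (Decision n) \<omega> - p)\<^sup>2) = expectation H * (p * (1 - p))"
proof -
  have [measurable]: "W (Decision n) \<in> borel_measurable M" using n by (intro W_meas) (auto simp: indices_def)
  have [measurable]: "H \<in> borel_measurable M" using meas_F[OF H(1)] .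
  have iH: "integrable M H" by (rule integrable_const_bound[of _ B]) (use H(2) in auto)
  have i1: "integrable M (\<lambda>\<omega>. W (Decision n) \<omega> - p)" using integrable_decision[OF n] by simp
  have sq: "(W (Decision n) \<omega> - p)\<^sup>2 = W (Decision n) \<omega> * (1 - 2 * p) + p\<^sup>2" for \<omega>
    by (auto simp: W_def power2_eq_square algebra_simps)
  have i2: "integrable M (\<lambda>\<omega>. (W (Decision n) \<omega> - p)\<^sup>2)" unfolding sq using integrable_decision[OF n] by simp
  have e1: "expectation (\<lambda>\<omega>. W (Decision n) \<omega> - p) = 0"
    using integrable_decision[OF n] expectation_decision[OF n] by (simp add: prob_space)
  have e2: "expectation (\<lambda>\<omega>. (W (Decision n) \<omega> - p)\<^sup>2) = p * (1 - p)"
    unfolding sq using integrable_decision[OF n] expectation_decision[OF n]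
    by (simp add: prob_space power2_eq_square algebra_simps)
  have "indep_var borel H borel (\<lambda>\<omega>. (\<lambda>f. f (Decision n) - p) (\<lambda>i\<in>present n. W i \<omega>))"
    by (rule indep_past[OF n H(1)]) (simp add: present_def)
  then have "indep_var borel H borel (\<lambda>\<omega>. W (Decision n) \<omega> - p)" by (simp add: present_def)
  from indep_var_lebesgue_integral[OF this iH i1]
  show "expectation (\<lambda>\<omega>. H \<omega> * (W (Decision n) \<omega> - p)) = 0" by (simp add: e1)
  have "indep_var borel H borel (\<lambda>\<omega>. (\<lambda>f. (f (Decision n) - p)\<^sup>2) (\<lambda>i\<in>present n. W i \<omega>))"
    by (rule indep_past[OF n H(1)]) (simp add: present_def)
  then have "indep_var borel H borel (\<lambda>\<omega>. (W (Decision n) \<omega> - p)\<^sup>2)" by (simp add: present_def)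
  from indep_var_lebesgue_integral[OF this iH i2]
  show "expectation (\<lambda>\<omega>. H \<omega> * (W (Decision n) \<omega> - p)\<^sup>2) = expectation H * (p * (1 - p))" by (simp add: e2)
qed

end

section \<open>The modified martingale and its law of the iterated logarithm\<close>

context reinforced_scale
begin

lemma level_at_top: "filterlim level at_top sequentially"
  using level_lim by (simp add: level_def[abs_def])

text \<open>A multiple of the centred decision with variance \<open>T (Suc k) - T k\<close> has size
  at most the root of the left-hand side. As the increments of \<open>T\<close> are of order
  \<open>(a k)\<^sup>2\<close> and the levels tend to infinity, it obeys the same bound as the
  truncated innovations.\<close>

lemma small_increments:
  assumes "0 < \<delta>"
  shows "eventually (\<lambda>k. (T (Suc k) - T k) / (p * (1 - p)) \<le> \<delta>\<^sup>2 * (a k * level k)\<^sup>2) sequentially"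
proof -
  have "filterlim (\<lambda>k. (level k)\<^sup>2) at_top sequentially"
  proof -
    have "filterlim (\<lambda>x::real. x\<^sup>2) at_top at_top" by real_asymp
    from filterlim_compose[OF this level_at_top] show ?thesis .
  qed
  then have "eventually (\<lambda>k. (level k)\<^sup>2 \<ge> (m2 - \<mu>\<^sup>2 + 1) / (p * (1 - p) * \<delta>\<^sup>2)) sequentially"
    unfolding filterlim_at_top by blast
  moreover have "eventually (\<lambda>k. (T (Suc k) - T k) / (a k)\<^sup>2 < m2 - \<mu>\<^sup>2 + 1) sequentially"
    using order_tendstoD(2)[OF increments] by simp
  ultimately show ?thesis
  proof eventually_elim
    case (elim k)
    have pp: "0 < p * (1 - p)" using p by simp
    have "m2 - \<mu>\<^sup>2 + 1 \<le> (level k)\<^sup>2 * (p * (1 - p) * \<delta>\<^sup>2)"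
      using elim(1) pp assms by (simp add: pos_divide_le_eq)
    then have "(T (Suc k) - T k) / (a k)\<^sup>2 \<le> (level k)\<^sup>2 * (p * (1 - p) * \<delta>\<^sup>2)" using elim(2) by linarith
    then have "T (Suc k) - T k \<le> (level k)\<^sup>2 * (p * (1 - p) * \<delta>\<^sup>2) * (a k)\<^sup>2"
      using a_pos[of k] by (simp add: pos_divide_le_eq)
    then show ?case using pp by (simp add: pos_divide_le_eq power_mult_distrib mult_ac)
  qed
qed

text \<open>
  The martingale to which the bracket-controlled law is applied: the innovations of the truncated
  steps, weighted by \<open>a\<close>. Whenever the conditional variance leaves its limiting window, which
  happens only finitely often, the increment is replaced by a multiple of \<open>\<epsilon> k - p\<close> with exactly
  the right variance; this makes the bracket deterministic up to a factor \<open>1 \<pm> \<kappa>\<close>.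
\<close>

lemma wsum_bounds:
  assumes \<eta>: "0 < \<eta>" "\<eta> \<le> 1 / 4"
  shows "AE \<omega> in M. eventually (\<lambda>n. wsum n \<omega> \<le> (1 + 2 * \<eta>) * norming n) sequentially \<and>
    frequently (\<lambda>n. wsum n \<omega> \<ge> (1 - 6 * \<eta>) * norming n) sequentially"
proof -
  \<comment> \<open>\<open>\<delta>\<close> and \<open>\<kappa>\<close> are the largest values that
    \<open>lil_lower\<close> admits.\<close>
  define \<delta> where "\<delta> = \<eta>\<^sup>2 / 200"
  define \<kappa> where "\<kappa> = \<eta>\<^sup>2 / 20"
  have \<eta>2: "0 < \<eta>\<^sup>2" "\<eta>\<^sup>2 \<le> 1 / 16" using \<eta> power_mono[of \<eta> "1/4" 2] by (simp_all add: power2_eq_square)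
  have \<delta>: "0 < \<delta>" using \<eta>2 by (simp add: \<delta>_def)
  have \<kappa>: "0 < \<kappa>" "\<kappa> \<le> 1" using \<eta>2 by (simp_all add: \<kappa>_def)
  define v where "v = m2 - \<mu>\<^sup>2"
  define w where "w k = T (Suc k) - T k" for k
  \<comment> \<open>Half of \<open>\<delta>\<close>, because an innovation is bounded by twice the
    truncation level.\<close>
  define b where "b k = \<delta> / 2 * level k" for k
  have w_lim: "(\<lambda>k. w k / (a k)\<^sup>2) \<longlonglongrightarrow> v" using increments by (simp add: w_def v_def)
  have v: "0 < v" using v_pos by (simp add: v_def)
  have b_lim: "filterlim b at_top sequentially"
    unfolding b_def by (rule filterlim_tendsto_pos_mult_at_top[OF tendsto_const _ level_at_top]) (use \<delta> in simp)
  have "eventually (\<lambda>k. w k / (a k)\<^sup>2 > 0) sequentially" using order_tendstoD(1)[OF w_lim v] .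
  moreover have "eventually (\<lambda>k. T k \<ge> exp (exp 1)) sequentially" using T_lim by (simp add: filterlim_at_top)
  ultimately have "eventually (\<lambda>k. 2 \<le> k \<and> exp (exp 1) \<le> T k \<and> 0 < w k \<and> w k / (p * (1 - p)) \<le> \<delta>\<^sup>2 * (a k * level k)\<^sup>2) sequentially"
    using eventually_ge_at_top[of 2] small_increments[OF \<delta>]
    by eventually_elim (use a_pos in \<open>auto simp: w_def zero_less_divide_iff\<close>)
  then obtain k1 where k1: "\<And>k. k1 \<le> k \<Longrightarrow> 2 \<le> k \<and> exp (exp 1) \<le> T k \<and> 0 < w k \<and> w k / (p * (1 - p)) \<le> \<delta>\<^sup>2 * (a k * level k)\<^sup>2"
    unfolding eventually_sequentially by blast
  have L1: "1 \<le> LL (T k)" if "k1 \<le> k" for k using k1[OF that] by (intro LL_ge_1) auto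
  have T1: "1 < T k" if "k1 \<le> k" for k
  proof -
    have "1 < exp (exp 1 :: real)" by simp
    then show ?thesis using k1[OF that] by linarith
  qed
  have lev0: "0 < level k" if "k1 \<le> k" for k
    unfolding level_def using a_pos[of k] T1[OF that] L1[OF that] by (intro divide_pos_pos) auto
  have alev: "a k * level k = sqrt (T k / LL (T k))" for k using a_pos[of k] by (simp add: level_def)
  define V0 where "V0 k \<omega> = (a k)\<^sup>2 * (cexp k (\<lambda>x. (trunc (b k) x)\<^sup>2) \<omega> - (cexp k (trunc (b k)) \<omega>)\<^sup>2)" for k \<omega>
  define J where "J k = {\<omega>\<in>space M. \<bar>V0 k \<omega> - w k\<bar> \<le> \<kappa> * w k}" for k
  \<comment> \<open>Normalised so that \<open>cn k\<close> times the centred decision has variance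
    exactly \<open>w k\<close>.\<close>
  define cn where "cn k = sqrt (w k / (p * (1 - p)))" for k
  define D where "D k \<omega> = (if k < k1 then 0 else
    indicator (J k) \<omega> * (a k * innov k (trunc (b k)) \<omega>) + (1 - indicator (J k) \<omega>) * (cn k * (W (Decision k) \<omega> - p)))" for k \<omega>
  define V where "V k \<omega> = (if k < k1 then 0 else indicator (J k) \<omega> * V0 k \<omega> + (1 - indicator (J k) \<omega>) * w k)" for k \<omega>
  define c where "c k = (if k < k1 then 0 else \<delta> * sqrt (T k / LL (T k)))" for k
  have b0: "0 \<le> b k" if "k1 \<le> k" for k using lev0[OF that] \<delta> by (simp add: b_def)
  have ab: "a k * b k = \<delta> / 2 * sqrt (T k / LL (T k))" for k unfolding b_def alev[symmetric] by simp
  have V0_F: "V0 k \<in> borel_measurable (F k)" for k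
  proof -
    have [measurable]: "cexp k (\<lambda>x. (trunc (b k) x)\<^sup>2) \<in> borel_measurable (F k)" by (rule cexp_meas_F) measurable
    have [measurable]: "cexp k (trunc (b k)) \<in> borel_measurable (F k)" by (rule cexp_meas_F) measurable
    show ?thesis unfolding V0_def[abs_def] by measurable
  qed
  have J_F: "J k \<in> sets (F k)" for k
  proof -
    have [measurable]: "V0 k \<in> borel_measurable (F k)" by (rule V0_F)
    have "{\<omega>\<in>space (F k). \<bar>V0 k \<omega> - w k\<bar> \<le> \<kappa> * w k} \<in> sets (F k)" by measurable
    then show ?thesis by (simp add: J_def)
  qed
  have pp: "0 < p * (1 - p)" "p * (1 - p) \<le> 1" using p mult_mono[of p 1 "1 - p" 1] by auto
  have wc: "w k \<le> (c k)\<^sup>2" "cn k \<le> c k" "0 \<le> cn k" "(cn k)\<^sup>2 * (p * (1 - p)) = w k" if k: "k1 \<le> k" for k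
  proof -
    have le: "w k / (p * (1 - p)) \<le> (c k)\<^sup>2"
      using k1[OF k] k unfolding alev c_def by (simp add: power_mult_distrib)
    have "w k * (p * (1 - p)) \<le> w k * 1" using pp k1[OF k] by (intro mult_left_mono) auto
    then have "w k \<le> w k / (p * (1 - p))" using pp by (simp add: pos_le_divide_eq)
    then show "w k \<le> (c k)\<^sup>2" using le by linarith
    have "0 \<le> c k" unfolding c_def using \<delta> T1[OF k] L1[OF k] by auto
    then show "cn k \<le> c k" unfolding cn_def using real_sqrt_le_mono[OF le] by simp
    show "0 \<le> cn k" unfolding cn_def using k1[OF k] pp by simp
    have "(cn k)\<^sup>2 = w k / (p * (1 - p))" unfolding cn_def using k1[OF k] pp by (intro real_sqrt_pow2) auto
    then show "(cn k)\<^sup>2 * (p * (1 - p)) = w k" using pp(1) by (metis nonzero_eq_divide_eq order_less_irrefl)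
  qed
  have c0: "0 \<le> c k" for k unfolding c_def using \<delta> T1[of k] L1[of k] by auto
  have innov_c: "\<bar>a k * innov k (trunc (b k)) \<omega>\<bar> \<le> c k" if k: "k1 \<le> k" for k \<omega>
  proof -
    have "\<bar>innov k (trunc (b k)) \<omega>\<bar> \<le> 2 * b k"
      using k1[OF k] trunc_bound[OF b0[OF k]] by (intro innov_bound) auto
    then have "a k * \<bar>innov k (trunc (b k)) \<omega>\<bar> \<le> a k * (2 * b k)" using a_pos[of k] by (intro mult_left_mono) auto
    also have "\<dots> = 2 * (a k * b k)" by simp
    also have "\<dots> = c k" unfolding ab c_def using k by simp
    finally show ?thesis using a_pos[of k] by (simp add: abs_mult)
  qed
  have V0_c: "V0 k \<omega> \<le> (c k)\<^sup>2" if k: "k1 \<le> k" for k \<omega>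
  proof -
    have tb: "\<bar>(trunc (b k) x)\<^sup>2\<bar> \<le> (b k)\<^sup>2" for x
      using trunc_bound[OF b0[OF k], of x] b0[OF k] abs_le_square_iff[of "trunc (b k) x" "b k"] by simp
    have "\<bar>cexp k (\<lambda>x. (trunc (b k) x)\<^sup>2) \<omega>\<bar> \<le> (b k)\<^sup>2"
      using k1[OF k] tb by (intro cexp_bound) auto
    then have "cexp k (\<lambda>x. (trunc (b k) x)\<^sup>2) \<omega> - (cexp k (trunc (b k)) \<omega>)\<^sup>2 \<le> (b k)\<^sup>2"
      using zero_le_power2[of "cexp k (trunc (b k)) \<omega>"] by linarith
    then have "V0 k \<omega> \<le> (a k)\<^sup>2 * (b k)\<^sup>2" unfolding V0_def by (intro mult_left_mono) auto
    also have "\<dots> = (c k / 2)\<^sup>2" unfolding power_mult_distrib[symmetric] ab c_def using k by simp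
    also have "\<dots> \<le> (c k)\<^sup>2" using c0[of k] by (intro power_mono) auto
    finally show ?thesis .
  qed
  have V_window: "(1 - \<kappa>) * w k \<le> V k \<omega> \<and> V k \<omega> \<le> (1 + \<kappa>) * w k" if k: "k1 \<le> k" and \<omega>: "\<omega> \<in> space M" for k \<omega>
  proof (cases "\<omega> \<in> J k")
    case True
    then show ?thesis using k by (simp add: V_def J_def abs_le_iff algebra_simps)
  next
    case False
    moreover have "0 \<le> \<kappa> * w k" using \<kappa> k1[OF k] by simp
    ultimately show ?thesis using k by (simp add: V_def algebra_simps)
  qed
  have innov_F: "innov k (trunc (b k)) \<in> borel_measurable (F (Suc k))" if "k1 \<le> k" for k
    using k1[OF that] by (intro innov_meas_F) auto
  interpret D: bounded_mds M F D V c
  proof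
    fix k
    show "D k \<in> borel_measurable (F (Suc k))"
    proof (cases "k < k1")
      case False
      then have k: "k1 \<le> k" by simp
      have [measurable]: "J k \<in> sets (F (Suc k))" using J_F[of k] sets_F_Suc by blast
      have [measurable]: "W (Decision k) \<in> borel_measurable (F (Suc k))"
        using k1[OF k] by (intro W_meas_F) (auto simp: past_def)
      have [measurable]: "innov k (trunc (b k)) \<in> borel_measurable (F (Suc k))" by (rule innov_F[OF k])
      show ?thesis unfolding D_def[abs_def] using False by simp
    qed (simp add: D_def[abs_def])
    have [measurable]: "J k \<in> sets (F k)" "V0 k \<in> borel_measurable (F k)" using J_F V0_F by auto
    show "V k \<in> borel_measurable (F k)" unfolding V_def[abs_def] by (cases "k < k1") simp_all
    fix \<omega> assume \<omega>: "\<omega> \<in> space M"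
    show "\<bar>D k \<omega>\<bar> \<le> c k"
    proof (cases "k < k1")
      case False
      then have k: "k1 \<le> k" by simp
      have "\<bar>W (Decision k) \<omega> - p\<bar> \<le> 1" using p by (auto simp: W_def)
      then have "\<bar>cn k * (W (Decision k) \<omega> - p)\<bar> \<le> c k"
        using wc(2,3)[OF k] mult_mono[of "cn k" "c k" "\<bar>W (Decision k) \<omega> - p\<bar>" 1] c0[of k] by (simp add: abs_mult)
      then show ?thesis using False innov_c[OF k, of \<omega>] by (cases "\<omega> \<in> J k") (simp_all add: D_def)
    qed (simp add: D_def c_def)
    show "0 \<le> V k \<omega>"
    proof (cases "k < k1")
      case False
      then have k: "k1 \<le> k" by simp
      have "0 \<le> (1 - \<kappa>) * w k" using \<kappa> k1[OF k] by simp
      then show ?thesis using V_window[OF k \<omega>] by linarith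
    qed (simp add: V_def)
    show "V k \<omega> \<le> (c k)\<^sup>2"
    proof (cases "k < k1")
      case False
      then show ?thesis using V0_c[of k \<omega>] wc(1)[of k] by (cases "\<omega> \<in> J k") (simp_all add: V_def)
    qed (simp add: V_def)
  next
    fix H k and B :: real
    assume H: "H \<in> borel_measurable (F k)" "\<And>\<omega>. \<omega> \<in> space M \<Longrightarrow> \<bar>H \<omega>\<bar> \<le> B"
    have HM[measurable]: "H \<in> borel_measurable M" by (rule meas_F[OF H(1)])
    have JM[measurable]: "J k \<in> sets M" by (rule sets_F[OF J_F])
    have B0: "0 \<le> B" using H(2) not_empty by fastforce
    \<comment> \<open>Splitting the test function along \<open>J k\<close>, an event of
      \<open>F k\<close>, separates the true innovation from the substitute; both pieces are again
      bounded and \<open>F k\<close>-measurable.\<close>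
    define H1 where "H1 \<omega> = H \<omega> * indicator (J k) \<omega>" for \<omega>
    define H2 where "H2 \<omega> = H \<omega> * (1 - indicator (J k) \<omega>)" for \<omega>
    have H1: "H1 \<in> borel_measurable (F k)" "\<bar>H1 \<omega>\<bar> \<le> B" if "\<omega> \<in> space M" for \<omega>
      using H(1) J_F[of k] H(2)[OF that] B0 by (auto simp: H1_def[abs_def] indicator_def)
    have H2: "H2 \<in> borel_measurable (F k)" "\<bar>H2 \<omega>\<bar> \<le> B" if "\<omega> \<in> space M" for \<omega>
      using H(1) J_F[of k] H(2)[OF that] B0 by (auto simp: H2_def[abs_def] indicator_def)
    have H1F: "H1 \<in> borel_measurable (F k)" and H2F: "H2 \<in> borel_measurable (F k)"
      using H1(1) H2(1) not_empty by blast+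
    have [measurable]: "H1 \<in> borel_measurable M" "H2 \<in> borel_measurable M" using meas_F[OF H1F] meas_F[OF H2F] by auto
    have both: "expectation (\<lambda>\<omega>. H \<omega> * D k \<omega>) = 0 \<and> expectation (\<lambda>\<omega>. H \<omega> * (D k \<omega>)\<^sup>2) = expectation (\<lambda>\<omega>. H \<omega> * V k \<omega>)"
    proof (cases "k < k1")
      case True
      then show ?thesis by (simp add: D_def V_def)
    next
      case False
      then have k: "k1 \<le> k" by simp
      have k2: "2 \<le> k" using k1[OF k] by simp
      let ?I = "innov k (trunc (b k))" and ?W = "\<lambda>\<omega>. W (Decision k) \<omega> - p"
      have [measurable]: "?I \<in> borel_measurable M" by (rule meas_F[OF innov_F[OF k]])
      have [measurable]: "W (Decision k) \<in> borel_measurable M" using k2 by (intro W_meas) (auto simp: indices_def)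
      have tb: "\<bar>trunc (b k) x\<bar> \<le> b k" for x by (rule trunc_bound[OF b0[OF k]])
      have I2: "\<bar>?I \<omega>\<bar> \<le> 2 * b k" for \<omega> using tb by (intro innov_bound k2) auto
      have W1: "\<bar>?W \<omega>\<bar> \<le> 1" for \<omega> using p by (auto simp: W_def)
      have int: "integrable M f" if "f \<in> borel_measurable M" "\<And>\<omega>. \<omega> \<in> space M \<Longrightarrow> \<bar>f \<omega>\<bar> \<le> (c::real)" for f c
        by (rule integrable_const_bound[of _ c]) (use that in auto)
      have iI: "integrable M (\<lambda>\<omega>. H1 \<omega> * ?I \<omega>)"
        by (rule int[of _ "B * (2 * b k)"]) (use H1(2) I2 B0 in \<open>auto simp: abs_mult intro!: mult_mono\<close>)
      have iW: "integrable M (\<lambda>\<omega>. H2 \<omega> * ?W \<omega>)"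
        by (rule int[of _ "B * 1"]) (use H2(2) W1 B0 in \<open>auto simp only: abs_mult intro!: mult_mono\<close>, auto)
      have I4: "(?I \<omega>)\<^sup>2 \<le> (2 * b k)\<^sup>2" for \<omega> using I2[of \<omega>] b0[OF k] abs_le_square_iff[of "?I \<omega>" "2 * b k"] by simp
      have W2: "(?W \<omega>)\<^sup>2 \<le> 1" for \<omega> using W1[of \<omega>] abs_le_square_iff[of "?W \<omega>" 1] by simp
      have iI2: "integrable M (\<lambda>\<omega>. H1 \<omega> * (?I \<omega>)\<^sup>2)"
      proof (rule int[of _ "B * (2 * b k)\<^sup>2"])
        fix \<omega> assume "\<omega> \<in> space M"
        then show "\<bar>H1 \<omega> * (?I \<omega>)\<^sup>2\<bar> \<le> B * (2 * b k)\<^sup>2"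
          unfolding abs_mult abs_power2 using H1(2) I4[of \<omega>] B0 by (intro mult_mono) auto
      qed measurable
      have iW2: "integrable M (\<lambda>\<omega>. H2 \<omega> * (?W \<omega>)\<^sup>2)"
      proof (rule int[of _ "B * 1"])
        fix \<omega> assume "\<omega> \<in> space M"
        then show "\<bar>H2 \<omega> * (?W \<omega>)\<^sup>2\<bar> \<le> B * 1"
          unfolding abs_mult abs_power2 using H2(2) W2[of \<omega>] B0 by (intro mult_mono) auto
      qed measurable
      have "expectation (\<lambda>\<omega>. H \<omega> * D k \<omega>) = expectation (\<lambda>\<omega>. a k * (H1 \<omega> * ?I \<omega>) + cn k * (H2 \<omega> * ?W \<omega>))"
        using False by (intro Bochner_Integration.integral_cong) (auto simp: D_def H1_def H2_def indicator_def)
      also have "\<dots> = a k * expectation (\<lambda>\<omega>. H1 \<omega> * ?I \<omega>) + cn k * expectation (\<lambda>\<omega>. H2 \<omega> * ?W \<omega>)"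
        using iI iW by simp
      also have "\<dots> = 0"
        using innov_centered[OF k2 trunc_meas tb H1F H1(2)] decision_moments(1)[OF k2 H2F H2(2)] by simp
      finally have one: "expectation (\<lambda>\<omega>. H \<omega> * D k \<omega>) = 0" .
      have iH2: "integrable M H2" by (rule int[of _ B]) (use H2(2) in auto)
      let ?U = "\<lambda>\<omega>. cexp k (\<lambda>x. (trunc (b k) x)\<^sup>2) \<omega> - (cexp k (trunc (b k)) \<omega>)\<^sup>2"
      have iU: "integrable M (\<lambda>\<omega>. H1 \<omega> * ((a k)\<^sup>2 * ?U \<omega>))"
      proof (rule int[of _ "B * (c k)\<^sup>2"])
        have [measurable]: "V0 k \<in> borel_measurable M" by (rule meas_F[OF V0_F])
        have "(\<lambda>\<omega>. H1 \<omega> * V0 k \<omega>) \<in> borel_measurable M" by measurable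
        then show "(\<lambda>\<omega>. H1 \<omega> * ((a k)\<^sup>2 * ?U \<omega>)) \<in> borel_measurable M" by (simp add: V0_def)
        fix \<omega> assume \<omega>: "\<omega> \<in> space M"
        show "\<bar>H1 \<omega> * ((a k)\<^sup>2 * ?U \<omega>)\<bar> \<le> B * (c k)\<^sup>2"
        proof (cases "\<omega> \<in> J k")
          case True
          have "0 \<le> (1 - \<kappa>) * w k" using \<kappa> k1[OF k] by simp
          then have "0 \<le> V0 k \<omega>" using V_window[OF k \<omega>] True False by (simp add: V_def)
          then show ?thesis unfolding V0_def[symmetric] abs_mult
            using H1(2)[OF \<omega>] V0_c[OF k, of \<omega>] B0 by (intro mult_mono) auto
        next
          case False
          then show ?thesis using B0 by (simp add: H1_def)
        qed
      qed
      have "expectation (\<lambda>\<omega>. H \<omega> * (D k \<omega>)\<^sup>2) = expectation (\<lambda>\<omega>. (a k)\<^sup>2 * (H1 \<omega> * (?I \<omega>)\<^sup>2) + (cn k)\<^sup>2 * (H2 \<omega> * (?W \<omega>)\<^sup>2))"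
        using False by (intro Bochner_Integration.integral_cong) (auto simp: D_def H1_def H2_def indicator_def power_mult_distrib)
      also have "\<dots> = (a k)\<^sup>2 * expectation (\<lambda>\<omega>. H1 \<omega> * (?I \<omega>)\<^sup>2) + (cn k)\<^sup>2 * expectation (\<lambda>\<omega>. H2 \<omega> * (?W \<omega>)\<^sup>2)"
        using iI2 iW2 by simp
      also have "\<dots> = (a k)\<^sup>2 * expectation (\<lambda>\<omega>. H1 \<omega> * ?U \<omega>) + (cn k)\<^sup>2 * (expectation H2 * (p * (1 - p)))"
        by (simp only: innov_variance[OF k2 trunc_meas tb H1F H1(2)] decision_moments(2)[OF k2 H2F H2(2)])
      also have "\<dots> = expectation (\<lambda>\<omega>. H1 \<omega> * ((a k)\<^sup>2 * ?U \<omega>)) + w k * expectation H2"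
      proof -
        have "expectation (\<lambda>\<omega>. H1 \<omega> * ((a k)\<^sup>2 * ?U \<omega>)) = expectation (\<lambda>\<omega>. (a k)\<^sup>2 * (H1 \<omega> * ?U \<omega>))"
          by (simp only: mult_ac)
        also have "\<dots> = (a k)\<^sup>2 * expectation (\<lambda>\<omega>. H1 \<omega> * ?U \<omega>)" by simp
        finally have 1: "(a k)\<^sup>2 * expectation (\<lambda>\<omega>. H1 \<omega> * ?U \<omega>) = expectation (\<lambda>\<omega>. H1 \<omega> * ((a k)\<^sup>2 * ?U \<omega>))" ..
        show ?thesis unfolding 1 wc(4)[OF k, symmetric] by simp
      qed
      also have "\<dots> = expectation (\<lambda>\<omega>. H1 \<omega> * ((a k)\<^sup>2 * ?U \<omega>) + w k * H2 \<omega>)" using iU iH2 by simp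
      also have "\<dots> = expectation (\<lambda>\<omega>. H \<omega> * V k \<omega>)"
        using False by (intro Bochner_Integration.integral_cong) (auto simp: V_def V0_def H1_def H2_def indicator_def)
      finally show ?thesis using one by blast
    qed
    then show "expectation (\<lambda>\<omega>. H \<omega> * D k \<omega>) = 0" "expectation (\<lambda>\<omega>. H \<omega> * (D k \<omega>)\<^sup>2) = expectation (\<lambda>\<omega>. H \<omega> * V k \<omega>)"
      by auto
  qed
  \<comment> \<open>Freezing \<open>T\<close> before \<open>k1\<close> matches the vanishing of
    \<open>D\<close> and \<open>V\<close> there, so that the window for \<open>V\<close> holds at
    every index.\<close>
  define T' where "T' k = T (max k k1)" for k
  have T'_eq: "eventually (\<lambda>n. T' n = T n) sequentially"
    using eventually_ge_at_top[of k1] by eventually_elim (simp add: T'_def max_def)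
  have T'_mono: "T' n \<le> T' (Suc n)" for n
    unfolding T'_def by (rule lift_Suc_mono_le[of T, OF T_mono]) auto
  have T'_lim: "filterlim T' at_top sequentially"
    by (rule filterlim_cong[THEN iffD1, OF refl refl _ T_lim]) (use T'_eq in eventually_elim, simp)
  have T'_ratio: "(\<lambda>n. T' (Suc n) / T' n) \<longlonglongrightarrow> 1"
  proof (rule Lim_transform_eventually[OF T_ratio])
    show "eventually (\<lambda>n. T (Suc n) / T n = T' (Suc n) / T' n) sequentially"
      using eventually_ge_at_top[of k1] by eventually_elim (simp add: T'_def max_def)
  qed
  have T'_0: "0 \<le> T' 0" using T1[of k1] by (simp add: T'_def)
  have T'_inc: "T' (Suc k) - T' k = (if k < k1 then 0 else w k)" for k
    by (auto simp: T'_def w_def max_def)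
  have Vup: "V k \<omega> \<le> (1 + \<kappa>) * (T' (Suc k) - T' k)" and Vlo: "V k \<omega> \<ge> (1 - \<kappa>) * (T' (Suc k) - T' k)"
    if "\<omega> \<in> space M" for k \<omega>
    using V_window[of k \<omega>] that unfolding T'_inc by (auto simp: V_def not_less)
  have csmall: "eventually (\<lambda>n. \<forall>k<n. c k * sqrt (LL (T' n)) \<le> \<delta> * sqrt (T' n)) sequentially"
    using eventually_ge_at_top[of k1]
  proof eventually_elim
    case (elim n)
    have Tn: "T' n = T n" using elim by (simp add: T'_def max_def)
    show ?case unfolding Tn
    proof (intro allI impI)
      fix k assume "k < n"
      show "c k * sqrt (LL (T n)) \<le> \<delta> * sqrt (T n)"
      proof (cases "k < k1")
        case True
        then show ?thesis using \<delta> T1[OF elim] by (simp add: c_def)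
      next
        case False
        have "T k \<le> T n" using \<open>k < n\<close> by (intro lift_Suc_mono_le[of T, OF T_mono]) auto
        then have "T k / LL (T k) \<le> T n / LL (T n)" using k1[of k] False by (intro divide_LL_mono) auto
        then have "c k \<le> \<delta> * sqrt (T n / LL (T n))" using False \<delta> by (simp add: c_def)
        then have "c k * sqrt (LL (T n)) \<le> \<delta> * sqrt (T n / LL (T n)) * sqrt (LL (T n))"
          using L1[OF elim] by (intro mult_right_mono) auto
        also have "\<dots> = \<delta> * sqrt (T n)" using L1[OF elim] by (simp add: real_sqrt_divide)
        finally show ?thesis .
      qed
    qed
  qed
  have up: "AE \<omega> in M. eventually (\<lambda>n. D.mart 0 n \<omega> \<le> (1 + \<eta>) * sqrt (2 * T' n * LL (T' n))) sequentially"
  proof (rule D.lil_upper[OF T'_mono T'_lim T'_ratio T'_0 Vup _ csmall])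
    have "exp (2 * \<delta>) \<le> 1 + 2 * \<delta> + (2 * \<delta>)\<^sup>2" using \<delta> \<eta>2 by (intro exp_bound) (auto simp: \<delta>_def)
    also have "(2 * \<delta>)\<^sup>2 \<le> 2 * \<delta> * 1" unfolding power2_eq_square using \<delta> \<eta>2 by (intro mult_left_mono) (auto simp: \<delta>_def)
    finally have "exp (2 * \<delta>) \<le> 1 + \<eta>\<^sup>2 / 50" by (simp add: \<delta>_def)
    then have "exp (2 * \<delta>) * (1 + \<kappa>) \<le> (1 + \<eta>\<^sup>2 / 50) * (1 + \<eta>\<^sup>2 / 20)"
      using \<kappa> by (intro mult_mono) (auto simp: \<kappa>_def)
    also have "\<dots> = 1 + \<eta>\<^sup>2 / 50 + \<eta>\<^sup>2 / 20 + \<eta>\<^sup>2 / 1000 * \<eta>\<^sup>2" by (simp add: field_simps)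
    also have "\<eta>\<^sup>2 / 1000 * \<eta>\<^sup>2 \<le> \<eta>\<^sup>2 / 1000 * 1" using \<eta>2 by (intro mult_left_mono) auto
    finally have "exp (2 * \<delta>) * (1 + \<kappa>) \<le> 1 + \<eta>\<^sup>2 / 2" using \<eta>2(1) by linarith
    moreover have "\<eta>\<^sup>2 \<le> \<eta>" using \<eta> by (simp add: power2_eq_square mult_left_le)
    ultimately show "exp (2 * \<delta>) * (1 + \<kappa>) < 1 + \<eta>" using \<eta> by linarith
  qed (use \<kappa> \<delta> in auto)
  have lo: "AE \<omega> in M. frequently (\<lambda>n. D.mart 0 n \<omega> \<ge> (1 - 5 * \<eta>) * sqrt (2 * T' n * LL (T' n))) sequentially"
    by (rule D.lil_lower[OF T'_mono T'_lim T'_ratio T'_0 Vup Vlo csmall \<eta>]) (use \<kappa> \<delta> in \<open>auto simp: \<kappa>_def \<delta>_def\<close>)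
  \<comment> \<open>By \<open>truncated_averages\<close> and \<open>increments\<close>, both
    \<open>V0 k / (a k)\<^sup>2\<close> and \<open>w k / (a k)\<^sup>2\<close> tend to
    \<open>v\<close>, so their ratio ends up in the window.\<close>
  have good: "AE \<omega> in M. eventually (\<lambda>k. \<omega> \<in> J k) sequentially"
    using truncated_averages[OF b_lim] AE_space
  proof eventually_elim
    case (elim \<omega>)
    have "(\<lambda>k. (cexp k (\<lambda>x. (trunc (b k) x)\<^sup>2) \<omega> - (cexp k (trunc (b k)) \<omega>)\<^sup>2) / (w k / (a k)\<^sup>2)) \<longlonglongrightarrow> v / v"
      unfolding v_def using elim v w_lim by (intro tendsto_intros) (auto simp: v_def)
    then have "(\<lambda>k. V0 k \<omega> / w k) \<longlonglongrightarrow> 1" using v by (simp add: V0_def mult.commute)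
    then have "eventually (\<lambda>k. dist (V0 k \<omega> / w k) 1 < \<kappa>) sequentially" using \<kappa> by (intro tendstoD)
    then show ?case using eventually_ge_at_top[of k1]
    proof eventually_elim
      case (elim k)
      have w: "0 < w k" using k1[OF elim(2)] by simp
      have "\<bar>V0 k \<omega> / w k - 1\<bar> * w k \<le> \<kappa> * w k" using elim(1) w by (intro mult_right_mono) (auto simp: dist_real_def)
      moreover have "\<bar>V0 k \<omega> / w k - 1\<bar> * w k = \<bar>V0 k \<omega> - w k\<bar>"
      proof -
        have "\<bar>V0 k \<omega> / w k - 1\<bar> * w k = \<bar>(V0 k \<omega> / w k - 1) * w k\<bar>" using w by (simp add: abs_mult)
        also have "(V0 k \<omega> / w k - 1) * w k = V0 k \<omega> - w k" using w by (simp add: left_diff_distrib)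
        finally show ?thesis .
      qed
      ultimately show ?case using \<open>\<omega> \<in> space M\<close> by (simp add: J_def)
    qed
  qed
  have \<delta>2: "0 < \<delta> / 2" using \<delta> by simp
  show ?thesis using up lo good excess_negligible[OF \<delta>2]
  proof eventually_elim
    case (elim \<omega>)
    \<comment> \<open>Nonzero only at finitely many indices for a given sample point, hence
      negligible after division by the norming.\<close>
    define d where "d k = (if 2 \<le> k then a k * innov k (trunc (b k)) \<omega> else 0) - D k \<omega>" for k
    obtain K where K: "\<And>k. K \<le> k \<Longrightarrow> \<omega> \<in> J k" using elim(3) by (auto simp: eventually_sequentially)
    have d0: "d k = 0" if "max K (max k1 2) \<le> k" for k
      using that K[of k] by (simp add: d_def D_def)
    have "(\<lambda>n. \<Sum>k<n. d k) \<longlonglongrightarrow> (\<Sum>k<max K (max k1 2). d k)"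
    proof (rule tendsto_eventually)
      show "eventually (\<lambda>n. (\<Sum>k<n. d k) = (\<Sum>k<max K (max k1 2). d k)) sequentially"
        using eventually_ge_at_top[of "max K (max k1 2)"]
      proof eventually_elim
        case (elim n)
        show ?case by (rule sum.mono_neutral_right) (use elim d0 in auto)
      qed
    qed
    then have l1: "(\<lambda>n. (\<Sum>k<n. d k) / norming n) \<longlonglongrightarrow> 0"
      by (rule tendsto_divide_0[OF _ filterlim_at_top_imp_at_infinity[OF norming_lim]])
    define E where "E n = (\<Sum>k<n. d k) / norming n + (\<Sum>k=2..<n. a k * innov k (excess (\<delta> / 2 * level k)) \<omega>) / norming n" for n
    have E: "E \<longlonglongrightarrow> 0" unfolding E_def using tendsto_add[OF l1 elim(4)] by simp
    have eq: "wsum n \<omega> = D.mart 0 n \<omega> + (\<Sum>k<n. d k) + (\<Sum>k=2..<n. a k * innov k (excess (\<delta> / 2 * level k)) \<omega>)" for n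
    proof -
      have "wsum n \<omega> = (\<Sum>k=2..<n. a k * innov k (trunc (b k)) \<omega>) + (\<Sum>k=2..<n. a k * innov k (excess (\<delta> / 2 * level k)) \<omega>)"
        unfolding wsum_def sum.distrib[symmetric] distrib_left[symmetric] b_def[symmetric] innov_split[symmetric] ..
      also have "(\<Sum>k=2..<n. a k * innov k (trunc (b k)) \<omega>) = (\<Sum>k<n. if 2 \<le> k then a k * innov k (trunc (b k)) \<omega> else 0)"
        by (rule sum.mono_neutral_cong_left) auto
      also have "\<dots> = (\<Sum>k<n. D k \<omega> + d k)" by (simp add: d_def)
      also have "\<dots> = D.mart 0 n \<omega> + (\<Sum>k<n. d k)" by (simp add: sum.distrib D.mart_def atLeast0LessThan)
      finally show ?thesis .
    qed
    have pos: "eventually (\<lambda>n. 0 < norming n) sequentially" using norming_lim by (simp add: filterlim_at_top_dense)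
    have nT: "eventually (\<lambda>n. sqrt (2 * T' n * LL (T' n)) = norming n) sequentially"
      using T'_eq by eventually_elim (simp add: norming_def)
    have Esm: "eventually (\<lambda>n. \<bar>E n\<bar> < \<eta>) sequentially" using tendstoD[OF E \<eta>(1)] by (simp add: dist_real_def)
    have cmp: "eventually (\<lambda>n. \<bar>wsum n \<omega> - D.mart 0 n \<omega>\<bar> \<le> \<eta> * norming n \<and> sqrt (2 * T' n * LL (T' n)) = norming n) sequentially"
      using pos nT Esm
    proof eventually_elim
      case (elim n)
      have "wsum n \<omega> - D.mart 0 n \<omega> = E n * norming n" using elim by (simp add: eq E_def add_divide_distrib[symmetric])
      then have "\<bar>wsum n \<omega> - D.mart 0 n \<omega>\<bar> = \<bar>E n\<bar> * norming n" using elim by (simp add: abs_mult)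
      also have "\<dots> \<le> \<eta> * norming n" using elim by (intro mult_right_mono) auto
      finally show ?case using elim by simp
    qed
    show ?case
    proof
      show "eventually (\<lambda>n. wsum n \<omega> \<le> (1 + 2 * \<eta>) * norming n) sequentially"
        using elim(1) cmp
      proof eventually_elim
        case (elim n)
        have "(1 + 2 * \<eta>) * norming n = (1 + \<eta>) * norming n + \<eta> * norming n" by (simp add: algebra_simps)
        then show ?case using elim by (simp add: abs_le_iff)
      qed
      have "eventually (\<lambda>n. D.mart 0 n \<omega> \<ge> (1 - 5 * \<eta>) * sqrt (2 * T' n * LL (T' n)) \<longrightarrow> wsum n \<omega> \<ge> (1 - 6 * \<eta>) * norming n) sequentially"
        using cmp
      proof eventually_elim
        case (elim n)
        have "(1 - 6 * \<eta>) * norming n = (1 - 5 * \<eta>) * norming n - \<eta> * norming n" by (simp add: algebra_simps)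
        then show ?case using elim by (auto simp: abs_le_iff)
      qed
      then show "frequently (\<lambda>n. wsum n \<omega> \<ge> (1 - 6 * \<eta>) * norming n) sequentially"
        using elim(2) by (rule frequently_rev_mp[rotated])
    qed
  qed
qed

lemma limsup_wsum: "AE \<omega> in M. limsup (\<lambda>n. ereal (wsum n \<omega> / norming n)) = 1"
proof -
  \<comment> \<open>The offset 4 meets the condition \<open>\<eta> \<le> 1 / 4\<close>; countably
    many values of \<open>\<eta>\<close> tending to 0 suffice.\<close>
  have "AE \<omega> in M. \<forall>i::nat. eventually (\<lambda>n. wsum n \<omega> \<le> (1 + 2 * (1 / real (i + 4))) * norming n) sequentially \<and>
    frequently (\<lambda>n. wsum n \<omega> \<ge> (1 - 6 * (1 / real (i + 4))) * norming n) sequentially"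
    unfolding AE_all_countable by (intro allI wsum_bounds) auto
  then show ?thesis
  proof eventually_elim
    case (elim \<omega>)
    have pos: "eventually (\<lambda>n. 0 < norming n) sequentially" using norming_lim by (simp add: filterlim_at_top_dense)
    have upper: "limsup (\<lambda>n. ereal (wsum n \<omega> / norming n)) \<le> ereal (1 + 2 * (1 / real (i + 4)))" for i
    proof (rule Limsup_bounded)
      show "eventually (\<lambda>n. ereal (wsum n \<omega> / norming n) \<le> ereal (1 + 2 * (1 / real (i + 4)))) sequentially"
        using elim[rule_format, of i, THEN conjunct1] pos by eventually_elim (simp add: pos_divide_le_eq)
    qed
    have lower: "ereal (1 - 6 * (1 / real (i + 4))) \<le> limsup (\<lambda>n. ereal (wsum n \<omega> / norming n))" for i
    proof -
      have "frequently (\<lambda>n. ereal (1 - 6 * (1 / real (i + 4))) \<le> ereal (wsum n \<omega> / norming n)) sequentially"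
        by (rule frequently_rev_mp[OF elim[rule_format, of i, THEN conjunct2]])
          (use pos in \<open>eventually_elim, simp add: pos_le_divide_eq\<close>)
      then show ?thesis
        by (rule contrapos_pp) (auto simp: not_frequently not_le dest!: Limsup_lessD)
    qed
    have l: "(\<lambda>i. ereal (1 + 2 * (1 / real (i + 4)))) \<longlonglongrightarrow> ereal (1 + 2 * 0)" "(\<lambda>i. ereal (1 - 6 * (1 / real (i + 4)))) \<longlonglongrightarrow> ereal (1 - 6 * 0)"
    proof -
      have "(\<lambda>i. 1 / real (i + 4)) \<longlonglongrightarrow> 0" by real_asymp
      then show "(\<lambda>i. ereal (1 + 2 * (1 / real (i + 4)))) \<longlonglongrightarrow> ereal (1 + 2 * 0)" "(\<lambda>i. ereal (1 - 6 * (1 / real (i + 4)))) \<longlonglongrightarrow> ereal (1 - 6 * 0)"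
        by (intro tendsto_intros; assumption)+
    qed
    show ?case
    proof (rule antisym)
      show "limsup (\<lambda>n. ereal (wsum n \<omega> / norming n)) \<le> 1"
        using LIMSEQ_le_const[OF l(1)] upper by (simp add: one_ereal_def)
      show "1 \<le> limsup (\<lambda>n. ereal (wsum n \<omega> / norming n))"
        using LIMSEQ_le_const2[OF l(2)] lower by (simp add: one_ereal_def)
    qed
  qed
qed

end

section \<open>Weights and scales\<close>

context signed_reinforcement
begin

definition weight :: "nat \<Rightarrow> real" where
  "weight n = (\<Prod>i\<in>{1..<n}. real i / (real i + p * s))"

lemma weight_pos: "0 < weight n"
  unfolding weight_def
proof (rule prod_pos)
  fix i assume "i \<in> {1..<n}"
  then have "1 \<le> real i" by simp
  then show "0 < real i / (real i + p * s)" using ps_greater by (intro divide_pos_pos) linarith+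
qed

lemma weight_Suc: "1 \<le> n \<Longrightarrow> weight (Suc n) * (real n + p * s) = weight n * real n"
proof -
  assume n: "1 \<le> n"
  then have "1 \<le> real n" by simp
  then have "0 < real n + p * s" using ps_greater by linarith
  then show ?thesis using n by (simp add: weight_def)
qed

text \<open>\<open>weight (n + 2)\<close> is \<open>(n + 1)!\<close> over the rising factorial of
  \<open>1 + p * s\<close>, which differs from Euler's \<open>Gamma_series\<close> by powers whose
  ratio is asymptotically \<open>n powr (- p * s)\<close>.\<close>

lemma weight_asymp: "(\<lambda>n. weight n * real n powr (p * s)) \<longlonglongrightarrow> Gamma (1 + p * s)"
proof -
  define r where "r = p * s"
  have r: "- 1 < r" using ps_greater by (simp add: r_def)
  have poch: "pochhammer (1 + r) (Suc n) * weight (n + 2) = fact (Suc n)" for n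
  proof (induction n)
    case 0
    have "{1..<2::nat} = {1}" by auto
    then show ?case using r by (simp add: weight_def r_def[symmetric])
  next
    case (Suc n)
    have "weight (Suc (n + 2)) * (real (n + 2) + r) = weight (n + 2) * real (n + 2)"
      using weight_Suc[of "n + 2"] by (simp add: r_def)
    moreover have "pochhammer (1 + r) (Suc (Suc n)) = pochhammer (1 + r) (Suc n) * (real (n + 2) + r)"
      by (subst pochhammer_Suc) (simp add: algebra_simps)
    ultimately have "pochhammer (1 + r) (Suc (Suc n)) * weight (Suc n + 2) = (pochhammer (1 + r) (Suc n) * weight (n + 2)) * real (n + 2)"
      by (simp only: mult_ac add_Suc)
    then show ?case using Suc by (simp add: algebra_simps)
  qed
  have pos: "0 < pochhammer (1 + r) n" for n using r by (intro pochhammer_pos) auto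
  have eq: "weight (n + 2) * real (n + 2) powr r = Gamma_series (1 + r) n * (real (n + 1) * real (n + 2) powr r / real n powr (1 + r))"
    if "1 \<le> n" for n
  proof -
    have "weight (n + 2) = fact (Suc n) / pochhammer (1 + r) (Suc n)"
      using poch[of n] pos[of "Suc n"] by (simp add: field_simps)
    moreover have "Gamma_series (1 + r) n = fact n * real n powr (1 + r) / pochhammer (1 + r) (Suc n)"
      using that by (simp add: Gamma_series_def powr_def)
    moreover have "fact (Suc n) / P * x = fact n * q / P * (real (n + 1) * x / q)" if "q \<noteq> 0" for P x q :: real
      using that by (cases "P = 0") (simp_all add: field_simps)
    moreover have "real n powr (1 + r) \<noteq> 0" using that by simp
    ultimately show ?thesis by (simp only:)
  qed
  have "(\<lambda>n. Gamma_series (1 + r) n * (real (n + 1) * real (n + 2) powr r / real n powr (1 + r))) \<longlonglongrightarrow> Gamma (1 + r) * 1"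
  proof (rule tendsto_mult[OF Gamma_series_LIMSEQ])
    show "(\<lambda>n::nat. real (n + 1) * real (n + 2) powr r / real n powr (1 + r)) \<longlonglongrightarrow> 1" by real_asymp
  qed
  moreover have "eventually (\<lambda>n. Gamma_series (1 + r) n * (real (n + 1) * real (n + 2) powr r / real n powr (1 + r)) = weight (n + 2) * real (n + 2) powr r) sequentially"
    using eventually_ge_at_top[of 1] by eventually_elim (rule eq[symmetric])
  ultimately have "(\<lambda>n. weight (n + 2) * real (n + 2) powr r) \<longlonglongrightarrow> Gamma (1 + r) * 1"
    by (rule Lim_transform_eventually)
  then have "(\<lambda>n. weight (n + 2) * real (n + 2) powr r) \<longlonglongrightarrow> Gamma (1 + r)" by simp
  then show ?thesis unfolding r_def by (rule LIMSEQ_offset)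
qed

definition walk :: "nat \<Rightarrow> 'a \<Rightarrow> real" where "walk n \<omega> = (\<Sum>k=1..n. Y k \<omega>)"

text \<open>Given the past, the centred walk is multiplied in conditional mean by
  \<open>(n + p * s) / n\<close>, and the weight is the reciprocal of the accumulated factors. The
  centring by \<open>\<mu>\<close> is consistent because of \<open>\<mu>_eq\<close>.\<close>

lemma walk_decomposition:
  assumes "1 \<le> n"
  shows "weight n * (walk n \<omega> - \<mu> * real n) = (Y 1 \<omega> - \<mu>) + (\<Sum>k=2..<Suc n. weight k * innov k (\<lambda>x. x) \<omega>)"
  using assms
proof (induction n rule: dec_induct)
  case base
  then show ?case by (simp add: walk_def weight_def)
next
  case (step n)
  have S: "(\<Sum>j\<in>{1..<Suc n}. s * Y j \<omega>) = s * walk n \<omega>"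
    by (simp add: walk_def sum_distrib_left atLeastLessThanSuc_atLeastAtMost)
  have n0: "0 < real n" using step by simp
  have "innov (Suc n) (\<lambda>x. x) \<omega> = Y (Suc n) \<omega> - ((1 - p) * expectation (X 1) + p * s * walk n \<omega> / real n)"
    unfolding innov_def cexp_def S by simp
  also have "(1 - p) * expectation (X 1) = \<mu> - p * s * \<mu>" using \<mu>_eq by linarith
  finally have i: "innov (Suc n) (\<lambda>x. x) \<omega> = walk (Suc n) \<omega> - \<mu> * real (Suc n) - (walk n \<omega> - \<mu> * real n) * ((real n + p * s) / real n)"
    using n0 by (simp add: walk_def field_simps)
  have "weight (Suc n) * ((real n + p * s) / real n) = weight n"
    using weight_Suc[of n] step n0 by (simp add: field_simps)
  then have "weight (Suc n) * innov (Suc n) (\<lambda>x. x) \<omega> = weight (Suc n) * (walk (Suc n) \<omega> - \<mu> * real (Suc n)) - weight n * (walk n \<omega> - \<mu> * real n)"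
  proof -
    assume w: "weight (Suc n) * ((real n + p * s) / real n) = weight n"
    have "weight (Suc n) * ((walk n \<omega> - \<mu> * real n) * ((real n + p * s) / real n))
      = (weight (Suc n) * ((real n + p * s) / real n)) * (walk n \<omega> - \<mu> * real n)" by (simp only: mult_ac)
    then show ?thesis unfolding i right_diff_distrib[of "weight (Suc n)"] w by simp
  qed
  moreover have "(\<Sum>k=2..<Suc (Suc n). weight k * innov k (\<lambda>x. x) \<omega>) = (\<Sum>k=2..<Suc n. weight k * innov k (\<lambda>x. x) \<omega>) + weight (Suc n) * innov (Suc n) (\<lambda>x. x) \<omega>"
    using step by simp
  ultimately show ?case using step.IH by linarith
qed

end

text \<open>A discrete integral comparison, by telescoping. It reduces \<open>weight_sum\<close> to
  an asymptotic inequality between consecutive values; \<open>C\<close> also has to cover the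
  initial term at \<open>k0\<close>.\<close>

lemma sum_le_of_increments:
  fixes \<gamma> \<beta> :: "nat \<Rightarrow> real"
  assumes c: "0 < c" and inc: "\<And>k. k0 \<le> k \<Longrightarrow> c * \<gamma> (Suc k) \<le> \<beta> (Suc k) - \<beta> k"
    and pos: "\<And>k. k0 \<le> k \<Longrightarrow> 0 \<le> \<gamma> k" "0 < \<beta> k0"
  shows "\<exists>C\<ge>0. \<forall>n\<ge>k0. (\<Sum>k=k0..n. \<gamma> k) \<le> C * \<beta> n"
proof -
  define C where "C = max (1 / c) (\<gamma> k0 / \<beta> k0)"
  have C: "1 \<le> C * c" "\<gamma> k0 \<le> C * \<beta> k0" "0 \<le> C"
  proof -
    have "1 / c \<le> C" "\<gamma> k0 / \<beta> k0 \<le> C" by (simp_all add: C_def)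
    then show "1 \<le> C * c" "\<gamma> k0 \<le> C * \<beta> k0" using c pos(2) by (simp_all add: pos_divide_le_eq)
    show "0 \<le> C" using c by (simp add: C_def le_max_iff_disj)
  qed
  have "(\<Sum>k=k0..n. \<gamma> k) \<le> C * \<beta> n" if "k0 \<le> n" for n
    using that
  proof (induction n rule: dec_induct)
    case base
    then show ?case using C by simp
  next
    case (step n)
    have "\<gamma> (Suc n) \<le> (C * c) * \<gamma> (Suc n)" using C(1) pos(1)[of "Suc n"] step by (simp add: mult_le_cancel_right1)
    also have "\<dots> = C * (c * \<gamma> (Suc n))" by simp
    also have "\<dots> \<le> C * (\<beta> (Suc n) - \<beta> n)" using inc[of n] step C(3) by (intro mult_left_mono) auto
    finally have "\<gamma> (Suc n) \<le> C * \<beta> (Suc n) - C * \<beta> n" by (simp add: right_diff_distrib)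
    then show ?case using step by simp
  qed
  then show ?thesis using C by blast
qed

section \<open>From the weights to explicit scales\<close>

context signed_reinforcement
begin

text \<open>Replaces \<open>weight k\<close> by its asymptotic form, a Gamma value times
  \<open>k powr (- p * s)\<close>, so that only conditions on explicit functions remain. The Gamma
  value is squared because the increments of the bracket carry squared weights.\<close>

lemma reinforced_scaleI:
  fixes T :: "nat \<Rightarrow> real"
  assumes v: "0 < m2 - \<mu>\<^sup>2"
    and T: "\<And>k. T k \<le> T (Suc k)" "0 \<le> T 0" "filterlim T at_top sequentially" "(\<lambda>k. T (Suc k) / T k) \<longlonglongrightarrow> 1"
    and inc: "(\<lambda>k. (T (Suc k) - T k) * (real k powr (p * s))\<^sup>2) \<longlonglongrightarrow> (m2 - \<mu>\<^sup>2) * (Gamma (1 + p * s))\<^sup>2"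
    and lev: "filterlim (\<lambda>k. sqrt (T k / LL (T k)) * real k powr (p * s)) at_top sequentially"
    and ws: "0 < c" "eventually (\<lambda>k. c * (1 / (real (Suc k) powr (p * s) * sqrt (T (Suc k) * LL (T (Suc k)))))
       \<le> sqrt (T (Suc k) / LL (T (Suc k))) * real (Suc k) powr (p * s) - sqrt (T k / LL (T k)) * real k powr (p * s)) sequentially"
  shows "reinforced_scale M p X \<epsilon> U s weight T"
proof
  define r where "r = p * s"
  define g where "g = Gamma (1 + r)"
  have g: "0 < g" unfolding g_def using ps_greater by (intro Gamma_real_pos) (simp add: r_def)
  have wl: "(\<lambda>n. weight n * real n powr r) \<longlonglongrightarrow> g" using weight_asymp by (simp add: r_def g_def)
  show "0 < weight k" for k by (rule weight_pos)
  show "T k \<le> T (Suc k)" for k by (rule T(1))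
  show "0 \<le> T 0" "filterlim T at_top sequentially" "(\<lambda>k. T (Suc k) / T k) \<longlonglongrightarrow> 1" by (rule T)+
  show "0 < m2 - \<mu>\<^sup>2" by (rule v)
  have "(\<lambda>k. ((T (Suc k) - T k) * (real k powr r)\<^sup>2) / (weight k * real k powr r)\<^sup>2) \<longlonglongrightarrow> (m2 - \<mu>\<^sup>2) * g\<^sup>2 / g\<^sup>2"
    using tendsto_divide[OF inc[folded r_def, folded g_def] tendsto_power[OF wl, of 2]] g by simp
  moreover have "eventually (\<lambda>k. ((T (Suc k) - T k) * (real k powr r)\<^sup>2) / (weight k * real k powr r)\<^sup>2 = (T (Suc k) - T k) / (weight k)\<^sup>2) sequentially"
    using eventually_ge_at_top[of 1] by eventually_elim (simp add: power_mult_distrib)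
  ultimately have "(\<lambda>k. (T (Suc k) - T k) / (weight k)\<^sup>2) \<longlonglongrightarrow> (m2 - \<mu>\<^sup>2) * g\<^sup>2 / g\<^sup>2"
    by (rule Lim_transform_eventually)
  then show "(\<lambda>k. (T (Suc k) - T k) / (weight k)\<^sup>2) \<longlonglongrightarrow> m2 - \<mu>\<^sup>2" using g by simp
  have wi: "(\<lambda>k. 1 / (weight k * real k powr r)) \<longlonglongrightarrow> 1 / g" using wl g by (intro tendsto_intros) auto
  have "filterlim (\<lambda>k. 1 / (weight k * real k powr r) * (sqrt (T k / LL (T k)) * real k powr r)) at_top sequentially"
    using filterlim_tendsto_pos_mult_at_top[OF wi _ lev[folded r_def]] g by simp
  moreover have "eventually (\<lambda>k. 1 / (weight k * real k powr r) * (sqrt (T k / LL (T k)) * real k powr r) = sqrt (T k / LL (T k)) / weight k) sequentially"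
    using eventually_ge_at_top[of 1] by eventually_elim simp
  ultimately show "filterlim (\<lambda>k. sqrt (T k / LL (T k)) / weight k) at_top sequentially"
    by (rule filterlim_cong[OF refl refl, THEN iffD1, rotated])
  have e1: "eventually (\<lambda>k. weight k * real k powr r < 2 * g) sequentially" using order_tendstoD(2)[OF wl, of "2 * g"] g by simp
  have e2: "eventually (\<lambda>k. exp (exp 1) \<le> T k) sequentially" using T(3) by (simp add: filterlim_at_top)
  have "eventually (\<lambda>k. 1 \<le> k \<and> weight k * real k powr r < 2 * g \<and> exp (exp 1) \<le> T k \<and>
     c * (1 / (real (Suc k) powr r * sqrt (T (Suc k) * LL (T (Suc k)))))
       \<le> sqrt (T (Suc k) / LL (T (Suc k))) * real (Suc k) powr r - sqrt (T k / LL (T k)) * real k powr r) sequentially"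
    using eventually_ge_at_top[of 1] e1 e2 ws(2)[folded r_def] by eventually_elim auto
  then obtain k0 where k0: "\<And>k. k0 \<le> k \<Longrightarrow> 1 \<le> k \<and> weight k * real k powr r < 2 * g \<and> exp (exp 1) \<le> T k \<and>
     c * (1 / (real (Suc k) powr r * sqrt (T (Suc k) * LL (T (Suc k)))))
       \<le> sqrt (T (Suc k) / LL (T (Suc k))) * real (Suc k) powr r - sqrt (T k / LL (T k)) * real k powr r"
    unfolding eventually_sequentially by blast
  have L: "1 \<le> LL (T k)" if "k0 \<le> k" for k using k0[OF that] by (intro LL_ge_1) auto
  have T1: "1 < T k" if "k0 \<le> k" for k
  proof -
    have "1 < exp (exp 1 :: real)" by simp
    then show ?thesis using k0[OF that] by linarith
  qed
  define \<gamma> where "\<gamma> k = 1 / (real k powr r * sqrt (T k * LL (T k)))" for k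
  define \<beta> where "\<beta> k = sqrt (T k / LL (T k)) * real k powr r" for k
  have \<gamma>0: "0 \<le> \<gamma> k" if "k0 \<le> k" for k using T1[OF that] L[OF that] by (simp add: \<gamma>_def)
  have \<beta>0: "0 < \<beta> k" if "k0 \<le> k" for k unfolding \<beta>_def using T1[OF that] L[OF that] k0[OF that] by (intro mult_pos_pos) auto
  have "\<exists>C\<ge>0. \<forall>n\<ge>k0. (\<Sum>k=k0..n. \<gamma> k) \<le> C * \<beta> n"
  proof (rule sum_le_of_increments[OF ws(1)])
    show "c * \<gamma> (Suc k) \<le> \<beta> (Suc k) - \<beta> k" if "k0 \<le> k" for k using k0[OF that] by (simp only: \<gamma>_def \<beta>_def)
  qed (use \<gamma>0 \<beta>0 in auto)
  then obtain C where C: "0 \<le> C" "\<And>n. n \<ge> k0 \<Longrightarrow> (\<Sum>k=k0..n. \<gamma> k) \<le> C * \<beta> n" by blast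
  show "\<exists>C k0. (\<forall>k\<ge>k0. exp (exp 1) \<le> T k) \<and>
      (\<forall>n\<ge>k0. (\<Sum>k=k0..n. weight k / sqrt (T k * LL (T k))) \<le> C * (sqrt (T n / LL (T n)) / weight n))"
  proof (intro exI[of _ "2 * g * C * (2 * g)"] exI[of _ k0] conjI allI impI)
    show "exp (exp 1) \<le> T k" if "k0 \<le> k" for k using k0[OF that] by blast
    fix n assume n: "k0 \<le> n"
    have "(\<Sum>k=k0..n. weight k / sqrt (T k * LL (T k))) = (\<Sum>k=k0..n. (weight k * real k powr r) * \<gamma> k)"
    proof (intro sum.cong refl)
      fix k assume "k \<in> {k0..n}"
      then have "0 < real k powr r" using k0[of k] by simp
      then show "weight k / sqrt (T k * LL (T k)) = (weight k * real k powr r) * \<gamma> k" by (simp add: \<gamma>_def)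
    qed
    also have "\<dots> \<le> (\<Sum>k=k0..n. 2 * g * \<gamma> k)"
      using k0 \<gamma>0 by (intro sum_mono mult_right_mono) (auto simp: less_imp_le)
    also have "\<dots> = 2 * g * (\<Sum>k=k0..n. \<gamma> k)" by (simp add: sum_distrib_left)
    also have "\<dots> \<le> 2 * g * (C * \<beta> n)" using C(2)[OF n] g by (intro mult_left_mono) auto
    also have "\<beta> n = (weight n * real n powr r) * (sqrt (T n / LL (T n)) / weight n)"
      using weight_pos[of n] by (simp add: \<beta>_def)
    also have "2 * g * (C * ((weight n * real n powr r) * (sqrt (T n / LL (T n)) / weight n)))
      \<le> 2 * g * (C * ((2 * g) * (sqrt (T n / LL (T n)) / weight n)))"
    proof (intro mult_left_mono mult_right_mono)
      show "0 \<le> sqrt (T n / LL (T n)) / weight n"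
        using weight_pos[of n] T1[OF n] L[OF n] by (intro divide_nonneg_nonneg) auto
      show "weight n * real n powr r \<le> 2 * g" using k0[OF n] by simp
    qed (use g C in auto)
    finally show "(\<Sum>k=k0..n. weight k / sqrt (T k * LL (T k))) \<le> 2 * g * C * (2 * g) * (sqrt (T n / LL (T n)) / weight n)"
      by (simp only: mult.assoc)
  qed
qed

text \<open>Divide \<open>walk_decomposition\<close> by \<open>weight n\<close>: the initial term is
  negligible and the normings compare through \<open>weight_asymp\<close>. The shift to
  \<open>Suc n\<close> comes from the exclusive upper end of \<open>wsum\<close>.\<close>

lemma limsup_walk_of_scale:
  fixes T N :: "nat \<Rightarrow> real"
  assumes scale: "reinforced_scale M p X \<epsilon> U s weight T"
    and ratio: "(\<lambda>n. sqrt (2 * T (Suc n) * LL (T (Suc n))) * real n powr (p * s) / N n) \<longlonglongrightarrow> L" and L: "0 < L"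
  shows "AE \<omega> in M. limsup (\<lambda>n. ereal ((walk n \<omega> - \<mu> * real n) / N n)) = ereal (L / Gamma (1 + p * s))"
proof -
  interpret reinforced_scale M p X \<epsilon> U s weight T by (rule scale)
  define g where "g = Gamma (1 + p * s)"
  have g: "0 < g" unfolding g_def using ps_greater by (intro Gamma_real_pos) simp
  define u where "u n = norming (Suc n) / (weight n * N n)" for n
  have nlim: "filterlim (\<lambda>n. norming (Suc n)) at_top sequentially"
    by (rule filterlim_compose[OF norming_lim filterlim_Suc])
  have u: "u \<longlonglongrightarrow> L / g"
  proof (rule Lim_transform_eventually)
    show "(\<lambda>n. (norming (Suc n) * real n powr (p * s) / N n) / (weight n * real n powr (p * s))) \<longlonglongrightarrow> L / g"
      using ratio weight_asymp g unfolding norming_def g_def by (intro tendsto_divide) auto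
    show "eventually (\<lambda>n. (norming (Suc n) * real n powr (p * s) / N n) / (weight n * real n powr (p * s)) = u n) sequentially"
      using eventually_ge_at_top[of 1] by eventually_elim (simp add: u_def field_simps)
  qed
  have Lg: "0 < L / g" using L g by simp
  show ?thesis using limsup_wsum
  proof eventually_elim
    case (elim \<omega>)
    have lim: "limsup (\<lambda>n. ereal (wsum (Suc n) \<omega> / norming (Suc n))) = 1"
      using limsup_shift[of "\<lambda>n. ereal (wsum n \<omega> / norming n)"] elim by simp
    have small: "(\<lambda>n. (Y 1 \<omega> - \<mu>) / norming (Suc n) * u n) \<longlonglongrightarrow> 0 * (L / g)"
      by (intro tendsto_mult u tendsto_divide_0[OF tendsto_const filterlim_at_top_imp_at_infinity[OF nlim]])
    have "limsup (\<lambda>n. ereal (u n) * ereal (wsum (Suc n) \<omega> / norming (Suc n))) = ereal (L / g) * 1"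
      unfolding lim[symmetric] by (rule ereal_limsup_lim_mult) (use u Lg in auto)
    then have m: "limsup (\<lambda>n. ereal (u n * (wsum (Suc n) \<omega> / norming (Suc n)))) = ereal (L / g)" by simp
    have "limsup (\<lambda>n. ereal ((Y 1 \<omega> - \<mu>) / norming (Suc n) * u n) + ereal (u n * (wsum (Suc n) \<omega> / norming (Suc n)))) = ereal 0 + ereal (L / g)"
      unfolding m[symmetric] by (rule ereal_limsup_lim_add) (use small in auto)
    also have "\<dots> = ereal (L / g)" by simp
    finally have "limsup (\<lambda>n. ereal ((Y 1 \<omega> - \<mu>) / norming (Suc n) * u n) + ereal (u n * (wsum (Suc n) \<omega> / norming (Suc n)))) = ereal (L / g)" .
    moreover have "eventually (\<lambda>n. ereal ((Y 1 \<omega> - \<mu>) / norming (Suc n) * u n) + ereal (u n * (wsum (Suc n) \<omega> / norming (Suc n)))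
       = ereal ((walk n \<omega> - \<mu> * real n) / N n)) sequentially"
    proof -
      have "eventually (\<lambda>n. norming (Suc n) > 0) sequentially" using nlim by (simp add: filterlim_at_top_dense)
      then show ?thesis using eventually_ge_at_top[of 1]
      proof eventually_elim
        case (elim n)
        have wp: "0 < weight n" by (rule weight_pos)
        have d: "weight n * (walk n \<omega> - \<mu> * real n) = (Y 1 \<omega> - \<mu>) + wsum (Suc n) \<omega>"
          using walk_decomposition[OF elim(2)] by (simp add: wsum_def)
        have "(Y 1 \<omega> - \<mu>) / norming (Suc n) * u n + u n * (wsum (Suc n) \<omega> / norming (Suc n))
          = ((Y 1 \<omega> - \<mu>) + wsum (Suc n) \<omega>) / (weight n * N n)"
          using elim by (simp add: u_def add_divide_distrib)
        also have "\<dots> = (walk n \<omega> - \<mu> * real n) / N n" unfolding d[symmetric] using wp by simp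
        finally show ?case by simp
      qed
    qed
    ultimately show ?case unfolding g_def by (simp only: Limsup_eq)
  qed
qed

text \<open>\<open>h\<close> is the shape of the bracket, \<open>e\<close> that of the variance of
  the walk, and \<open>d\<close> the limit of the rescaled increments of \<open>h\<close>. The
  factor \<open>C\<close> fits the bracket to the conditional variances; it is invisible inside the
  iterated logarithm, and outside the Gamma value cancels and leaves
  \<open>(m2 - \<mu>\<^sup>2) / d\<close>.\<close>

lemma lil_of_profile:
  fixes h e N :: "nat \<Rightarrow> real"
  assumes v: "0 < m2 - \<mu>\<^sup>2"
    and h: "\<And>k. h k \<le> h (Suc k)" "0 \<le> h 0" "filterlim h at_top sequentially" "(\<lambda>k. h (Suc k) / h k) \<longlonglongrightarrow> 1"
    and he: "\<And>k. sqrt (h k) * real k powr (p * s) = sqrt (e k)"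
    and d: "(\<lambda>k. (h (Suc k) - h k) * (real k powr (p * s))\<^sup>2) \<longlonglongrightarrow> d" "0 < d"
    and lev: "\<And>C. 0 < C \<Longrightarrow> filterlim (\<lambda>k. sqrt (e k / LL (C * h k))) at_top sequentially"
    and inc: "\<And>C. 0 < C \<Longrightarrow> eventually (\<lambda>k. 1 / 4 < (sqrt (e (Suc k) / LL (C * h (Suc k))) - sqrt (e k / LL (C * h k)))
       * sqrt (e (Suc k) * LL (C * h (Suc k))) \<and> 0 < sqrt (e (Suc k) * LL (C * h (Suc k)))) sequentially"
    and N: "\<And>C. 0 < C \<Longrightarrow> (\<lambda>n. sqrt (LL (C * h (Suc n))) / sqrt (N n)) \<longlonglongrightarrow> 1"
  shows "AE \<omega> in M. limsup (\<lambda>n. ereal ((walk n \<omega> - \<mu> * real n) / sqrt (2 * e n * N n))) = ereal (sqrt ((m2 - \<mu>\<^sup>2) / d))"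
proof -
  define g where "g = Gamma (1 + p * s)"
  define C where "C = (m2 - \<mu>\<^sup>2) * g\<^sup>2 / d"
  define T where "T k = C * h k" for k
  have g: "0 < g" unfolding g_def using ps_greater by (intro Gamma_real_pos) simp
  have C: "0 < C" unfolding C_def using v g d by simp
  have TC: "sqrt (T k) * real k powr (p * s) = sqrt C * sqrt (e k)" for k
    unfolding T_def real_sqrt_mult mult.assoc he ..
  have lev_eq: "sqrt (T k / LL (T k)) * real k powr (p * s) = sqrt C * sqrt (e k / LL (T k))" for k
    using TC[of k] by (simp add: real_sqrt_divide)
  have wt_eq: "1 / (real k powr (p * s) * sqrt (T k * LL (T k))) = 1 / sqrt C * (1 / sqrt (e k * LL (T k)))" for k
  proof -
    have "real k powr (p * s) * sqrt (T k * LL (T k)) = (sqrt (T k) * real k powr (p * s)) * sqrt (LL (T k))"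
      by (simp add: real_sqrt_mult)
    then show ?thesis unfolding TC by (simp add: real_sqrt_mult)
  qed
  have scale: "reinforced_scale M p X \<epsilon> U s weight T"
  proof (rule reinforced_scaleI[OF v])
    show "T k \<le> T (Suc k)" for k unfolding T_def using C h(1) by (intro mult_left_mono) auto
    show "0 \<le> T 0" unfolding T_def using C h(2) by simp
    show "filterlim T at_top sequentially"
      unfolding T_def[abs_def] by (rule filterlim_tendsto_pos_mult_at_top[OF tendsto_const C h(3)])
    show "(\<lambda>k. T (Suc k) / T k) \<longlonglongrightarrow> 1" unfolding T_def using C h(4) by simp
    have "(\<lambda>k. C * ((h (Suc k) - h k) * (real k powr (p * s))\<^sup>2)) \<longlonglongrightarrow> C * d" by (intro tendsto_intros d)
    moreover have "C * d = (m2 - \<mu>\<^sup>2) * g\<^sup>2" using d by (simp add: C_def)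
    ultimately show "(\<lambda>k. (T (Suc k) - T k) * (real k powr (p * s))\<^sup>2) \<longlonglongrightarrow> (m2 - \<mu>\<^sup>2) * (Gamma (1 + p * s))\<^sup>2"
      unfolding T_def g_def[symmetric] right_diff_distrib[symmetric] by (simp only: mult.assoc)
    show "filterlim (\<lambda>k. sqrt (T k / LL (T k)) * real k powr (p * s)) at_top sequentially"
      unfolding lev_eq by (rule filterlim_tendsto_pos_mult_at_top[OF tendsto_const _ lev[OF C, folded T_def]]) (use C in simp)
    show "0 < C / 4" using C by simp
    show "eventually (\<lambda>k. C / 4 * (1 / (real (Suc k) powr (p * s) * sqrt (T (Suc k) * LL (T (Suc k)))))
       \<le> sqrt (T (Suc k) / LL (T (Suc k))) * real (Suc k) powr (p * s) - sqrt (T k / LL (T k)) * real k powr (p * s)) sequentially"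
      using inc[OF C, folded T_def]
    proof eventually_elim
      case (elim k)
      then have "1 / 4 * (1 / sqrt (e (Suc k) * LL (T (Suc k)))) \<le> sqrt (e (Suc k) / LL (T (Suc k))) - sqrt (e k / LL (T k))"
        by (simp add: pos_divide_le_eq)
      then have "sqrt C * (1 / 4 * (1 / sqrt (e (Suc k) * LL (T (Suc k))))) \<le> sqrt C * (sqrt (e (Suc k) / LL (T (Suc k))) - sqrt (e k / LL (T k)))"
        using C by (intro mult_left_mono) auto
      moreover have "C / 4 * (1 / sqrt C * D) = sqrt C * (1 / 4 * D)" for D
      proof -
        have "C / 4 * (1 / sqrt C * D) = C / sqrt C * (1 / 4 * D)" by simp
        then show ?thesis using C by (simp only: real_div_sqrt less_imp_le)
      qed
      ultimately show ?case unfolding lev_eq wt_eq by (simp only: right_diff_distrib)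
    qed
  qed
  have "(\<lambda>n. sqrt (2 * T (Suc n) * LL (T (Suc n))) * real n powr (p * s) / sqrt (2 * e n * N n)) \<longlonglongrightarrow> sqrt C"
  proof (rule Lim_transform_eventually)
    have "(\<lambda>n. sqrt C * sqrt (h (Suc n) / h n) * (sqrt (LL (C * h (Suc n))) / sqrt (N n))) \<longlonglongrightarrow> sqrt C * sqrt 1 * 1"
      by (intro tendsto_intros h(4) N C)
    then show "(\<lambda>n. sqrt C * sqrt (h (Suc n) / h n) * (sqrt (LL (C * h (Suc n))) / sqrt (N n))) \<longlonglongrightarrow> sqrt C" by simp
    have "eventually (\<lambda>n. 0 < h n) sequentially" using h(3) by (simp add: filterlim_at_top_dense)
    then show "eventually (\<lambda>n. sqrt C * sqrt (h (Suc n) / h n) * (sqrt (LL (C * h (Suc n))) / sqrt (N n))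
      = sqrt (2 * T (Suc n) * LL (T (Suc n))) * real n powr (p * s) / sqrt (2 * e n * N n)) sequentially"
      using eventually_ge_at_top[of 1]
    proof eventually_elim
      case (elim n)
      then show ?case by (simp add: T_def real_sqrt_mult real_sqrt_divide he[symmetric])
    qed
  qed
  from limsup_walk_of_scale[OF scale this] C
  have "AE \<omega> in M. limsup (\<lambda>n. ereal ((walk n \<omega> - \<mu> * real n) / sqrt (2 * e n * N n))) = ereal (sqrt C / g)"
    by (simp add: g_def)
  moreover have "sqrt C / g = sqrt ((m2 - \<mu>\<^sup>2) / d)"
    using g by (simp add: C_def real_sqrt_mult real_sqrt_divide)
  ultimately show ?thesis by simp
qed

text \<open>The squares of \<open>k powr (- p * s)\<close> add up to a multiple of
  \<open>k powr q\<close> with \<open>q = 1 - 2 * (p * s)\<close>; the rescaled increments of this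
  power tend to \<open>q\<close>, which is the constant in the limit.\<close>

lemma lil_subcritical:
  assumes v: "0 < m2 - \<mu>\<^sup>2" and r: "p * s < 1 / 2"
  shows "AE \<omega> in M. limsup (\<lambda>n. ereal ((walk n \<omega> - \<mu> * real n) / sqrt (2 * real n * ln (ln (real n)))))
    = ereal (sqrt ((m2 - \<mu>\<^sup>2) / (1 - 2 * (p * s))))"
proof -
  define q where "q = 1 - 2 * (p * s)"
  have q: "0 < q" using r by (simp add: q_def)
  have ps: "p * s = (1 - q) / 2" by (simp add: q_def)
  show ?thesis unfolding q_def[symmetric]
  proof (rule lil_of_profile[OF v, where h = "\<lambda>k. real k powr q"])
    show "real k powr q \<le> real (Suc k) powr q" for k using q by (intro powr_mono2) auto
    show "filterlim (\<lambda>k. real k powr q) at_top sequentially" using q by real_asymp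
    show "(\<lambda>k. real (Suc k) powr q / real k powr q) \<longlonglongrightarrow> 1" using q by real_asymp
    show "sqrt (real k powr q) * real k powr (p * s) = sqrt (real k)" for k
    proof -
      have "sqrt (real k powr q) = real k powr (q / 2)" by (simp add: powr_half_sqrt[symmetric] powr_powr)
      then show ?thesis unfolding ps by (simp add: powr_add[symmetric] add_divide_distrib[symmetric] powr_half_sqrt)
    qed
    have "(\<lambda>k::nat. (real (Suc k) powr q - real k powr q) * real k powr (1 - q)) \<longlonglongrightarrow> q" using q by real_asymp
    moreover have "real k powr (1 - q) = (real k powr (p * s))\<^sup>2" for k
      unfolding ps power2_eq_square by (simp add: powr_add[symmetric])
    ultimately show "(\<lambda>k. (real (Suc k) powr q - real k powr q) * (real k powr (p * s))\<^sup>2) \<longlonglongrightarrow> q" by simp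
    fix C :: real assume C: "0 < C"
    show "filterlim (\<lambda>k. sqrt (real k / LL (C * real k powr q))) at_top sequentially"
      unfolding LL_def using C q by real_asymp
    \<comment> \<open>The limit is that of \<open>(sqrt (k + 1) - sqrt k) * sqrt (k + 1)\<close>,
      since the iterated logarithm varies too slowly to matter; it exceeds the required
      \<open>1 / 4\<close>.\<close>
    have "(\<lambda>k::nat. (sqrt (real (Suc k) / ln (ln (C * real (Suc k) powr q))) - sqrt (real k / ln (ln (C * real k powr q)))) * sqrt (real (Suc k) * ln (ln (C * real (Suc k) powr q)))) \<longlonglongrightarrow> 1 / 2"
      using C q by real_asymp
    then have "eventually (\<lambda>k::nat. 1 / 4 < (sqrt (real (Suc k) / ln (ln (C * real (Suc k) powr q))) - sqrt (real k / ln (ln (C * real k powr q)))) * sqrt (real (Suc k) * ln (ln (C * real (Suc k) powr q)))) sequentially"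
      by (rule order_tendstoD) simp
    moreover have "eventually (\<lambda>k::nat. 0 < sqrt (real (Suc k) * ln (ln (C * real (Suc k) powr q)))) sequentially"
      using C q by real_asymp
    ultimately show "eventually (\<lambda>k. 1 / 4 < (sqrt (real (Suc k) / LL (C * real (Suc k) powr q)) - sqrt (real k / LL (C * real k powr q)))
       * sqrt (real (Suc k) * LL (C * real (Suc k) powr q)) \<and> 0 < sqrt (real (Suc k) * LL (C * real (Suc k) powr q))) sequentially"
      unfolding LL_def by (rule eventually_conj)
    show "(\<lambda>n. sqrt (LL (C * real (Suc n) powr q)) / sqrt (ln (ln (real n)))) \<longlonglongrightarrow> 1"
      unfolding LL_def using C q by real_asymp
  qed (use q in auto)
qed

text \<open>At \<open>p * s = 1 / 2\<close> the squared weights behave like \<open>1 / k\<close>, so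
  the bracket is logarithmic: this is the origin of the factor \<open>ln n\<close> and of the third
  logarithm.\<close>

lemma lil_critical:
  assumes v: "0 < m2 - \<mu>\<^sup>2" and r: "p * s = 1 / 2"
  shows "AE \<omega> in M. limsup (\<lambda>n. ereal ((walk n \<omega> - \<mu> * real n) / sqrt (2 * real n * ln (real n) * ln (ln (ln (real n))))))
    = ereal (sqrt (m2 - \<mu>\<^sup>2))"
proof -
  have pw: "real k powr (p * s) = sqrt (real k)" for k unfolding r by (simp add: powr_half_sqrt)
  have "AE \<omega> in M. limsup (\<lambda>n. ereal ((walk n \<omega> - \<mu> * real n) / sqrt (2 * (real n * ln (real n)) * ln (ln (ln (real n))))))
    = ereal (sqrt ((m2 - \<mu>\<^sup>2) / 1))"
  proof (rule lil_of_profile[OF v, where h = "\<lambda>k. ln (real k)"])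
    show "ln (real k) \<le> ln (real (Suc k))" for k by (cases "k = 0") auto
    show "filterlim (\<lambda>k. ln (real k)) at_top sequentially" by real_asymp
    show "(\<lambda>k. ln (real (Suc k)) / ln (real k)) \<longlonglongrightarrow> 1" by real_asymp
    show "sqrt (ln (real k)) * real k powr (p * s) = sqrt (real k * ln (real k))" for k
      unfolding pw by (simp add: real_sqrt_mult)
    show "(\<lambda>k. (ln (real (Suc k)) - ln (real k)) * (real k powr (p * s))\<^sup>2) \<longlonglongrightarrow> 1"
      unfolding pw by real_asymp
    fix C :: real assume C: "0 < C"
    show "filterlim (\<lambda>k. sqrt (real k * ln (real k) / LL (C * ln (real k)))) at_top sequentially"
      unfolding LL_def using C by real_asymp
    \<comment> \<open>The factor \<open>ln k\<close> in the variance makes this product diverge,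
      where the subcritical case has the limit \<open>1 / 2\<close>.\<close>
    have "filterlim (\<lambda>k::nat. (sqrt (real (Suc k) * ln (real (Suc k)) / ln (ln (C * ln (real (Suc k))))) - sqrt (real k * ln (real k) / ln (ln (C * ln (real k))))) * sqrt (real (Suc k) * ln (real (Suc k)) * ln (ln (C * ln (real (Suc k)))))) at_top sequentially"
      using C by real_asymp
    then have "eventually (\<lambda>k::nat. 1 / 4 < (sqrt (real (Suc k) * ln (real (Suc k)) / ln (ln (C * ln (real (Suc k))))) - sqrt (real k * ln (real k) / ln (ln (C * ln (real k))))) * sqrt (real (Suc k) * ln (real (Suc k)) * ln (ln (C * ln (real (Suc k)))))) sequentially"
      unfolding filterlim_at_top_dense by blast
    moreover have "eventually (\<lambda>k::nat. 0 < sqrt (real (Suc k) * ln (real (Suc k)) * ln (ln (C * ln (real (Suc k)))))) sequentially"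
      using C by real_asymp
    ultimately show "eventually (\<lambda>k. 1 / 4 < (sqrt (real (Suc k) * ln (real (Suc k)) / LL (C * ln (real (Suc k)))) - sqrt (real k * ln (real k) / LL (C * ln (real k))))
       * sqrt (real (Suc k) * ln (real (Suc k)) * LL (C * ln (real (Suc k)))) \<and> 0 < sqrt (real (Suc k) * ln (real (Suc k)) * LL (C * ln (real (Suc k))))) sequentially"
      unfolding LL_def by (rule eventually_conj)
    show "(\<lambda>n. sqrt (LL (C * ln (real (Suc n)))) / sqrt (ln (ln (ln (real n))))) \<longlonglongrightarrow> 1"
      unfolding LL_def using C by real_asymp
  qed auto
  then show ?thesis by (simp add: mult.assoc)
qed

text \<open>For \<open>s = 1\<close> the hypothesis says that \<open>X 1\<close> has variance 0. For
  \<open>s = - 1\<close>, \<open>\<mu>\<close> is the mean of \<open>X 1\<close> times a factor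
  strictly between 0 and 1, so nonnegativity of the variance forces the mean and then
  \<open>X 1\<close> itself to vanish. Either way the innovations are constant with a value that the
  copying sign preserves.\<close>

lemma degenerate_walk:
  assumes v: "m2 - \<mu>\<^sup>2 = 0"
  shows "AE \<omega> in M. \<forall>n. walk n \<omega> = \<mu> * real n"
proof -
  have sm: "\<mu> = expectation (X 1) \<or> (\<mu> = 0 \<and> s = - 1)"
  proof (cases "s = 1")
    case True
    then show ?thesis unfolding \<mu>_def using p by simp
  next
    case False
    then have s1: "s = - 1" using s by simp
    define c where "c = (1 - p) / (1 + p)"
    have c: "0 < c" "c < 1" using p by (simp_all add: c_def)
    have mu: "\<mu> = c * expectation (X 1)" unfolding \<mu>_def using s1 by (simp add: c_def)
    have "0 \<le> variance (X 1)" by (rule variance_positive)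
    then have "(expectation (X 1))\<^sup>2 \<le> m2" using variance_eq[OF integrable_X1 X_square] unfolding m2_def by linarith
    also have "m2 = c\<^sup>2 * (expectation (X 1))\<^sup>2" using v mu by (simp add: power_mult_distrib)
    finally have "(1 - c\<^sup>2) * (expectation (X 1))\<^sup>2 \<le> 0" by (simp add: algebra_simps)
    moreover have "c\<^sup>2 < 1" using c by (simp add: power_less_one_iff)
    ultimately have "(expectation (X 1))\<^sup>2 \<le> 0" by (simp add: mult_le_0_iff)
    then have "expectation (X 1) = 0" by simp
    then show ?thesis using mu s1 by simp
  qed
  have s\<mu>: "s * \<mu> = \<mu>"
  proof (cases "s = 1")
    case False
    then have "s = - 1" using s by simp
    have "\<mu> = 0"
    proof (rule ccontr)
      assume "\<mu> \<noteq> 0"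
      then have "\<mu> = expectation (X 1)" using sm by simp
      moreover have "\<mu> = (1 - p) * expectation (X 1) / (1 + p)" unfolding \<mu>_def using \<open>s = - 1\<close> by simp
      ultimately have "(1 - p) * \<mu> / (1 + p) = \<mu>" by metis
      then show False using p \<open>\<mu> \<noteq> 0\<close> by (simp add: field_simps)
    qed
    then show ?thesis by simp
  qed simp
  have E: "expectation (\<lambda>\<omega>. (X 1 \<omega> - \<mu>)\<^sup>2) = 0"
  proof -
    have "expectation (\<lambda>\<omega>. (X 1 \<omega> - \<mu>)\<^sup>2) = expectation (\<lambda>\<omega>. (X 1 \<omega>)\<^sup>2 - 2 * \<mu> * X 1 \<omega> + \<mu>\<^sup>2)"
      by (intro Bochner_Integration.integral_cong) (auto simp: power2_eq_square algebra_simps)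
    also have "\<dots> = m2 - 2 * \<mu> * expectation (X 1) + \<mu>\<^sup>2"
      using X_square integrable_X1 by (simp add: m2_def prob_space)
    also have "\<dots> = 0" using v sm by (auto simp: power2_eq_square)
    finally show ?thesis .
  qed
  have int: "integrable M (\<lambda>\<omega>. (X 1 \<omega> - \<mu>)\<^sup>2)"
  proof -
    have "integrable M (\<lambda>\<omega>. (X 1 \<omega>)\<^sup>2 - 2 * \<mu> * X 1 \<omega> + \<mu>\<^sup>2)" using X_square integrable_X1 by simp
    then show ?thesis by (simp add: power2_eq_square algebra_simps)
  qed
  have "AE \<omega> in M. X n \<omega> = \<mu>" if "1 \<le> n" for n
  proof -
    have i: "integrable M (\<lambda>\<omega>. (X n \<omega> - \<mu>)\<^sup>2)" using integrable_X[of "\<lambda>x. (x - \<mu>)\<^sup>2" n] int that by (simp add: comp_def)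
    have "expectation (\<lambda>\<omega>. (X n \<omega> - \<mu>)\<^sup>2) = 0" using expectation_X[of "\<lambda>x. (x - \<mu>)\<^sup>2" n] that E by simp
    then have "AE \<omega> in M. (X n \<omega> - \<mu>)\<^sup>2 = 0" using integral_nonneg_eq_0_iff_AE[OF i] by simp
    then show ?thesis by eventually_elim simp
  qed
  then have "AE \<omega> in M. \<forall>n. 1 \<le> n \<longrightarrow> X n \<omega> = \<mu>" by (simp add: AE_all_countable)
  then show ?thesis
  proof eventually_elim
    case (elim \<omega>)
    have "Y n \<omega> = \<mu>" if "1 \<le> n" for n
      using that
    proof (induction n rule: less_induct)
      case (less n)
      then show ?case using elim by (subst Y_rec) (auto simp: s\<mu>)
    qed
    then show ?case by (simp add: walk_def)
  qed
qed

lemma limsup_degenerate: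
  assumes "m2 - \<mu>\<^sup>2 = 0"
  shows "AE \<omega> in M. limsup (\<lambda>n. ereal ((walk n \<omega> - \<mu> * real n) / N n)) = ereal 0"
  using degenerate_walk[OF assms] by eventually_elim (simp add: Limsup_const)

end

theorem corollary1p1:
  fixes M :: "'a measure" and p :: real
    and X :: "nat \<Rightarrow> 'a \<Rightarrow> real" and \<epsilon> :: "nat \<Rightarrow> 'a \<Rightarrow> bool" and U :: "nat \<Rightarrow> 'a \<Rightarrow> nat"
    and m1 m2 \<sigma> \<mu>' \<sigma>' :: real
  assumes reinforced: "step_reinforcement M p X \<epsilon> U"
    and second_moment: "integrable M (\<lambda>\<omega>. (X 1 \<omega>)\<^sup>2)"
    and m1: "m1 = prob_space.expectation M (X 1)"
    and m2: "m2 = prob_space.expectation M (\<lambda>\<omega>. (X 1 \<omega>)\<^sup>2)"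
    and sigma: "\<sigma> \<ge> 0" "\<sigma>\<^sup>2 = prob_space.variance M (X 1)"
    and neg_mu: "\<mu>' = (1 - p) * m1 / (1 + p)"
    and neg_sigma: "\<sigma>' \<ge> 0" "\<sigma>'\<^sup>2 = m2 - ((1 - p) * m1 / (1 + p))\<^sup>2"
  shows "(0 < p \<and> p < 1 / 2 \<longrightarrow>
           (AE \<omega> in M.
              limsup (\<lambda>n. ereal ((pos_walk X \<epsilon> U n \<omega> - m1 * real n) /
                                  sqrt (2 * real n * ln (ln (real n)))))
              = ereal (\<sigma> / sqrt (1 - 2 * p))))
       \<and> (p = 1 / 2 \<longrightarrow>
           (AE \<omega> in M.
              limsup (\<lambda>n. ereal ((pos_walk X \<epsilon> U n \<omega> - m1 * real n) /
                                  sqrt (2 * real n * ln (real n) * ln (ln (ln (real n))))))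
              = ereal \<sigma>))
       \<and> (0 < p \<and> p < 1 \<longrightarrow>
           (AE \<omega> in M.
              limsup (\<lambda>n. ereal ((neg_walk X \<epsilon> U n \<omega> - \<mu>' * real n) /
                                  sqrt (2 * real n * ln (ln (real n)))))
              = ereal (\<sigma>' / sqrt (2 * p + 1))))"
proof -
  have loc: "signed_reinforcement M p X \<epsilon> U s" if "s = 1 \<or> s = - 1" "0 < p" "p < 1" for s :: real
    using reinforced second_moment that
    by (intro signed_reinforcement.intro signed_reinforcement_axioms.intro) auto
  have pos: "pos_walk X \<epsilon> U n \<omega> = signed_reinforcement.walk X \<epsilon> U 1 n \<omega>"
    and pos_\<mu>: "signed_reinforcement.\<mu> M p X 1 = m1" and pos_v: "signed_reinforcement.m2 M X - (signed_reinforcement.\<mu> M p X 1)\<^sup>2 = \<sigma>\<^sup>2"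
    if p: "0 < p" "p < 1" for n \<omega>
  proof -
    interpret P: signed_reinforcement M p X \<epsilon> U 1 by (rule loc) (use p in auto)
    show "pos_walk X \<epsilon> U n \<omega> = P.walk n \<omega>" by (simp add: pos_walk_def P.walk_def P.Y_def pos_step_eq)
    show mu: "P.\<mu> = m1" using p by (simp add: P.\<mu>_def m1)
    show "P.m2 - P.\<mu>\<^sup>2 = \<sigma>\<^sup>2"
      unfolding mu sigma(2) using P.variance_eq[OF P.integrable_X1 P.X_square] by (simp add: P.m2_def m1)
  qed
  have neg: "neg_walk X \<epsilon> U n \<omega> = signed_reinforcement.walk X \<epsilon> U (- 1) n \<omega>"
    and neg_\<mu>: "signed_reinforcement.\<mu> M p X (- 1) = \<mu>'" and neg_v: "signed_reinforcement.m2 M X - (signed_reinforcement.\<mu> M p X (- 1))\<^sup>2 = \<sigma>'\<^sup>2"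
    if p: "0 < p" "p < 1" for n \<omega>
  proof -
    interpret N: signed_reinforcement M p X \<epsilon> U "- 1" by (rule loc) (use p in auto)
    show "neg_walk X \<epsilon> U n \<omega> = N.walk n \<omega>" by (simp add: neg_walk_def N.walk_def N.Y_def neg_step_eq)
    show mu: "N.\<mu> = \<mu>'" by (simp add: N.\<mu>_def m1 neg_mu)
    show "N.m2 - N.\<mu>\<^sup>2 = \<sigma>'\<^sup>2" unfolding mu neg_sigma(2) by (simp add: N.m2_def m2 neg_mu)
  qed
  have part1: "AE \<omega> in M. limsup (\<lambda>n. ereal ((pos_walk X \<epsilon> U n \<omega> - m1 * real n) / sqrt (2 * real n * ln (ln (real n)))))
      = ereal (\<sigma> / sqrt (1 - 2 * p))" if p: "0 < p" "p < 1 / 2"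
  proof -
    have p1: "p < 1" using p by simp
    interpret P: signed_reinforcement M p X \<epsilon> U 1 by (rule loc) (use p in auto)
    note v = pos_v[OF p(1) p1] and mu = pos_\<mu>[OF p(1) p1] and walk = pos[OF p(1) p1]
    show ?thesis
    \<comment> \<open>\<open>reinforced_scale\<close> requires a positive limiting variance, so
      constant steps are treated apart.\<close>
    proof (cases "\<sigma> = 0")
      case True
      then have "P.m2 - P.\<mu>\<^sup>2 = 0" unfolding v by simp
      from P.limsup_degenerate[OF this] True show ?thesis unfolding mu walk by simp
    next
      case False
      then have v0: "0 < P.m2 - P.\<mu>\<^sup>2" unfolding v by simp
      have r: "p * 1 < 1 / 2" using p by simp
      show ?thesis using P.lil_subcritical[OF v0 r, unfolded v, unfolded mu] sigma(1) unfolding walk by (simp add: real_sqrt_divide)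
    qed
  qed
  have part2: "AE \<omega> in M. limsup (\<lambda>n. ereal ((pos_walk X \<epsilon> U n \<omega> - m1 * real n) / sqrt (2 * real n * ln (real n) * ln (ln (ln (real n))))))
      = ereal \<sigma>" if half: "p = 1 / 2"
  proof -
    have p: "0 < p" "p < 1" using half by simp_all
    interpret P: signed_reinforcement M p X \<epsilon> U 1 by (rule loc) (use p in auto)
    note v = pos_v[OF p] and mu = pos_\<mu>[OF p] and walk = pos[OF p]
    show ?thesis
    proof (cases "\<sigma> = 0")
      case True
      then have "P.m2 - P.\<mu>\<^sup>2 = 0" unfolding v by simp
      from P.limsup_degenerate[OF this] True show ?thesis unfolding mu walk by simp
    next
      case False
      then have v0: "0 < P.m2 - P.\<mu>\<^sup>2" unfolding v by simp
      have r: "p * 1 = 1 / 2" using half by simp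
      show ?thesis using P.lil_critical[OF v0 r, unfolded v, unfolded mu] sigma(1) unfolding walk by simp
    qed
  qed
  have part3: "AE \<omega> in M. limsup (\<lambda>n. ereal ((neg_walk X \<epsilon> U n \<omega> - \<mu>' * real n) / sqrt (2 * real n * ln (ln (real n)))))
      = ereal (\<sigma>' / sqrt (2 * p + 1))" if p: "0 < p" "p < 1"
  proof -
    interpret N: signed_reinforcement M p X \<epsilon> U "- 1" by (rule loc) (use p in auto)
    note v = neg_v[OF p] and mu = neg_\<mu>[OF p] and walk = neg[OF p]
    show ?thesis
    proof (cases "\<sigma>' = 0")
      case True
      then have "N.m2 - N.\<mu>\<^sup>2 = 0" unfolding v by simp
      from N.limsup_degenerate[OF this] True show ?thesis unfolding mu walk by simp
    next
      case False
      then have v0: "0 < N.m2 - N.\<mu>\<^sup>2" unfolding v by simp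
      \<comment> \<open>With the sign \<open>- 1\<close> every \<open>p\<close> in
        \<open>(0, 1)\<close> is subcritical, and \<open>1 - 2 * (p * s)\<close> becomes
        \<open>1 + 2 * p\<close>.\<close>
      have r: "p * - 1 < 1 / 2" using p by simp
      show ?thesis using N.lil_subcritical[OF v0 r, unfolded v, unfolded mu] neg_sigma(1) unfolding walk by (simp add: real_sqrt_divide add.commute)
    qed
  qed
  show ?thesis using part1 part2 part3 by blast
qed

end
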